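(* Let $(M,g)$ be a compact locally conformally flat Riemannian manifold without boundary, of even dimension $n\ge 6$. Then $(M,g)$ is $4$-Einstein if and only if it is $4$-Thorpe.
   Context: Double forms: for a Euclidean space $(V,g)$ of dimension $n$, a $(p,q)$ double form is an element of $\Lambda^pV^*\otimes\Lambda^qV^*$. The exterior product of double forms is $(\alpha_1\otimes\beta_1)(\alpha_2\otimes\beta_2)=(\alpha_1\wedge\alpha_2)\otimes(\beta_1\wedge\beta_2)$, and powers are taken for this product. The metric $g=\sum e^i\otimes e^i$ (with $(e_i)$ an orthonormal basis of $V$ and $(e^i)$ its dual basis) is a $(1,1)$ double form. The contraction $\mathbf{c}$ is $\mathbf{c}\omega(x_1,\dots;y_1,\dots)=\sum_i\omega(e_i,x_1,\dots;e_i,y_1,\dots)$. The (double) Hodge star is $\star(\theta_1\otimes\theta_2)=(\star\theta_1)\otimes(\star\theta_2)$. On a Riemannian manifold these notions are applied fibrewise. The Riemann curvature tensor $R$ is viewed as a symmetric $(2,2)$ double form, with sign such that $R(x\wedge y;x\wedge y)$ is the sectional curvature for orthonormal $x,y$; $R^2$ is its exterior square, a $(4,4)$ double form. $4$-Einstein: let $h_4=\mathbf{c}^4R^2/4!$. The metric $g$ is called $4$-Einstein if it is a critical point of $H_4(g)=\int_Mh_4\,\mathrm{dvol}_g$ restricted to unit volume metrics; the condition for this is taken to be that $h_4\,g-\frac{\mathbf{c}^3R^2}{3!}=\lambda g$ for some function $\lambda$, i.e. $\frac{\mathbf{c}^3R^2}{3!}=\frac{4}{n}h_4\,g$. $4$-Thorpe,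 $n=2r$: if $n\ge 8$, it means $\star(g^{r-4}R^2)=g^{r-4}R^2$. If $n=6$, then $R^2=g^2A$ for a unique symmetric $(2,2)$ double form $A$, and $4$-Thorpe means $\star(gA)=gA$. In both cases it is equivalent to the vanishing of all odd-index components $\omega_i$ in the orthogonal decomposition $R^2=\sum_{i=0}^{\min\{4,n-4\}}g^{4-i}\omega_i$, where the $\omega_i$ are the unique $(i,i)$ double forms with $\mathbf{c}\omega_i=0$. *)

theory Defs
  imports "HOL-Analysis.Analysis"
begin

section \<open>Double forms on a Euclidean space\<close>

text \<open>
  A Euclidean space is given by the coordinate space \<^typ>\<open>real^'n\<close> together with the Gram
  matrix \<open>G\<close> of an inner product. A \<open>p\<close>-form is a function on lists of vectors that is multilinear and
  alternating on lists of length \<open>p\<close> and vanishes on lists of any other length. A \<open>(p,q)\<close> double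
  form is a function of two lists, a \<open>p\<close>-form in the first and a \<open>q\<close>-form in the second. Because of
  the vanishing outside the bidegree, equality of double forms is equality of functions, and the
  operations below need not mention the bidegrees of their arguments.
\<close>

type_synonym 'n form = "(real^'n) list \<Rightarrow> real"
type_synonym 'n dform = "(real^'n) list \<Rightarrow> (real^'n) list \<Rightarrow> real"

definition is_form :: "nat \<Rightarrow> 'n::finite form \<Rightarrow> bool" where
  "is_form p \<theta> \<longleftrightarrow>
     (\<forall>xs. length xs \<noteq> p \<longrightarrow> \<theta> xs = 0) \<and>
     (\<forall>xs i. length xs = p \<longrightarrow> i < p \<longrightarrow> linear (\<lambda>v. \<theta> (xs[i := v]))) \<and>
     (\<forall>xs. \<not> distinct xs \<longrightarrow> \<theta> xs = 0)"

definition is_dform :: "nat \<Rightarrow> nat \<Rightarrow> 'n::finite dform \<Rightarrow> bool" where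
  "is_dform p q \<omega> \<longleftrightarrow>
     (\<forall>ys. is_form p (\<lambda>xs. \<omega> xs ys)) \<and> (\<forall>xs. is_form q (\<lambda>ys. \<omega> xs ys))"

definition symmetric_dform :: "'n::finite dform \<Rightarrow> bool" where
  "symmetric_dform \<omega> \<longleftrightarrow> (\<forall>xs ys. \<omega> xs ys = \<omega> ys xs)"

text \<open>
  The wedge product is the shuffle product (so that \<open>e\<^sup>1 \<and> e\<^sup>2\<close> takes the value \<open>1\<close> on
  \<open>e\<^sub>1, e\<^sub>2\<close>): \<open>I\<close> is the set of positions whose arguments go to the first factor. Only the sets
  \<open>I\<close> whose size is the degree of the first factor contribute.
\<close>

definition shuffle_sign :: "nat \<Rightarrow> nat set \<Rightarrow> real" where
  "shuffle_sign m I = (- 1) ^ card {(i, j). i \<in> I \<and> j \<in> {..<m} - I \<and> j < i}"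

definition wedge :: "'n::finite form \<Rightarrow> 'n form \<Rightarrow> 'n form" where
  "wedge \<alpha> \<beta> xs = (\<Sum>I\<in>Pow {..<length xs}.
     shuffle_sign (length xs) I * (\<alpha> (nths xs I) * \<beta> (nths xs (- I))))"

definition dprod :: "'n::finite dform \<Rightarrow> 'n dform \<Rightarrow> 'n dform" where
  "dprod \<omega> \<eta> xs ys =
     (\<Sum>I\<in>Pow {..<length xs}. \<Sum>J\<in>Pow {..<length ys}.
        shuffle_sign (length xs) I * shuffle_sign (length ys) J *
        (\<omega> (nths xs I) (nths ys J) * \<eta> (nths xs (- I)) (nths ys (- J))))"

text \<open>\<open>dprod\<close> is the bilinear extension of the rule on simple tensors:\<close>

lemma dprod_tensor:
  "dprod (\<lambda>xs ys. \<alpha>1 xs * \<beta>1 ys) (\<lambda>xs ys. \<alpha>2 xs * \<beta>2 ys) =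
     (\<lambda>xs ys. wedge \<alpha>1 \<alpha>2 xs * wedge \<beta>1 \<beta>2 ys)"
  by (simp add: fun_eq_iff dprod_def wedge_def sum_product mult_ac)

definition dunit :: "'n::finite dform" where
  "dunit xs ys = (if xs = [] \<and> ys = [] then 1 else 0)"

primrec dpower :: "'n::finite dform \<Rightarrow> nat \<Rightarrow> 'n dform" where
  "dpower \<omega> 0 = dunit"
| "dpower \<omega> (Suc k) = dprod \<omega> (dpower \<omega> k)"

definition ginner :: "real^'n^'n \<Rightarrow> real^'n::finite \<Rightarrow> real^'n \<Rightarrow> real" where
  "ginner G u v = u \<bullet> (G *v v)"

definition inner_product_matrix :: "real^'n::finite^'n \<Rightarrow> bool" where
  "inner_product_matrix G \<longleftrightarrow> transpose G = G \<and> (\<forall>v. v \<noteq> 0 \<longrightarrow> 0 < ginner G v v)"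

definition metric_dform :: "real^'n::finite^'n \<Rightarrow> 'n dform" where
  "metric_dform G xs ys = (case (xs, ys) of ([x], [y]) \<Rightarrow> ginner G x y | _ \<Rightarrow> 0)"

text \<open>
  An orthonormal basis \<open>e 0, \<dots>, e (n - 1)\<close>; the contraction and the double Hodge star of a
  double form do not depend on which one is chosen.
\<close>

definition onb :: "real^'n::finite^'n \<Rightarrow> nat \<Rightarrow> real^'n" where
  "onb G = (SOME e. \<forall>i<CARD('n). \<forall>j<CARD('n). ginner G (e i) (e j) = of_bool (i = j))"

definition contraction :: "real^'n::finite^'n \<Rightarrow> 'n dform \<Rightarrow> 'n dform" where
  "contraction G \<omega> xs ys = (\<Sum>i<CARD('n). \<omega> (onb G i # xs) (onb G i # ys))"

text \<open>The volume form for which \<^term>\<open>onb G\<close> is positively oriented.\<close>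

definition vol_form :: "real^'n::finite^'n \<Rightarrow> 'n form" where
  "vol_form G xs = (if length xs = CARD('n)
     then \<Sum>\<pi> | \<pi> permutes {..<CARD('n)}.
            of_int (sign \<pi>) * (\<Prod>i<CARD('n). ginner G (onb G (\<pi> i)) (xs ! i))
     else 0)"

definition onb_list :: "real^'n::finite^'n \<Rightarrow> nat set \<Rightarrow> (real^'n) list" where
  "onb_list G I = map (onb G) (sorted_list_of_set I)"

text \<open>
  For a \<open>p\<close>-form \<open>\<theta>\<close> only the sets \<open>I\<close> of size \<open>p\<close> contribute, so that this is the
  linear map with \<open>\<star> e\<^sup>I = \<plusminus> e\<^sup>J\<close>, \<open>J\<close> the complement of \<open>I\<close>, and
  \<open>e\<^sup>I \<and> \<star> e\<^sup>I\<close> the volume form.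
\<close>

definition hodge_form :: "real^'n::finite^'n \<Rightarrow> 'n form \<Rightarrow> 'n form" where
  "hodge_form G \<theta> xs =
     (\<Sum>I\<in>Pow {..<CARD('n)}. \<theta> (onb_list G I) * vol_form G (onb_list G I @ xs))"

definition hodge :: "real^'n::finite^'n \<Rightarrow> 'n dform \<Rightarrow> 'n dform" where
  "hodge G \<omega> xs ys =
     (\<Sum>I\<in>Pow {..<CARD('n)}. \<Sum>J\<in>Pow {..<CARD('n)}. \<omega> (onb_list G I) (onb_list G J) *
        (vol_form G (onb_list G I @ xs) * vol_form G (onb_list G J @ ys)))"

lemma hodge_tensor:
  "hodge G (\<lambda>xs ys. \<alpha> xs * \<beta> ys) = (\<lambda>xs ys. hodge_form G \<alpha> xs * hodge_form G \<beta> ys)"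
  by (simp add: fun_eq_iff hodge_def hodge_form_def sum_product mult_ac)


section \<open>Smooth manifolds\<close>

text \<open>Continuous derivatives of all orders on an open set.\<close>

primrec Ck_on :: "nat \<Rightarrow> (real^'n::finite) set \<Rightarrow> (real^'n \<Rightarrow> 'b::real_normed_vector) \<Rightarrow> bool" where
  "Ck_on 0 S f \<longleftrightarrow> continuous_on S f"
| "Ck_on (Suc k) S f \<longleftrightarrow>
     (\<forall>x\<in>S. f differentiable (at x)) \<and>
     (\<forall>v. Ck_on k S (\<lambda>x. frechet_derivative f (at x) v))"

definition smooth_on :: "(real^'n::finite) set \<Rightarrow> (real^'n \<Rightarrow> 'b::real_normed_vector) \<Rightarrow> bool" where
  "smooth_on S f \<longleftrightarrow> (\<forall>k. Ck_on k S f)"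

text \<open>
  A chart is a domain together with a map that is only relevant on the domain. Its image is an open
  subset of the coordinate space (not of a half-space), so the manifolds have no boundary.
\<close>

type_synonym ('a, 'n) chart = "'a set \<times> ('a \<Rightarrow> real^'n)"

abbreviation chart_dom :: "('a, 'n::finite) chart \<Rightarrow> 'a set" where
  "chart_dom \<equiv> fst"

abbreviation coord :: "('a, 'n::finite) chart \<Rightarrow> 'a \<Rightarrow> real^'n" where
  "coord \<equiv> snd"

definition transition :: "('a, 'n::finite) chart \<Rightarrow> ('a, 'n) chart \<Rightarrow> real^'n \<Rightarrow> real^'n" where
  "transition c d = coord d \<circ> inv_into (chart_dom c) (coord c)"

definition is_chart :: "'a topology \<Rightarrow> ('a, 'n::finite) chart \<Rightarrow> bool" where
  "is_chart X c \<longleftrightarrow>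
     openin X (chart_dom c) \<and> open (coord c ` chart_dom c) \<and>
     homeomorphic_map (subtopology X (chart_dom c))
       (top_of_set (coord c ` chart_dom c)) (coord c)"

definition smoothly_compatible :: "('a, 'n::finite) chart \<Rightarrow> ('a, 'n) chart \<Rightarrow> bool" where
  "smoothly_compatible c d \<longleftrightarrow>
     smooth_on (coord c ` (chart_dom c \<inter> chart_dom d)) (transition c d) \<and>
     smooth_on (coord d ` (chart_dom c \<inter> chart_dom d)) (transition d c)"

text \<open>The manifold is the topological space \<open>X\<close> with the smooth structure given by the atlas \<open>A\<close>.\<close>

locale smooth_manifold =
  fixes X :: "'a topology" and A :: "('a, 'n::finite) chart set"
  assumes hausdorff: "Hausdorff_space X"
    and second_countable: "second_countable X"
    and charts: "c \<in> A \<Longrightarrow> is_chart X c"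
    and cover: "(\<Union>c\<in>A. chart_dom c) = topspace X"
    and compatible: "c \<in> A \<Longrightarrow> d \<in> A \<Longrightarrow> smoothly_compatible c d"

text \<open>
  A Riemannian metric is given by its coordinate representations: \<open>g c x\<close> is the Gram matrix of the
  inner product on the tangent space at the point with coordinates \<open>x\<close> in the chart \<open>c\<close>, in the
  basis of coordinate vector fields of \<open>c\<close>.
\<close>

type_synonym ('a, 'n) metric = "('a, 'n) chart \<Rightarrow> real^'n \<Rightarrow> real^'n^'n"

locale riemannian_manifold = smooth_manifold X A
  for X :: "'a topology" and A :: "('a, 'n::finite) chart set" +
  fixes g :: "('a, 'n) metric"
  assumes inner_product:
      "c \<in> A \<Longrightarrow> x \<in> coord c ` chart_dom c \<Longrightarrow> inner_product_matrix (g c x)"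
    and smooth: "c \<in> A \<Longrightarrow> smooth_on (coord c ` chart_dom c) (g c)"
    and change_of_chart:
      "c \<in> A \<Longrightarrow> d \<in> A \<Longrightarrow> p \<in> chart_dom c \<inter> chart_dom d \<Longrightarrow>
        J = frechet_derivative (transition c d) (at (coord c p)) \<Longrightarrow>
        ginner (g c (coord c p)) u v = ginner (g d (coord d p)) (J u) (J v)"

text \<open>
  Locally conformally flat: every point has an open neighbourhood with a conformal diffeomorphism
  onto an open subset of Euclidean space. The diffeomorphism is the coordinate map of a chart \<open>d\<close> of
  the smooth structure (not necessarily in \<open>A\<close>), the conformal factor is \<open>exp (2 f)\<close>.
\<close>

definition locally_conformally_flat ::
    "'a topology \<Rightarrow> ('a, 'n::finite) chart set \<Rightarrow> ('a, 'n) metric \<Rightarrow> bool" where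
  "locally_conformally_flat X A g \<longleftrightarrow>
     (\<forall>p\<in>topspace X. \<exists>d f.
        is_chart X d \<and> (\<forall>c\<in>A. smoothly_compatible c d) \<and> p \<in> chart_dom d \<and>
        smooth_on (coord d ` chart_dom d) (f :: real^'n \<Rightarrow> real) \<and>
        (\<forall>c\<in>A. \<forall>q\<in>chart_dom c \<inter> chart_dom d. \<forall>u v.
           let J = frechet_derivative (transition c d) (at (coord c q)) in
             ginner (g c (coord c q)) u v = exp (2 * f (coord d q)) * (J u \<bullet> J v)))"


section \<open>Curvature\<close>

definition partial :: "'n \<Rightarrow> (real^'n::finite \<Rightarrow> real) \<Rightarrow> real^'n \<Rightarrow> real" where
  "partial i f x = frechet_derivative f (at x) (axis i 1)"

text \<open>\<open>christoffel G l i j\<close> is \<open>\<Gamma>\<^sup>l\<^sub>i\<^sub>j\<close>, the Levi-Civita connection in coordinates.\<close>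

definition christoffel ::
    "(real^'n \<Rightarrow> real^'n^'n) \<Rightarrow> 'n \<Rightarrow> 'n \<Rightarrow> 'n \<Rightarrow> real^'n::finite \<Rightarrow> real" where
  "christoffel G l i j x = 1 / 2 * (\<Sum>m\<in>UNIV. matrix_inv (G x) $ l $ m *
     (partial i (\<lambda>y. G y $ j $ m) x + partial j (\<lambda>y. G y $ i $ m) x
       - partial m (\<lambda>y. G y $ i $ j) x))"

text \<open>
  \<open>curvature_coeff G l i j k\<close> is the \<open>l\<close>-th component of
  \<open>\<nabla>\<^sub>i \<nabla>\<^sub>j \<partial>\<^sub>k - \<nabla>\<^sub>j \<nabla>\<^sub>i \<partial>\<^sub>k\<close>.
\<close>

definition curvature_coeff ::
    "(real^'n \<Rightarrow> real^'n^'n) \<Rightarrow> 'n \<Rightarrow> 'n \<Rightarrow> 'n \<Rightarrow> 'n \<Rightarrow> real^'n::finite \<Rightarrow> real" where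
  "curvature_coeff G l i j k x =
     partial i (christoffel G l j k) x - partial j (christoffel G l i k) x +
     (\<Sum>m\<in>UNIV. christoffel G l i m x * christoffel G m j k x
                - christoffel G l j m x * christoffel G m i k x)"

definition curvature_operator ::
    "(real^'n \<Rightarrow> real^'n^'n) \<Rightarrow> real^'n \<Rightarrow> real^'n \<Rightarrow> real^'n \<Rightarrow> real^'n \<Rightarrow> real^'n::finite" where
  "curvature_operator G x u v w =
     (\<chi> l. \<Sum>i\<in>UNIV. \<Sum>j\<in>UNIV. \<Sum>k\<in>UNIV. curvature_coeff G l i j k x * u $ i * v $ j * w $ k)"

text \<open>
  The sign is such that \<open>R(u,v;u,v)\<close>, the inner product of \<open>R(u,v)v\<close> and \<open>u\<close>, is the sectional
  curvature for orthonormal \<open>u, v\<close>.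
\<close>

definition riemann :: "(real^'n \<Rightarrow> real^'n^'n) \<Rightarrow> real^'n::finite \<Rightarrow> 'n dform" where
  "riemann G x us vs = (case (us, vs) of
     ([u1, u2], [v1, v2]) \<Rightarrow> ginner (G x) (curvature_operator G x u1 u2 v2) v1 | _ \<Rightarrow> 0)"


section \<open>Metrics that are 4-Einstein or 4-Thorpe\<close>

text \<open>The fibrewise notions, for an inner product \<open>G\<close> and a \<open>(2,2)\<close> double form \<open>R\<close>.\<close>

definition h4 :: "real^'n::finite^'n \<Rightarrow> 'n dform \<Rightarrow> real" where
  "h4 G R = (contraction G ^^ 4) (dpower R 2) [] [] / fact 4"

definition einstein4_at :: "real^'n::finite^'n \<Rightarrow> 'n dform \<Rightarrow> real \<Rightarrow> bool" where
  "einstein4_at G R \<mu> \<longleftrightarrow>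
     (\<forall>xs ys. h4 G R * metric_dform G xs ys - (contraction G ^^ 3) (dpower R 2) xs ys / fact 3
        = \<mu> * metric_dform G xs ys)"

text \<open>For \<open>n = 6\<close> the double form \<open>B\<close> is unique if it exists.\<close>

definition thorpe4_at :: "real^'n::finite^'n \<Rightarrow> 'n dform \<Rightarrow> bool" where
  "thorpe4_at G R \<longleftrightarrow>
     (if CARD('n) = 6 then
        \<exists>B. is_dform 2 2 B \<and> symmetric_dform B \<and>
            dpower R 2 = dprod (dpower (metric_dform G) 2) B \<and>
            hodge G (dprod (metric_dform G) B) = dprod (metric_dform G) B
      else
        let \<omega> = dprod (dpower (metric_dform G) (CARD('n) div 2 - 4)) (dpower R 2) in
          hodge G \<omega> = \<omega>)"

definition einstein4 :: "('a, 'n::finite) chart set \<Rightarrow> ('a, 'n) metric \<Rightarrow> bool" where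
  "einstein4 A g \<longleftrightarrow> (\<exists>\<mu> :: 'a \<Rightarrow> real. \<forall>c\<in>A. \<forall>p\<in>chart_dom c.
     einstein4_at (g c (coord c p)) (riemann (g c) (coord c p)) (\<mu> p))"

text \<open>The second notion is only meant for even dimension at least \<open>6\<close>.\<close>

definition thorpe4 :: "('a, 'n::finite) chart set \<Rightarrow> ('a, 'n) metric \<Rightarrow> bool" where
  "thorpe4 A g \<longleftrightarrow> (\<forall>c\<in>A. \<forall>p\<in>chart_dom c.
     thorpe4_at (g c (coord c p)) (riemann (g c) (coord c p)))"

end

theory Submission
  imports Defs
begin

text \<open>
  In a conformally flat chart the curvature is \<open>R = g h\<close>, where \<open>h\<close> is the Schouten tensor. Choose an
  orthonormal basis of the tangent space in which \<open>h\<close> is diagonal, with eigenvalues \<open>l i\<close>. Then all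
  double forms in question are combinations of \<open>e\<^sup>I \<otimes> e\<^sup>I\<close>, and on their coefficients the exterior
  product is subset convolution, the contraction is a sum over the possible new elements, and the
  Hodge star is passage to the complement. In particular \<open>R\<^sup>2\<close> has the coefficient \<open>4 e\<^sub>2(l|I)\<close> at
  every \<open>I\<close> with four elements, \<open>e\<^sub>2\<close> being the second elementary symmetric function. With
  \<open>s\<close> the sum of all eigenvalues, 4-Einstein means that \<open>l i * (s - l i)\<close> is a constant \<open>m\<close>. Summing
  over a set \<open>I\<close> of size \<open>r = n / 2\<close> gives \<open>2 e\<^sub>2(l|I) = r m - s\<^sub>I s\<^sub>J\<close>, where \<open>J\<close> is the
  complement and \<open>s\<^sub>I, s\<^sub>J\<close> are the partial sums; this is symmetric in \<open>I\<close> and \<open>J\<close>, which is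
  4-Thorpe. Conversely, summing the 4-Thorpe equations over all \<open>I\<close> that contain \<open>i\<close> shows that the
  diagonal entries of \<open>c\<^sup>3R\<^sup>2\<close> agree.
\<close>

section \<open>Alternating forms\<close>

text \<open>The operations \<open>contraction\<close> and \<open>hodge\<close> refer to the fixed
  basis \<open>onb G\<close>, which is chosen without regard to the curvature, while the argument
  needs a basis in which \<open>h\<close> is diagonal. Both are therefore shown to give the same
  result in every orthonormal basis. For the Hodge star this rests on the invariance of the inner
  product of \<open>p\<close>-forms; the orientation drops out because the volume form occurs once
  in each slot. The conformally flat chart need not belong to the atlas in which the metric is
  given. Instead of transforming the curvature between charts, the Christoffel symbols are computed
  in the given chart after its coordinate fields have been pushed forward to Euclidean space.
  Dimension 6 is special because the squared curvature has degree 4, above the middle degree 3, so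
  that a factor of the metric must be divided out. In one direction \<open>h h\<close> is an
  explicit quotient; in the other only the existence of some \<open>B\<close> is given, and only its
  diagonal entries are used.\<close>

lemma is_form_other: "is_form p \<theta> \<Longrightarrow> length xs \<noteq> p \<Longrightarrow> \<theta> xs = 0"
  by (simp add: is_form_def)

lemma is_form_not_distinct: "is_form p \<theta> \<Longrightarrow> \<not> distinct xs \<Longrightarrow> \<theta> xs = 0"
  by (simp add: is_form_def)

lemma linear_const_zero: "linear (\<lambda>_. 0)"
  by (simp add: linear_iff)

lemma linear_cmul_real: "linear f \<Longrightarrow> linear (\<lambda>v. c * f v)" for c :: real
  using linear_compose_scale_right[of f c] by simp

text \<open>Holds for lists of any length: off the degree \<open>p\<close> the map is constantly
  zero, which is linear too. This frees later linearity arguments from degree bookkeeping.\<close>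

lemma is_form_linear:
  assumes "is_form p \<theta>"
  shows "linear (\<lambda>v. \<theta> (as @ v # bs))"
proof (cases "length (as @ undefined # bs) = p")
  case True
  moreover have "\<forall>xs i. length xs = p \<longrightarrow> i < p \<longrightarrow> linear (\<lambda>v. \<theta> (xs[i := v]))"
    using assms unfolding is_form_def by blast
  moreover have "length as < p" using True by simp
  ultimately have "linear (\<lambda>v. \<theta> ((as @ undefined # bs)[length as := v]))" by blast
  then show ?thesis by simp
next
  case False
  then have "(\<lambda>v. \<theta> (as @ v # bs)) = (\<lambda>_. 0)"
    using assms unfolding is_form_def by auto
  then show ?thesis by (simp add: linear_const_zero)
qed

text \<open>Polarization: the value with \<open>x + y\<close> in both adjacent slots vanishes, and
  expanding it leaves only the two mixed terms.\<close>

lemma is_form_swap: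
  assumes "is_form p \<theta>"
  shows "\<theta> (as @ x # y # bs) = - \<theta> (as @ y # x # bs)"
proof -
  interpret a: linear "\<lambda>v. \<theta> (as @ v # (x + y) # bs)" using is_form_linear[OF assms] .
  have b: "\<theta> (as @ u # (x + y) # bs) = \<theta> (as @ u # x # bs) + \<theta> (as @ u # y # bs)" for u
    using linear_add[OF is_form_linear[OF assms, of "as @ [u]" bs], of x y] by simp
  have z: "\<theta> (as @ u # u # bs) = 0" for u using is_form_not_distinct[OF assms] by simp
  show ?thesis using a.add[of x y] b[of x] b[of y] z[of x] z[of y] z[of "x + y"] by simp
qed

text \<open>Vanishing on adjacent equal arguments suffices: such a function is antisymmetric under
  adjacent transpositions, which move any two equal arguments next to each other.\<close>

lemma is_formI:
  assumes other: "\<And>xs. length xs \<noteq> p \<Longrightarrow> \<theta> xs = 0"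
    and lin: "\<And>as bs. linear (\<lambda>v. \<theta> (as @ v # bs))"
    and adj: "\<And>as x bs. \<theta> (as @ x # x # bs) = 0"
  shows "is_form p \<theta>"
proof -
  have swap: "\<theta> (as @ x # y # bs) = - \<theta> (as @ y # x # bs)" for as x y bs
  proof -
    have a: "\<theta> (as @ (x + y) # (x + y) # bs) = \<theta> (as @ x # (x + y) # bs) + \<theta> (as @ y # (x + y) # bs)"
      using linear_add[OF lin[of as "(x + y) # bs"], of x y] by simp
    have b: "\<theta> (as @ u # (x + y) # bs) = \<theta> (as @ u # x # bs) + \<theta> (as @ u # y # bs)" for u
      using linear_add[OF lin[of "as @ [u]" bs], of x y] by simp
    show ?thesis using a b[of x] b[of y] adj by simp
  qed
  have far: "\<theta> (as @ x # bs @ x # cs) = 0" for as x bs cs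
  proof (induction bs arbitrary: as)
    case Nil
    then show ?case using adj by simp
  next
    case (Cons b bs)
    show ?case using swap[of as x b "bs @ x # cs"] Cons[of "as @ [b]"] by simp
  qed
  have "\<theta> xs = 0" if "\<not> distinct xs" for xs
    using not_distinct_decomp[OF that] far by auto
  moreover have "linear (\<lambda>v. \<theta> (xs[i := v]))" if "i < length xs" for xs i
    using lin[of "take i xs" "drop (Suc i) xs"] that by (simp add: upd_conv_take_nth_drop)
  ultimately show ?thesis unfolding is_form_def using other by auto
qed

lemma is_form_zero: "is_form p (\<lambda>_. 0)"
  by (rule is_formI) (auto simp: linear_const_zero)

lemma is_form_scale: "is_form p \<theta> \<Longrightarrow> is_form p (\<lambda>xs. c * \<theta> xs)"
  by (rule is_formI)
    (simp_all add: is_form_other is_form_not_distinct linear_cmul_real is_form_linear)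

lemma is_form_add: "is_form p \<theta> \<Longrightarrow> is_form p \<eta> \<Longrightarrow> is_form p (\<lambda>xs. \<theta> xs + \<eta> xs)"
  by (rule is_formI) (simp_all add: is_form_other is_form_not_distinct linear_compose_add is_form_linear)

lemma is_form_diff: "is_form p \<theta> \<Longrightarrow> is_form p \<eta> \<Longrightarrow> is_form p (\<lambda>xs. \<theta> xs - \<eta> xs)"
  using is_form_add[OF _ is_form_scale[of p \<eta> "- 1"]] by simp

lemma is_form_sum: "(\<And>i. i \<in> S \<Longrightarrow> is_form p (\<theta> i)) \<Longrightarrow> is_form p (\<lambda>xs. \<Sum>i\<in>S. \<theta> i xs)"
  by (induction S rule: infinite_finite_induct) (auto intro: is_form_zero is_form_add)

lemma is_form_append: "is_form (length us + p) \<theta> \<Longrightarrow> is_form p (\<lambda>xs. \<theta> (us @ xs))"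
  apply (rule is_formI)
    apply (simp add: is_form_other)
   subgoal for as bs using is_form_linear[of "length us + p" \<theta> "us @ as" bs] by simp
  apply (simp add: is_form_not_distinct)
  done

lemma is_form_Cons: "is_form (Suc p) \<theta> \<Longrightarrow> is_form p (\<lambda>xs. \<theta> (x # xs))"
  using is_form_append[of "[x]" p \<theta>] by simp

text \<open>Truncated subtraction is harmless at \<open>p = 0\<close>: a \<open>0\<close>-form
  vanishes on every nonempty list, so the function on the right is zero.\<close>

lemma is_form_Cons': "is_form p \<theta> \<Longrightarrow> is_form (p - 1) (\<lambda>xs. \<theta> (x # xs))"
  by (cases p) (auto intro: is_form_Cons is_form_zero simp: is_form_other)

lemma linear_sum_form: "is_form p \<theta> \<Longrightarrow> \<theta> ((\<Sum>i\<in>S. c i *\<^sub>R v i) # xs) = (\<Sum>i\<in>S. c i * \<theta> (v i # xs))"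
  using linear_sum[OF is_form_linear[of p \<theta> "[]" xs], of "\<lambda>i. c i *\<^sub>R v i" S]
    linear_cmul[OF is_form_linear[of p \<theta> "[]" xs]]
  by simp

section \<open>Exterior products\<close>

lemma sum_Pow_insert:
  assumes "finite A" "a \<notin> A"
  shows "(\<Sum>I\<in>Pow (insert a A). f I) = (\<Sum>I\<in>Pow A. f I) + (\<Sum>I\<in>Pow A. (f (insert a I) :: 'b::comm_monoid_add))"
proof -
  have "inj_on (insert a) (Pow A)" using assms(2) by (auto simp: inj_on_def)
  then show ?thesis unfolding Pow_insert using assms
    by (subst sum.union_disjoint) (auto simp: sum.reindex)
qed

text \<open>The sign counts pairs of a position in the set and a smaller position outside it.
  Position \<open>0\<close> inside the set adds no such pair; outside, it adds one for every element
  of \<open>I\<close>.\<close>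

lemma shuffle_sign_Suc:
  assumes "I \<subseteq> {..<m}"
  shows "shuffle_sign (Suc m) (insert 0 (Suc ` I)) = shuffle_sign m I"
    and "shuffle_sign (Suc m) (Suc ` I) = (- 1) ^ card I * shuffle_sign m I"
proof -
  have fin: "finite I" using assms finite_subset by blast
  have fin2: "finite {(i, j). i \<in> I \<and> j \<in> {..<m} - I \<and> j < i}"
    by (rule finite_subset[of _ "I \<times> {..<m}"]) (use fin in auto)
  have "{(i, j). i \<in> insert 0 (Suc ` I) \<and> j \<in> {..<Suc m} - insert 0 (Suc ` I) \<and> j < i} =
     map_prod Suc Suc ` {(i, j). i \<in> I \<and> j \<in> {..<m} - I \<and> j < i}" (is "?A = map_prod Suc Suc ` ?B")
  proof (intro equalityI subsetI)
    fix z assume "z \<in> ?A"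
    then obtain i j where z: "z = (i, j)" "i \<in> insert 0 (Suc ` I)" "j \<in> {..<Suc m} - insert 0 (Suc ` I)" "j < i" by auto
    then obtain i' j' where "i = Suc i'" "j = Suc j'" by (cases i; cases j) auto
    then show "z \<in> map_prod Suc Suc ` ?B" using z by (auto intro!: image_eqI[where x = "(i', j')"])
  qed auto
  then have "card ?A = card ?B" by (simp add: card_image inj_on_def)
  then show "shuffle_sign (Suc m) (insert 0 (Suc ` I)) = shuffle_sign m I"
    by (simp add: shuffle_sign_def)
  have "{(i, j). i \<in> Suc ` I \<and> j \<in> {..<Suc m} - Suc ` I \<and> j < i} =
     map_prod Suc Suc ` ?B \<union> (\<lambda>i. (Suc i, 0)) ` I" (is "?C = ?D")
  proof (intro equalityI subsetI)
    fix z assume "z \<in> ?C"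
    then obtain i j where z: "z = (i, j)" "i \<in> Suc ` I" "j \<in> {..<Suc m} - Suc ` I" "j < i" by auto
    then obtain i' where "i = Suc i'" by (cases i) auto
    then show "z \<in> ?D" using z
      by (cases j) (auto intro!: image_eqI[where x = "(i', j - 1)"])
  qed auto
  then have "card ?C = card (map_prod Suc Suc ` ?B) + card ((\<lambda>i. (Suc i, 0::nat)) ` I)"
    using fin fin2 by (simp only:) (intro card_Un_disjoint; auto)
  also have "\<dots> = card ?B + card I" by (simp add: card_image inj_on_def)
  finally show "shuffle_sign (Suc m) (Suc ` I) = (- 1) ^ card I * shuffle_sign m I"
    by (simp add: shuffle_sign_def power_add)
qed

lemma shuffle_sign_square: "shuffle_sign m I * shuffle_sign m I = 1"
  by (simp add: shuffle_sign_def flip: power_mult_distrib)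

lemma wedge_Nil: "wedge \<alpha> \<beta> [] = \<alpha> [] * \<beta> []"
  by (simp add: wedge_def shuffle_sign_def)

text \<open>The Leibniz rule for inserting a vector: \<open>x\<close> goes to the first factor, or
  it moves past all arguments of the first factor into the second, at the cost of the sign
  \<open>(- 1) ^ length zs\<close>. Linearity and alternation of \<open>wedge\<close> are inductions
  along this recursion.\<close>

lemma wedge_Cons:
  "wedge \<alpha> \<beta> (x # xs) =
     wedge (\<lambda>zs. \<alpha> (x # zs)) \<beta> xs + wedge (\<lambda>zs. (- 1) ^ length zs * \<alpha> zs) (\<lambda>zs. \<beta> (x # zs)) xs"
proof -
  let ?n = "length xs"
  let ?f = "\<lambda>I. shuffle_sign (Suc ?n) I * (\<alpha> (nths (x # xs) I) * \<beta> (nths (x # xs) (- I)))"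
  have Pow: "Pow (Suc ` {..<?n}) = (`) Suc ` Pow {..<?n}" by (rule image_Pow_surj[symmetric]) simp
  have inj: "inj_on ((`) Suc) (Pow {..<?n})" by (simp add: inj_on_def inj_image_eq_iff)
  have "wedge \<alpha> \<beta> (x # xs) = (\<Sum>I\<in>Pow (insert 0 (Suc ` {..<?n})). ?f I)"
    by (simp add: wedge_def lessThan_Suc_eq_insert_0)
  also have "\<dots> = (\<Sum>I\<in>Pow (Suc ` {..<?n}). ?f (insert 0 I)) + (\<Sum>I\<in>Pow (Suc ` {..<?n}). ?f I)"
    by (subst sum_Pow_insert) auto
  also have "\<dots> = (\<Sum>I\<in>Pow {..<?n}. ?f (insert 0 (Suc ` I))) + (\<Sum>I\<in>Pow {..<?n}. ?f (Suc ` I))"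
    unfolding Pow using inj by (simp add: sum.reindex)
  also have "(\<Sum>I\<in>Pow {..<?n}. ?f (insert 0 (Suc ` I))) = wedge (\<lambda>zs. \<alpha> (x # zs)) \<beta> xs"
    unfolding wedge_def
  proof (rule sum.cong)
    fix I assume "I \<in> Pow {..<?n}"
    moreover have "{j. j \<in> I} = I" "{j. j \<notin> I} = - I" by auto
    ultimately show "?f (insert 0 (Suc ` I)) = shuffle_sign ?n I * (\<alpha> (x # nths xs I) * \<beta> (nths xs (- I)))"
      by (simp add: shuffle_sign_Suc nths_Cons image_iff)
  qed simp
  also have "(\<Sum>I\<in>Pow {..<?n}. ?f (Suc ` I)) =
      wedge (\<lambda>zs. (- 1) ^ length zs * \<alpha> zs) (\<lambda>zs. \<beta> (x # zs)) xs"
    unfolding wedge_def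
  proof (rule sum.cong)
    fix I assume I: "I \<in> Pow {..<?n}"
    then have "{i. i < ?n \<and> i \<in> I} = I" by auto
    then have "length (nths xs I) = card I" by (simp add: length_nths)
    moreover have "{j. j \<in> I} = I" "{j. j \<notin> I} = - I" by auto
    ultimately show "?f (Suc ` I) = shuffle_sign ?n I *
        ((- 1) ^ length (nths xs I) * \<alpha> (nths xs I) * \<beta> (x # nths xs (- I)))"
      using I by (simp add: shuffle_sign_Suc nths_Cons image_iff)
  qed simp
  finally show ?thesis .
qed

lemma wedge_scale_left: "wedge (\<lambda>zs. c * \<alpha> zs) \<beta> xs = c * wedge \<alpha> \<beta> xs"
  by (simp add: wedge_def sum_distrib_left mult_ac)

lemma wedge_zero: "wedge (\<lambda>_. 0) \<beta> xs = 0" "wedge \<alpha> (\<lambda>_. 0) xs = 0"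
  by (simp_all add: wedge_def)

text \<open>The factors are multilinear functions of no fixed degree, since the recursion replaces
  \<open>\<alpha>\<close> by a function with a length-dependent sign and the induction has to cover
  it.\<close>

lemma linear_wedge:
  assumes "\<And>as bs. linear (\<lambda>v. \<alpha> (as @ v # bs))" "\<And>as bs. linear (\<lambda>v. \<beta> (as @ v # bs))"
  shows "linear (\<lambda>v. wedge \<alpha> \<beta> (as @ v # bs))"
  using assms
proof (induction as arbitrary: \<alpha> \<beta>)
  case Nil
  have a: "linear (\<lambda>v. \<alpha> (v # zs))" and b: "linear (\<lambda>v. \<beta> (v # zs))" for zs
    using Nil(1)[of "[]" zs] Nil(2)[of "[]" zs] by auto
  show ?case unfolding append_Nil wedge_Cons unfolding wedge_def
    by (intro linear_compose_add linear_compose_sum ballI)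
      (simp_all add: linear_iff linear_add[OF a] linear_cmul[OF a] linear_add[OF b] linear_cmul[OF b] algebra_simps)
next
  case (Cons x as)
  have s: "linear (\<lambda>v. \<alpha> (x # as @ v # bs))" "linear (\<lambda>v. \<beta> (x # as @ v # bs))" for as bs
    using Cons.prems(1)[of "x # as" bs] Cons.prems(2)[of "x # as" bs] by auto
  have "linear (\<lambda>v. (- 1) ^ length (cs @ v # ds) * \<alpha> (cs @ v # ds))" for cs ds
    using linear_cmul_real[OF Cons.prems(1)[of cs ds], of "(- 1) ^ Suc (length cs + length ds)"]
    by simp
  then show ?case unfolding append_Cons wedge_Cons
    by (intro linear_compose_add Cons.IH s Cons.prems)
qed

text \<open>With two equal arguments in front, the recursion yields four terms. Both arguments in
  the same factor give zero; the two mixed terms differ by the sign of moving \<open>x\<close> past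
  one more argument and cancel.\<close>

lemma wedge_adjacent:
  assumes "\<And>as x bs. \<alpha> (as @ x # x # bs) = 0" "\<And>as x bs. \<beta> (as @ x # x # bs) = 0"
  shows "wedge \<alpha> \<beta> (as @ x # x # bs) = 0"
  using assms
proof (induction as arbitrary: \<alpha> \<beta>)
  case Nil
  then have "\<alpha> (x # x # zs) = 0" "\<beta> (x # x # zs) = 0" for zs
    by (metis append_Nil)+
  then show ?case using wedge_scale_left[of "- 1" "\<lambda>zs. (- 1) ^ length zs * \<alpha> (x # zs)"]
    by (simp add: wedge_Cons wedge_zero)
next
  case (Cons y as)
  have s: "\<alpha> (y # as @ x # x # bs) = 0" "\<beta> (y # as @ x # x # bs) = 0" for as x bs
    by (metis append_Cons Cons.prems)+
  show ?case unfolding append_Cons wedge_Cons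
    by (simp add: Cons s)
qed

lemma length_nths_Compl: "length (nths xs I) + length (nths xs (- I)) = length xs"
proof -
  have "card {i. i < length xs \<and> i \<in> I} + card {i. i < length xs \<and> i \<in> - I} =
      card ({i. i < length xs \<and> i \<in> I} \<union> {i. i < length xs \<and> i \<in> - I})"
    by (subst card_Un_disjoint) auto
  also have "{i. i < length xs \<and> i \<in> I} \<union> {i. i < length xs \<and> i \<in> - I} = {..<length xs}" by auto
  finally show ?thesis by (simp add: length_nths)
qed

lemma is_form_wedge:
  assumes "is_form p \<alpha>" "is_form q \<beta>"
  shows "is_form (p + q) (wedge \<alpha> \<beta>)"
proof (rule is_formI)
  fix xs :: "(real^'a) list" assume "length xs \<noteq> p + q"
  then have "length (nths xs I) \<noteq> p \<or> length (nths xs (- I)) \<noteq> q" for I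
    using length_nths_Compl[of xs I] by auto
  then have "\<alpha> (nths xs I) * \<beta> (nths xs (- I)) = 0" for I
    using is_form_other[OF assms(1), of "nths xs I"] is_form_other[OF assms(2), of "nths xs (- I)"] by auto
  then show "wedge \<alpha> \<beta> xs = 0" unfolding wedge_def by (simp only: mult_zero_right sum.neutral_const)
next
  show "linear (\<lambda>v. wedge \<alpha> \<beta> (as @ v # bs))" for as bs
    using assms by (intro linear_wedge is_form_linear)
next
  show "wedge \<alpha> \<beta> (as @ x # x # bs) = 0" for as x bs
    by (rule wedge_adjacent) (simp_all add: is_form_not_distinct[OF assms(1)] is_form_not_distinct[OF assms(2)])
qed

text \<open>For a fixed second list the product is a linear combination of wedges in the first list,
  so the form properties carry over from \<open>wedge\<close>; \<open>dprod_swap\<close> supplies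
  the second slot.\<close>

lemma dprod_eq_wedge:
  "dprod \<omega> \<eta> xs ys = (\<Sum>J\<in>Pow {..<length ys}. shuffle_sign (length ys) J *
     wedge (\<lambda>zs. \<omega> zs (nths ys J)) (\<lambda>zs. \<eta> zs (nths ys (- J))) xs)"
  unfolding dprod_def wedge_def
  by (subst sum.swap) (simp add: sum_distrib_left mult_ac)

lemma dprod_swap: "dprod \<omega> \<eta> xs ys = dprod (\<lambda>xs ys. \<omega> ys xs) (\<lambda>xs ys. \<eta> ys xs) ys xs"
  unfolding dprod_def by (subst sum.swap) (simp add: mult_ac)

lemma is_dform_dprod:
  assumes "is_dform p q \<omega>" "is_dform p' q' \<eta>"
  shows "is_dform (p + p') (q + q') (dprod \<omega> \<eta>)"
proof -
  have "is_form (p + p') (\<lambda>xs. dprod \<omega> \<eta> xs ys)" for ys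
    unfolding dprod_eq_wedge using assms
    by (intro is_form_sum is_form_scale is_form_wedge) (auto simp: is_dform_def)
  moreover
  have "is_form (q + q') (\<lambda>ys. dprod (\<lambda>xs ys. \<omega> ys xs) (\<lambda>xs ys. \<eta> ys xs) ys xs)" for xs
    unfolding dprod_eq_wedge using assms
    by (intro is_form_sum is_form_scale is_form_wedge) (auto simp: is_dform_def)
  then have "is_form (q + q') (dprod \<omega> \<eta> xs)" for xs
    using dprod_swap[of \<omega> \<eta> xs] by presburger
  ultimately show ?thesis by (simp add: is_dform_def)
qed

lemma is_dform_dunit: "is_dform 0 0 dunit"
  unfolding is_dform_def dunit_def is_form_def by (auto simp: linear_const_zero)

lemma is_dform_dpower: "is_dform p q \<omega> \<Longrightarrow> is_dform (k * p) (k * q) (dpower \<omega> k)"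
  by (induction k) (auto simp: is_dform_dunit intro: is_dform_dprod)

lemma symmetric_dprod:
  "symmetric_dform \<omega> \<Longrightarrow> symmetric_dform \<eta> \<Longrightarrow> symmetric_dform (dprod \<omega> \<eta>)"
proof -
  assume "symmetric_dform \<omega>" "symmetric_dform \<eta>"
  then have "(\<lambda>xs ys. \<omega> ys xs) = \<omega>" "(\<lambda>xs ys. \<eta> ys xs) = \<eta>"
    unfolding symmetric_dform_def fun_eq_iff by blast+
  then show ?thesis unfolding symmetric_dform_def using dprod_swap[of \<omega> \<eta>] by metis
qed

section \<open>Bases\<close>

definition basis_list :: "(nat \<Rightarrow> real^'n) \<Rightarrow> nat set \<Rightarrow> (real^'n::finite) list" where
  "basis_list e I = map e (sorted_list_of_set I)"

lemma onb_list_eq: "onb_list G I = basis_list (onb G) I"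
  by (simp add: onb_list_def basis_list_def)

lemma length_basis_list [simp]: "length (basis_list e I) = card I"
  by (simp add: basis_list_def)

text \<open>Moving \<open>x\<close> to its place in the sorted list takes one transposition for each
  smaller entry.\<close>

lemma is_form_insort:
  "is_form p \<theta> \<Longrightarrow> sorted (xs :: nat list) \<Longrightarrow>
     \<theta> (map e (x # xs)) = (- 1) ^ length (filter (\<lambda>y. y < x) xs) * \<theta> (map e (insort x xs))"
proof (induction xs arbitrary: p \<theta>)
  case Nil
  then show ?case by simp
next
  case (Cons y ys)
  show ?case
  proof (cases "x \<le> y")
    case True
    then have "filter (\<lambda>y. y < x) (y # ys) = []" using Cons.prems by (auto simp: filter_empty_conv)
    then show ?thesis using True by simp
  next
    case False
    have "\<theta> (map e (x # y # ys)) = - \<theta> (e y # map e (x # ys))"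
      using is_form_swap[OF Cons.prems(1), of "[]" "e x" "e y" "map e ys"] by simp
    also have "\<theta> (e y # map e (x # ys)) = (- 1) ^ length (filter (\<lambda>y. y < x) ys) * \<theta> (e y # map e (insort x ys))"
      using Cons.prems by (intro Cons.IH[of "p - 1" "\<lambda>zs. \<theta> (e y # zs)"] is_form_Cons') auto
    finally show ?thesis using False by simp
  qed
qed

lemma is_form_insert:
  assumes "is_form p \<theta>" "finite I" "i \<notin> I"
  shows "\<theta> (e i # basis_list e I) = (- 1) ^ card {j \<in> I. j < i} * \<theta> (basis_list e (insert i I))"
proof -
  have "length (filter (\<lambda>j. j < i) (sorted_list_of_set I)) = card {j \<in> I. j < i}"
    using assms(2) distinct_card[of "filter (\<lambda>j. j < i) (sorted_list_of_set I)"] by (simp add: conj_commute)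
  moreover have "sorted_list_of_set (insert i I) = insort i (sorted_list_of_set I)"
    using assms(2,3) by (rule sorted_list_of_set_insert)
  ultimately show ?thesis using is_form_insort[OF assms(1), of "sorted_list_of_set I" e i]
    by (simp add: basis_list_def)
qed

lemma is_form_insert_same:
  assumes "is_form p \<theta>" "finite I" "i \<in> I"
  shows "\<theta> (e i # basis_list e I) = 0"
  using assms by (intro is_form_not_distinct[OF assms(1)]) (auto simp: basis_list_def)

locale euclidean_frame =
  fixes G :: "real^'n::finite^'n" and e :: "nat \<Rightarrow> real^'n"
  assumes inner_product: "inner_product_matrix G"
    and orthonormal: "i < CARD('n) \<Longrightarrow> j < CARD('n) \<Longrightarrow> ginner G (e i) (e j) = of_bool (i = j)"

lemma ginner_linear:
  "ginner G (u + v) w = ginner G u w + ginner G v w"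
  "ginner G w (u + v) = ginner G w u + ginner G w v"
  "ginner G (c *\<^sub>R u) w = c * ginner G u w"
  "ginner G w (c *\<^sub>R u) = c * ginner G w u"
  "ginner G (u - v) w = ginner G u w - ginner G v w"
  "ginner G w (u - v) = ginner G w u - ginner G w v"
  "ginner G (sum f S) w = (\<Sum>i\<in>S. ginner G (f i) w)"
  "ginner G w (sum f S) = (\<Sum>i\<in>S. ginner G w (f i))"
  "ginner G 0 w = 0" "ginner G w 0 = 0"
  by (simp_all add: ginner_def inner_add_left inner_add_right inner_diff_left inner_diff_right
      matrix_vector_right_distrib matrix_vector_mult_diff_distrib inner_sum_left inner_sum_right
      matrix_vector_mult_scaleR scaleR_matrix_vector_assoc[symmetric]
      linear_sum[OF matrix_vector_mul_linear])

lemma linear_ginner: "linear (ginner G u)" "linear (\<lambda>v. ginner G v u)"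
  by (simp_all add: linear_iff ginner_linear)

lemma ginner_commute:
  assumes "inner_product_matrix G"
  shows "ginner G u v = ginner G v u"
proof -
  have "u \<bullet> (G *v v) = (transpose G *v u) \<bullet> v" by (metis dot_lmul_matrix vector_transpose_matrix transpose_transpose)
  then show ?thesis using assms unfolding ginner_def inner_product_matrix_def by (simp add: inner_commute)
qed

context euclidean_frame
begin

text \<open>Orthonormality makes the vectors distinct and independent, so they span by dimension,
  and pairing with \<open>e j\<close> reads off the coefficients.\<close>

lemma expansion: "v = (\<Sum>i<CARD('n). ginner G (e i) v *\<^sub>R e i)"
proof -
  have gs: "ginner G (e j) (\<Sum>i\<in>{..<CARD('n)}. c i *\<^sub>R e i) = c j" if "j < CARD('n)" for c j
    using that by (simp add: ginner_linear orthonormal)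
  have inj: "inj_on e {..<CARD('n)}"
  proof (rule inj_onI)
    fix i j assume *: "i \<in> {..<CARD('n)}" "j \<in> {..<CARD('n)}" "e i = e j"
    then have "ginner G (e i) (e j) = 1" using orthonormal[of i i] by simp
    then show "i = j" using * orthonormal[of i j] by (auto split: if_splits)
  qed
  have "independent (e ` {..<CARD('n)})"
  proof (rule ccontr)
    assume "\<not> independent (e ` {..<CARD('n)})"
    then obtain u where u: "\<exists>v\<in>e ` {..<CARD('n)}. u v \<noteq> 0" "(\<Sum>v\<in>e ` {..<CARD('n)}. u v *\<^sub>R v) = 0"
      by (auto simp: dependent_finite)
    then have "(\<Sum>i\<in>{..<CARD('n)}. u (e i) *\<^sub>R e i) = 0" using inj by (simp add: sum.reindex)
    then have "u (e j) = 0" if "j < CARD('n)" for j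
      using gs[OF that, of "\<lambda>i. u (e i)"] by (simp add: ginner_linear)
    then show False using u(1) by auto
  qed
  moreover have "card (e ` {..<CARD('n)}) = CARD('n)" using inj by (simp add: card_image)
  ultimately have "span (e ` {..<CARD('n)}) = UNIV"
    using card_eq_dim[of "e ` {..<CARD('n)}" UNIV] by auto
  then obtain u where u: "v = (\<Sum>w\<in>e ` {..<CARD('n)}. u w *\<^sub>R w)"
    using span_finite[of "e ` {..<CARD('n)}"] by auto
  then have v: "v = (\<Sum>i\<in>{..<CARD('n)}. u (e i) *\<^sub>R e i)" using inj by (simp add: sum.reindex)
  then have "u (e j) = ginner G (e j) v" if "j < CARD('n)" for j using gs[OF that] by simp
  with v show ?thesis by simp
qed

text \<open>The given frame shows that the choice in \<open>onb\<close> has a solution.\<close>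

lemma euclidean_frame_onb: "euclidean_frame G (onb G)"
proof -
  have "\<exists>f :: nat \<Rightarrow> real^'n. \<forall>i<CARD('n). \<forall>j<CARD('n). ginner G (f i) (f j) = of_bool (i = j)"
    using orthonormal by blast
  from someI_ex[OF this] show ?thesis
    unfolding euclidean_frame_def onb_def[symmetric] using inner_product by blast
qed

text \<open>Induction on the degree: with a basis vector in the first slot,
  \<open>is_form_insert\<close> leads back to an increasing list, so the induction hypothesis
  applies to the remaining slots; \<open>expansion\<close> then covers every first argument.\<close>

lemma form_eq_zero:
  assumes "is_form p \<theta>" "\<And>I. I \<subseteq> {..<CARD('n)} \<Longrightarrow> \<theta> (basis_list e I) = 0"
  shows "\<theta> xs = 0"
  using assms
proof (induction p arbitrary: \<theta> xs)
  case 0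
  then show ?case using "0.prems"(2)[of "{}"] by (cases xs) (auto simp: basis_list_def is_form_other)
next
  case (Suc p)
  have "\<theta> (e i # zs) = 0" if "i < CARD('n)" for i zs
  proof (rule Suc.IH[of "\<lambda>zs. \<theta> (e i # zs)"])
    show "\<theta> (e i # basis_list e I) = 0" if "I \<subseteq> {..<CARD('n)}" for I
      using Suc.prems that \<open>i < _\<close> finite_subset[OF that]
      by (cases "i \<in> I") (auto simp: is_form_insert is_form_insert_same)
  qed (use Suc.prems is_form_Cons in auto)
  then have "\<theta> (v # zs) = 0" for v zs
    using linear_sum_form[OF Suc.prems(1), of "\<lambda>i. ginner G (e i) v" e "{..<CARD('n)}" zs] expansion[of v] by simp
  then show ?case using Suc.prems by (cases xs) (auto simp: is_form_other)
qed

lemma dform_eqI: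
  assumes "is_dform p q \<omega>" "is_dform p q \<eta>"
    and "\<And>I J. I \<subseteq> {..<CARD('n)} \<Longrightarrow> J \<subseteq> {..<CARD('n)} \<Longrightarrow> \<omega> (basis_list e I) (basis_list e J) = \<eta> (basis_list e I) (basis_list e J)"
  shows "\<omega> = \<eta>"
proof -
  have f: "is_form p (\<lambda>xs. \<omega> xs ys - \<eta> xs ys)" "is_form q (\<lambda>ys. \<omega> xs ys - \<eta> xs ys)" for xs ys
    using assms(1,2) by (auto simp: is_dform_def intro!: is_form_diff)
  have "\<omega> (basis_list e I) ys - \<eta> (basis_list e I) ys = 0" if "I \<subseteq> {..<CARD('n)}" for I ys
    by (rule form_eq_zero[OF f(2)[of "basis_list e I"]]) (use assms(3)[OF that] in simp)
  then have "\<omega> xs ys - \<eta> xs ys = 0" for xs ys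
    using form_eq_zero[OF f(1)[of ys]] by blast
  then show ?thesis by (simp add: fun_eq_iff)
qed

text \<open>Every set of size \<open>Suc p\<close> arises in \<open>Suc p\<close> ways from an
  element \<open>i\<close> and the rest. The sign of sorting \<open>i\<close> into place occurs in
  both factors and squares to \<open>1\<close>. This allows the inner product of forms to be moved
  to another frame one slot at a time.\<close>

lemma sum_square_eq:
  assumes "is_form (Suc p) \<alpha>" "is_form (Suc p) \<beta>"
  shows "real (Suc p) * (\<Sum>I\<in>Pow {..<CARD('n)}. \<alpha> (basis_list e I) * \<beta> (basis_list e I)) =
    (\<Sum>i\<in>{..<CARD('n)}. \<Sum>I\<in>Pow {..<CARD('n)}. \<alpha> (e i # basis_list e I) * \<beta> (e i # basis_list e I))"
proof -
  let ?f = "\<lambda>I. \<alpha> (basis_list e I) * \<beta> (basis_list e I)"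
  let ?P = "{K \<in> Pow {..<CARD('n)}. card K = Suc p}"
  have "(\<Sum>I\<in>Pow {..<CARD('n)}. \<alpha> (e i # basis_list e I) * \<beta> (e i # basis_list e I)) = (\<Sum>K\<in>Pow {..<CARD('n)}. of_bool (i \<in> K) * ?f K)"
    if i: "i \<in> {..<CARD('n)}" for i
  proof -
    have "(\<Sum>I\<in>Pow {..<CARD('n)}. \<alpha> (e i # basis_list e I) * \<beta> (e i # basis_list e I)) =
        (\<Sum>I\<in>Pow {..<CARD('n)}. of_bool (i \<notin> I) * ?f (insert i I))"
    proof (rule sum.cong)
      fix I assume "I \<in> Pow {..<CARD('n)}"
      then have fin: "finite I" using finite_subset by blast
      have "(- 1) ^ card {j \<in> I. j < i} * (- 1) ^ card {j \<in> I. j < i} = (1::real)"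
        by (simp flip: power_mult_distrib)
      then show "\<alpha> (e i # basis_list e I) * \<beta> (e i # basis_list e I) = of_bool (i \<notin> I) * ?f (insert i I)"
        using is_form_insert_same[OF assms(1) fin] is_form_insert[OF assms(1) fin] is_form_insert[OF assms(2) fin]
        by (cases "i \<in> I") (auto simp: algebra_simps)
    qed simp
    also have "\<dots> = (\<Sum>I\<in>{I \<in> Pow {..<CARD('n)}. i \<notin> I}. ?f (insert i I))"
      by (rule sum.mono_neutral_cong_right) auto
    also have "\<dots> = (\<Sum>K\<in>{K \<in> Pow {..<CARD('n)}. i \<in> K}. ?f K)"
      by (rule sum.reindex_bij_witness[of _ "\<lambda>K. K - {i}" "insert i"]) (use i in \<open>auto simp: insert_absorb\<close>)
    also have "\<dots> = (\<Sum>K\<in>Pow {..<CARD('n)}. of_bool (i \<in> K) * ?f K)"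
      by (rule sum.mono_neutral_cong_left) auto
    finally show ?thesis .
  qed
  then have "(\<Sum>i\<in>{..<CARD('n)}. \<Sum>I\<in>Pow {..<CARD('n)}. \<alpha> (e i # basis_list e I) * \<beta> (e i # basis_list e I)) =
      (\<Sum>i\<in>{..<CARD('n)}. \<Sum>K\<in>Pow {..<CARD('n)}. of_bool (i \<in> K) * ?f K)" by simp
  also have "\<dots> = (\<Sum>K\<in>Pow {..<CARD('n)}. (\<Sum>i\<in>{..<CARD('n)}. of_bool (i \<in> K)) * ?f K)"
    by (subst sum.swap) (simp add: sum_distrib_right)
  also have "\<dots> = (\<Sum>K\<in>Pow {..<CARD('n)}. real (Suc p) * ?f K)"
  proof (rule sum.cong)
    fix K assume K: "K \<in> Pow {..<CARD('n)}"
    then have "(\<Sum>i\<in>{..<CARD('n)}. of_bool (i \<in> K)) = real (card K)"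
      by (simp add: Int_absorb1 flip: Int_def)
    then show "(\<Sum>i\<in>{..<CARD('n)}. of_bool (i \<in> K)) * ?f K = real (Suc p) * ?f K"
      using assms(1) by (cases "card K = Suc p") (auto simp: is_form_other)
  qed simp
  finally show ?thesis by (simp add: sum_distrib_left)
qed

text \<open>The invariance of a trace: expanding \<open>f\<close> in the new frame and reassembling
  \<open>h\<close> from the old one converts one sum into the other.\<close>

lemma sum_bilinear_frame:
  assumes "euclidean_frame G e'" "linear f" "linear (h :: real^'n \<Rightarrow> real)"
  shows "(\<Sum>i\<in>{..<CARD('n)}. f (e i) * h (e i)) = (\<Sum>i\<in>{..<CARD('n)}. f (e' i) * h (e' i))"
proof -
  interpret e': euclidean_frame G e' by fact
  have f: "f v = (\<Sum>j\<in>{..<CARD('n)}. ginner G (e' j) v * f (e' j))" if "linear f" for f :: "real^'n \<Rightarrow> real" and v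
    by (subst e'.expansion[of v]) (simp add: linear_sum[OF that] linear_cmul[OF that])
  have "(\<Sum>i\<in>{..<CARD('n)}. f (e i) * h (e i)) = (\<Sum>i\<in>{..<CARD('n)}. \<Sum>j\<in>{..<CARD('n)}. ginner G (e i) (e' j) * f (e' j) * h (e i))"
    by (subst f[OF assms(2)]) (simp add: sum_distrib_right ginner_commute[OF inner_product])
  also have "\<dots> = (\<Sum>j\<in>{..<CARD('n)}. f (e' j) * (\<Sum>i\<in>{..<CARD('n)}. ginner G (e i) (e' j) * h (e i)))"
    by (subst sum.swap) (simp add: sum_distrib_left mult_ac)
  moreover have "(\<Sum>i\<in>{..<CARD('n)}. ginner G (e i) (e' j) * h (e i)) = h (e' j)" for j
    by (subst (2) expansion[of "e' j"]) (simp add: linear_sum[OF assms(3)] linear_cmul[OF assms(3)])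
  ultimately show ?thesis by simp
qed

end

text \<open>Both sides are the inner product of two \<open>p\<close>-forms. One slot is split off
  with \<open>sum_square_eq\<close>; the remaining slots change frame by induction and the split one
  by \<open>sum_bilinear_frame\<close>.\<close>

lemma sum_basis_list_frame:
  fixes \<alpha> \<beta> :: "'n::finite form"
  assumes "euclidean_frame G e" "euclidean_frame G e'" "is_form p \<alpha>" "is_form p \<beta>"
  shows "(\<Sum>I\<in>Pow {..<CARD('n)}. \<alpha> (basis_list e I) * \<beta> (basis_list e I)) =
    (\<Sum>I\<in>Pow {..<CARD('n)}. \<alpha> (basis_list e' I) * \<beta> (basis_list e' I))"
  using assms(3,4)
proof (induction p arbitrary: \<alpha> \<beta>)
  case 0
  have "(\<Sum>I\<in>Pow {..<CARD('n)}. \<alpha> (basis_list f I) * \<beta> (basis_list f I)) = \<alpha> [] * \<beta> []" for f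
  proof -
    have "(\<Sum>I\<in>Pow {..<CARD('n)}. \<alpha> (basis_list f I) * \<beta> (basis_list f I)) =
        (\<Sum>I\<in>{{}}. \<alpha> (basis_list f I) * \<beta> (basis_list f I))"
    proof (rule sum.mono_neutral_right)
      show "\<forall>I\<in>Pow {..<CARD('n)} - {{}}. \<alpha> (basis_list f I) * \<beta> (basis_list f I) = 0"
      proof
        fix I assume "I \<in> Pow {..<CARD('n)} - {{}}"
        then have "card I \<noteq> 0" using finite_subset[of I "{..<CARD('n)}"] by auto
        then show "\<alpha> (basis_list f I) * \<beta> (basis_list f I) = 0"
          using is_form_other[OF 0(1), of "basis_list f I"] by simp
      qed
    qed auto
    then show ?thesis by (simp add: basis_list_def)
  qed
  then show ?case by metis
next
  case (Suc p)
  interpret e: euclidean_frame G e by fact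
  interpret e': euclidean_frame G e' by fact
  have lin: "linear (\<lambda>v. \<alpha> (v # zs))" "linear (\<lambda>v. \<beta> (v # zs))" for zs
    using is_form_linear[OF Suc.prems(1), of "[]"] is_form_linear[OF Suc.prems(2), of "[]"] by auto
  have "real (Suc p) * (\<Sum>I\<in>Pow {..<CARD('n)}. \<alpha> (basis_list e I) * \<beta> (basis_list e I)) =
      (\<Sum>i<CARD('n). \<Sum>I\<in>Pow {..<CARD('n)}. \<alpha> (e i # basis_list e I) * \<beta> (e i # basis_list e I))"
    using e.sum_square_eq[OF Suc.prems] .
  also have "\<dots> = (\<Sum>i<CARD('n). \<Sum>I\<in>Pow {..<CARD('n)}. \<alpha> (e i # basis_list e' I) * \<beta> (e i # basis_list e' I))"
    using Suc.prems by (intro sum.cong refl Suc.IH is_form_Cons)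
  also have "\<dots> = (\<Sum>I\<in>Pow {..<CARD('n)}. \<Sum>i<CARD('n). \<alpha> (e i # basis_list e' I) * \<beta> (e i # basis_list e' I))"
    by (rule sum.swap)
  also have "\<dots> = (\<Sum>I\<in>Pow {..<CARD('n)}. \<Sum>i<CARD('n). \<alpha> (e' i # basis_list e' I) * \<beta> (e' i # basis_list e' I))"
    by (intro sum.cong refl e.sum_bilinear_frame[OF assms(2)] lin)
  also have "\<dots> = (\<Sum>i<CARD('n). \<Sum>I\<in>Pow {..<CARD('n)}. \<alpha> (e' i # basis_list e' I) * \<beta> (e' i # basis_list e' I))"
    by (rule sum.swap)
  also have "\<dots> = real (Suc p) * (\<Sum>I\<in>Pow {..<CARD('n)}. \<alpha> (basis_list e' I) * \<beta> (basis_list e' I))"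
    using e'.sum_square_eq[OF Suc.prems] by simp
  finally show ?case by simp
qed

section \<open>Double forms that are diagonal in an orthonormal basis\<close>

text \<open>A double form is diagonal if it is a combination of the double forms \<open>e\<^sup>I \<otimes> e\<^sup>I\<close>; \<open>a I\<close> is the
  coefficient of \<open>e\<^sup>I \<otimes> e\<^sup>I\<close>.\<close>

definition diagonal :: "(nat \<Rightarrow> real^'n) \<Rightarrow> 'n::finite dform \<Rightarrow> (nat set \<Rightarrow> real) \<Rightarrow> bool" where
  "diagonal e \<omega> a \<longleftrightarrow> (\<forall>I J. I \<subseteq> {..<CARD('n)} \<longrightarrow> J \<subseteq> {..<CARD('n)} \<longrightarrow>
     \<omega> (basis_list e I) (basis_list e J) = of_bool (I = J) * a I)"

definition subset_convolution :: "('i set \<Rightarrow> real) \<Rightarrow> ('i set \<Rightarrow> real) \<Rightarrow> 'i set \<Rightarrow> real" where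
  "subset_convolution a b K = (\<Sum>I\<in>Pow K. a I * b (K - I))"

text \<open>A selection of positions from an increasing list is again increasing, so it is the
  increasing list of its own entries.\<close>

lemma nths_basis_list:
  assumes "finite K"
  shows "nths (basis_list e K) I = basis_list e (set (nths (sorted_list_of_set K) I))"
proof -
  have "sorted_list_of_set (set (nths (sorted_list_of_set K) I)) = nths (sorted_list_of_set K) I"
    by (rule sorted_list_of_set.idem_if_sorted_distinct) (simp_all add: sorted_nths)
  then show ?thesis by (simp add: basis_list_def nths_map)
qed

lemma set_nths_image: "I \<subseteq> {..<length xs} \<Longrightarrow> set (nths xs I) = (!) xs ` I"
  by (auto simp: set_nths)

lemma set_nths_Compl:
  assumes "distinct xs"
  shows "set (nths xs (- I)) = set xs - set (nths xs I)"
proof (intro equalityI subsetI)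
  fix x assume "x \<in> set (nths xs (- I))"
  then show "x \<in> set xs - set (nths xs I)" using assms by (auto simp: set_nths nth_eq_iff_index_eq)
next
  fix x assume "x \<in> set xs - set (nths xs I)"
  then obtain i where "i < length xs" "x = xs ! i" "i \<notin> I" by (auto simp: set_nths in_set_conv_nth)
  then show "x \<in> set (nths xs (- I))" by (auto simp: set_nths)
qed

lemma bij_betw_set_nths:
  assumes "distinct xs"
  shows "bij_betw (\<lambda>I. set (nths xs I)) (Pow {..<length xs}) (Pow (set xs))"
proof -
  have "bij_betw ((!) xs) {..<length xs} (set xs)" using assms by (simp add: bij_betw_nth)
  then have "bij_betw ((`) ((!) xs)) (Pow {..<length xs}) (Pow (set xs))" by (rule bij_betw_Pow)
  then show ?thesis by (rule bij_betw_cong[THEN iffD1, rotated]) (simp add: set_nths_image)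
qed

lemma dprod_diagonal_left:
  fixes \<omega> \<eta> :: "'n::finite dform"
  assumes dg: "diagonal e \<omega> a" and KL: "K \<subseteq> {..<CARD('n)}" "L \<subseteq> {..<CARD('n)}"
  shows "dprod \<omega> \<eta> (basis_list e K) (basis_list e L) =
    (\<Sum>I\<in>Pow {..<card K}. \<Sum>J\<in>Pow {..<card L}. shuffle_sign (card K) I * shuffle_sign (card L) J *
      (of_bool (set (nths (sorted_list_of_set K) I) = set (nths (sorted_list_of_set L) J)) *
        (a (set (nths (sorted_list_of_set K) I)) *
          \<eta> (basis_list e (K - set (nths (sorted_list_of_set K) I)))
            (basis_list e (L - set (nths (sorted_list_of_set L) J))))))"
proof -
  have fin: "finite K" "finite L" using KL by (auto intro: finite_subset)
  have sub: "set (nths (sorted_list_of_set K) I) \<subseteq> {..<CARD('n)}"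
    "set (nths (sorted_list_of_set L) I) \<subseteq> {..<CARD('n)}" for I
    using set_nths_subset fin KL by fastforce+
  show ?thesis unfolding dprod_def
    using dg sub fin by (simp add: nths_basis_list set_nths_Compl diagonal_def mult.assoc)
qed

text \<open>Only equal selections in the two slots survive, so the two shuffle signs agree and
  multiply to \<open>1\<close>. The second factor is arbitrary because it will also be the unknown
  \<open>B\<close> of the 6-dimensional Thorpe condition.\<close>

lemma dprod_diagonal_entry:
  fixes \<omega> \<eta> :: "'n::finite dform"
  assumes dg: "diagonal e \<omega> a" and K: "K \<subseteq> {..<CARD('n)}"
  shows "dprod \<omega> \<eta> (basis_list e K) (basis_list e K) =
    subset_convolution a (\<lambda>I. \<eta> (basis_list e I) (basis_list e I)) K"
proof -
  define k where "k I = set (nths (sorted_list_of_set K) I)" for I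
  have bk: "bij_betw k (Pow {..<card K}) (Pow K)"
    using bij_betw_set_nths[of "sorted_list_of_set K"] finite_subset[OF K] by (simp add: k_def[abs_def])
  let ?b = "\<lambda>I. \<eta> (basis_list e I) (basis_list e I)"
  have "dprod \<omega> \<eta> (basis_list e K) (basis_list e K) =
      (\<Sum>I\<in>Pow {..<card K}. \<Sum>J\<in>Pow {..<card K}. if J = I then a (k I) * ?b (K - k I) else 0)"
    unfolding dprod_diagonal_left[OF dg K K] k_def[symmetric]
  proof (intro sum.cong refl)
    fix I J assume "I \<in> Pow {..<card K}" "J \<in> Pow {..<card K}"
    then have "k I = k J \<longleftrightarrow> J = I" using bk by (auto simp: bij_betw_def inj_on_def)
    then show "shuffle_sign (card K) I * shuffle_sign (card K) J * (of_bool (k I = k J) *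
        (a (k I) * \<eta> (basis_list e (K - k I)) (basis_list e (K - k J)))) =
        (if J = I then a (k I) * ?b (K - k I) else 0)"
      by (auto simp: shuffle_sign_square)
  qed
  also have "\<dots> = (\<Sum>I\<in>Pow {..<card K}. a (k I) * ?b (K - k I))"
    by (intro sum.cong) (simp_all add: sum.delta)
  also have "\<dots> = subset_convolution a ?b K"
    unfolding subset_convolution_def by (rule sum.reindex_bij_betw[OF bk])
  finally show ?thesis .
qed

lemma diagonal_dprod:
  fixes \<omega> \<eta> :: "'n::finite dform"
  assumes "diagonal e \<omega> a" "diagonal e \<eta> b"
  shows "diagonal e (dprod \<omega> \<eta>) (subset_convolution a b)"
  unfolding diagonal_def
proof (intro allI impI)
  fix K L assume KL: "K \<subseteq> {..<CARD('n)}" "L \<subseteq> {..<CARD('n)}"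
  then have fin: "finite K" "finite L" by (auto intro: finite_subset)
  show "dprod \<omega> \<eta> (basis_list e K) (basis_list e L) = of_bool (K = L) * subset_convolution a b K"
  proof (cases "K = L")
    case True
    have "subset_convolution a (\<lambda>I. \<eta> (basis_list e I) (basis_list e I)) K = subset_convolution a b K"
      unfolding subset_convolution_def
    proof (intro sum.cong refl)
      fix I
      have "K - I \<subseteq> {..<CARD('n)}" using KL by auto
      then show "a I * \<eta> (basis_list e (K - I)) (basis_list e (K - I)) = a I * b (K - I)"
        using assms(2) by (simp add: diagonal_def)
    qed
    then show ?thesis using True dprod_diagonal_entry[OF assms(1) KL(1)] by simp
  next
    case False
    have "of_bool (set (nths (sorted_list_of_set K) I) = set (nths (sorted_list_of_set L) J)) *
        (a (set (nths (sorted_list_of_set K) I)) *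
          \<eta> (basis_list e (K - set (nths (sorted_list_of_set K) I)))
            (basis_list e (L - set (nths (sorted_list_of_set L) J)))) = 0" for I J
    proof -
      have s: "set (nths (sorted_list_of_set K) I) \<subseteq> K" "set (nths (sorted_list_of_set L) J) \<subseteq> L"
        using set_nths_subset fin by fastforce+
      \<comment> \<open>If the selected parts and the remaining parts both agreed, so would their
        unions \<open>K\<close> and \<open>L\<close>; hence one of the two factors vanishes.\<close>
      then have "set (nths (sorted_list_of_set K) I) \<noteq> set (nths (sorted_list_of_set L) J) \<or>
          K - set (nths (sorted_list_of_set K) I) \<noteq> L - set (nths (sorted_list_of_set L) J)"
        using False by blast
      moreover have "K - set (nths (sorted_list_of_set K) I) \<subseteq> {..<CARD('n)}"
        "L - set (nths (sorted_list_of_set L) J) \<subseteq> {..<CARD('n)}" using KL by auto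
      ultimately show ?thesis using assms(2) by (auto simp: diagonal_def)
    qed
    then show ?thesis using False
      unfolding dprod_diagonal_left[OF assms(1) KL] by (simp only: mult_zero_right sum.neutral_const) simp
  qed
qed

lemma diagonal_dunit: "diagonal e dunit (\<lambda>K. of_bool (K = {}))"
  unfolding diagonal_def
proof (intro allI impI)
  fix I J assume "I \<subseteq> {..<CARD('a)}" "J \<subseteq> {..<CARD('a)}"
  then have "finite I" "finite J" by (auto intro: finite_subset)
  then have "basis_list e I = [] \<longleftrightarrow> I = {}" "basis_list e J = [] \<longleftrightarrow> J = {}"
    by (simp_all add: basis_list_def)
  then show "dunit (basis_list e I) (basis_list e J) = of_bool (I = J) * of_bool (I = {})"
    by (auto simp: dunit_def)
qed

lemma diagonal_cong:
  "diagonal (e :: nat \<Rightarrow> real^'n::finite) \<omega> a \<Longrightarrow> (\<And>K. K \<subseteq> {..<CARD('n)} \<Longrightarrow> a K = b K) \<Longrightarrow> diagonal e \<omega> b"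
  by (simp add: diagonal_def)

lemma basis_list_singleton: "basis_list e {i} = [e i]"
  by (simp add: basis_list_def)

section \<open>Bilinear forms as \<open>(1,1)\<close> double forms\<close>

definition bilinear_dform :: "(real^'n \<Rightarrow> real^'n \<Rightarrow> real) \<Rightarrow> 'n::finite dform" where
  "bilinear_dform h xs ys = (case (xs, ys) of ([x], [y]) \<Rightarrow> h x y | _ \<Rightarrow> 0)"

lemma metric_dform_eq: "metric_dform G = bilinear_dform (ginner G)"
  by (simp add: fun_eq_iff metric_dform_def bilinear_dform_def)

lemma bilinear_dform_simps [simp]: "bilinear_dform h [x] [y] = h x y"
  by (simp add: bilinear_dform_def)

lemma bilinear_dform_other:
  "length xs \<noteq> 1 \<Longrightarrow> bilinear_dform h xs ys = 0"
  "length ys \<noteq> 1 \<Longrightarrow> bilinear_dform h xs ys = 0"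
  by (auto simp: bilinear_dform_def split: list.split)

lemma is_dform_bilinear:
  assumes "bilinear h"
  shows "is_dform 1 1 (bilinear_dform h)"
proof -
  have lin: "linear (h x)" "linear (\<lambda>x. h x y)" for x y using assms by (auto simp: bilinear_def)
  have "linear (\<lambda>v. bilinear_dform h (as @ v # bs) ys)" "linear (\<lambda>v. bilinear_dform h ys (as @ v # bs))" for as bs ys
  proof -
    show "linear (\<lambda>v. bilinear_dform h (as @ v # bs) ys)"
    proof (cases "as = [] \<and> bs = [] \<and> length ys = 1")
      case True
      then obtain y where "ys = [y]" by (auto simp: length_Suc_conv)
      then show ?thesis using True lin by simp
    next
      case False
      then have "length (as @ v # bs) \<noteq> 1 \<or> length ys \<noteq> 1" for v by auto
      then have "(\<lambda>v. bilinear_dform h (as @ v # bs) ys) = (\<lambda>_. 0)" using bilinear_dform_other by blast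
      then show ?thesis by (simp add: linear_const_zero)
    qed
    show "linear (\<lambda>v. bilinear_dform h ys (as @ v # bs))"
    proof (cases "as = [] \<and> bs = [] \<and> length ys = 1")
      case True
      then obtain y where "ys = [y]" by (auto simp: length_Suc_conv)
      then show ?thesis using True lin by simp
    next
      case False
      then have "length (as @ v # bs) \<noteq> 1 \<or> length ys \<noteq> 1" for v by auto
      then have "(\<lambda>v. bilinear_dform h ys (as @ v # bs)) = (\<lambda>_. 0)" using bilinear_dform_other by blast
      then show ?thesis by (simp add: linear_const_zero)
    qed
  qed
  then show ?thesis unfolding is_dform_def
    by (intro conjI allI is_formI) (simp_all add: bilinear_dform_other)
qed

lemma symmetric_bilinear_dform: "(\<And>x y. h x y = h y x) \<Longrightarrow> symmetric_dform (bilinear_dform h)"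
  unfolding symmetric_dform_def bilinear_dform_def by (auto split: list.split)

text \<open>\<open>sum a K\<close> serves to read \<open>a i\<close> off the singleton
  \<open>{i}\<close>; the factor in front removes all other sets.\<close>

lemma diagonal_bilinear:
  fixes e :: "nat \<Rightarrow> real^'n::finite"
  assumes "\<And>i j. i < CARD('n) \<Longrightarrow> j < CARD('n) \<Longrightarrow> h (e i) (e j) = of_bool (i = j) * a i"
  shows "diagonal e (bilinear_dform h) (\<lambda>K. of_bool (card K = 1) * sum a K)"
  unfolding diagonal_def
proof (intro allI impI)
  fix I J assume IJ: "I \<subseteq> {..<CARD('n)}" "J \<subseteq> {..<CARD('n)}"
  show "bilinear_dform h (basis_list e I) (basis_list e J) = of_bool (I = J) * (of_bool (card I = 1) * sum a I)"
  proof (cases "card I = 1 \<and> card J = 1")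
    case True
    then obtain i j where "I = {i}" "J = {j}" by (auto simp: card_1_singleton_iff)
    then show ?thesis using IJ assms by (auto simp: basis_list_singleton)
  next
    case False
    then have "length (basis_list e I) \<noteq> 1 \<or> length (basis_list e J) \<noteq> 1" by simp
    then show ?thesis using False by (auto simp: bilinear_dform_other)
  qed
qed

lemma bilinear_ginner: "bilinear (ginner G)"
  unfolding bilinear_def using linear_ginner by blast

lemma is_dform_metric: "is_dform 1 1 (metric_dform G)"
  unfolding metric_dform_eq by (rule is_dform_bilinear[OF bilinear_ginner])

lemma (in euclidean_frame) diagonal_metric: "diagonal e (metric_dform G) (\<lambda>K. of_bool (card K = 1))"
  by (rule diagonal_cong[OF diagonal_bilinear[of "ginner G" e "\<lambda>_. 1", folded metric_dform_eq]])
    (auto simp: orthonormal)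

section \<open>The contraction in an arbitrary orthonormal frame\<close>

lemma contraction_eq:
  assumes "euclidean_frame G e" "is_dform p q \<omega>"
  shows "contraction G \<omega> xs ys = (\<Sum>i<CARD('n). \<omega> (e i # xs) (e i # (ys :: (real^'n::finite) list)))"
proof -
  interpret e: euclidean_frame G e by fact
  interpret o: euclidean_frame G "onb G" by (rule e.euclidean_frame_onb)
  text \<open>Bilinear in the two slots, but not a product of two linear functions: expand one slot only.\<close>
  have l1: "linear (\<lambda>v. \<omega> (v # xs) zs)" for zs
    using is_form_linear[of p "\<lambda>xs. \<omega> xs zs" "[]"] assms(2) by (simp add: is_dform_def)
  have l2: "linear (\<lambda>v. \<omega> zs (v # ys))" for zs
    using is_form_linear[of q "\<omega> zs" "[]"] assms(2) by (simp add: is_dform_def)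
  have ex: "f v = (\<Sum>j<CARD('n). ginner G (e j) v * f (e j))" if "linear f" for f :: "real^'n \<Rightarrow> real" and v
    by (subst e.expansion[of v]) (simp add: linear_sum[OF that] linear_cmul[OF that])
  have ex': "f v = (\<Sum>j<CARD('n). ginner G (onb G j) v * f (onb G j))" if "linear f" for f :: "real^'n \<Rightarrow> real" and v
    by (subst o.expansion[of v]) (simp add: linear_sum[OF that] linear_cmul[OF that])
  have "contraction G \<omega> xs ys = (\<Sum>i<CARD('n). \<Sum>j<CARD('n). ginner G (e j) (onb G i) * \<omega> (onb G i # xs) (e j # ys))"
    unfolding contraction_def by (intro sum.cong refl ex l2)
  also have "\<dots> = (\<Sum>j<CARD('n). \<Sum>i<CARD('n). ginner G (onb G i) (e j) * \<omega> (onb G i # xs) (e j # ys))"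
    by (subst sum.swap) (simp add: ginner_commute[OF e.inner_product])
  also have "\<dots> = (\<Sum>j<CARD('n). \<omega> (e j # xs) (e j # ys))"
    by (intro sum.cong refl ex'[symmetric] l1)
  finally show ?thesis .
qed

lemma is_dform_contraction:
  assumes "is_dform (Suc p) (Suc q) \<omega>"
  shows "is_dform p q (contraction G \<omega>)"
  using assms unfolding is_dform_def contraction_def
  by (auto intro!: is_form_sum is_form_Cons[where \<theta> = "\<lambda>xs. \<omega> xs _"] is_form_Cons[where \<theta> = "\<omega> _"])

text \<open>Sorting \<open>i\<close> into place produces the same sign in both slots when
  \<open>I = J\<close>, so the signs cancel. An index that already occurs in one of the lists
  contributes zero.\<close>

lemma diagonal_contraction:
  fixes \<omega> :: "'n::finite dform"
  assumes fr: "euclidean_frame G e" and df: "is_dform p q \<omega>" and dg: "diagonal e \<omega> a"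
  shows "diagonal e (contraction G \<omega>) (\<lambda>K. \<Sum>i\<in>{..<CARD('n)} - K. a (insert i K))"
  unfolding diagonal_def
proof (intro allI impI)
  fix I J assume IJ: "I \<subseteq> {..<CARD('n)}" "J \<subseteq> {..<CARD('n)}"
  then have fin: "finite I" "finite J" by (auto intro: finite_subset)
  have f1: "is_form p (\<lambda>xs. \<omega> xs ys)" and f2: "is_form q (\<omega> xs)" for xs ys
    using df by (auto simp: is_dform_def)
  have "\<omega> (e i # basis_list e I) (e i # basis_list e J) = of_bool (I = J) * (if i \<in> I then 0 else a (insert i I))"
    if i: "i < CARD('n)" for i
  proof (cases "i \<in> I \<or> i \<in> J")
    case True
    then show ?thesis
      using is_form_insert_same[OF f1 fin(1)] is_form_insert_same[OF f2 fin(2)] by auto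
  next
    case False
    have "\<omega> (e i # basis_list e I) (e i # basis_list e J) =
        (- 1) ^ card {j \<in> I. j < i} * ((- 1) ^ card {j \<in> J. j < i} * \<omega> (basis_list e (insert i I)) (basis_list e (insert i J)))"
      using is_form_insert[OF f1 fin(1), of i] is_form_insert[OF f2 fin(2), of i] False by simp
    also have "\<omega> (basis_list e (insert i I)) (basis_list e (insert i J)) = of_bool (I = J) * a (insert i I)"
      using dg i IJ False by (auto simp: diagonal_def insert_ident)
    also have "(- 1) ^ card {j \<in> I. j < i} * ((- 1) ^ card {j \<in> J. j < i} * (of_bool (I = J) * a (insert i I))) =
        of_bool (I = J) * a (insert i I)"
      by (simp flip: power_mult_distrib mult.assoc)
    finally show ?thesis using False by simp
  qed
  then show "contraction G \<omega> (basis_list e I) (basis_list e J) =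
      of_bool (I = J) * (\<Sum>i\<in>{..<CARD('n)} - I. a (insert i I))"
    unfolding contraction_eq[OF fr df]
    by (auto simp: sum.If_cases Diff_eq intro!: sum.mono_neutral_cong_right)
qed

section \<open>The volume form and the Hodge star\<close>

text \<open>The volume form is a determinant in the components of its arguments. Composing the
  permutations with the transposition of two equal adjacent arguments keeps every product and flips
  every sign, so the sum equals its negative.\<close>

lemma is_form_vol: "is_form CARD('n) (vol_form (G :: real^'n::finite^'n))"
proof (rule is_formI)
  fix xs :: "(real^'n) list" assume "length xs \<noteq> CARD('n)"
  then show "vol_form G xs = 0" by (simp add: vol_form_def)
next
  fix as bs :: "(real^'n) list"
  show "linear (\<lambda>v. vol_form G (as @ v # bs))"
  proof (cases "length as + length bs + 1 = CARD('n)")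
    case True
    then have as: "length as \<in> {..<CARD('n)}" by auto
    have "(\<Prod>i<CARD('n). ginner G (onb G (\<pi> i)) ((as @ v # bs) ! i)) =
        ginner G (onb G (\<pi> (length as))) v *
          (\<Prod>i\<in>{..<CARD('n)} - {length as}. ginner G (onb G (\<pi> i)) ((as @ 0 # bs) ! i))" for \<pi> v
      unfolding prod.remove[OF finite_lessThan as]
      by (auto simp: nth_append nth_Cons' intro!: prod.cong split: if_splits)
    then show ?thesis using True unfolding vol_form_def
      by (auto simp: linear_iff ginner_linear algebra_simps sum.distrib sum_distrib_left)
  next
    case False
    then have "(\<lambda>v. vol_form G (as @ v # bs)) = (\<lambda>_. 0)" by (simp add: vol_form_def fun_eq_iff)
    then show ?thesis by (simp add: linear_const_zero)
  qed
next
  fix as bs :: "(real^'n) list" and x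
  let ?xs = "as @ x # x # bs" and ?\<tau> = "Transposition.transpose (length as) (Suc (length as))"
  show "vol_form G ?xs = 0"
  proof (cases "length ?xs = CARD('n)")
    case True
    let ?f = "\<lambda>\<pi>. of_int (sign \<pi>) * (\<Prod>i<CARD('n). ginner G (onb G (\<pi> i)) (?xs ! i))"
    have \<tau>: "?\<tau> permutes {..<CARD('n)}" using True by (intro permutes_swap_id) auto
    have nth: "?xs ! (?\<tau> i) = ?xs ! i" for i
      by (auto simp: Transposition.transpose_def nth_append)
    have f: "?f (\<pi> \<circ> ?\<tau>) = - ?f \<pi>" if "\<pi> permutes {..<CARD('n)}" for \<pi>
    proof -
      have "sign (\<pi> \<circ> ?\<tau>) = - sign \<pi>"
        using permutes_imp_permutation[OF finite_lessThan that]
        by (simp add: sign_compose permutation_swap_id sign_swap_id)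
      moreover have "(\<Prod>i<CARD('n). ginner G (onb G ((\<pi> \<circ> ?\<tau>) i)) (?xs ! i)) =
          (\<Prod>i<CARD('n). ginner G (onb G (\<pi> i)) (?xs ! i))"
        using prod.permute[OF \<tau>, of "\<lambda>i. ginner G (onb G (\<pi> i)) (?xs ! i)"] by (simp add: o_def nth)
      ultimately show ?thesis by simp
    qed
    have "sum ?f {\<pi>. \<pi> permutes {..<CARD('n)}} = (\<Sum>\<pi> | \<pi> permutes {..<CARD('n)}. ?f (\<pi> \<circ> ?\<tau>))"
      by (rule sum_permutations_compose_right[OF \<tau>])
    also have "\<dots> = - sum ?f {\<pi>. \<pi> permutes {..<CARD('n)}}"
      unfolding sum_negf[symmetric] by (intro sum.cong refl f) simp
    finally show ?thesis unfolding vol_form_def using True by simp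
  qed (simp add: vol_form_def)
qed

lemma (in euclidean_frame) vol_form_onb: "vol_form G (basis_list (onb G) {..<CARD('n)}) = 1"
proof -
  interpret o: euclidean_frame G "onb G" by (rule euclidean_frame_onb)
  have l: "sorted_list_of_set {..<CARD('n)} = [0..<CARD('n)]" by (simp add: lessThan_atLeast0)
  have "vol_form G (basis_list (onb G) {..<CARD('n)}) =
      (\<Sum>\<pi> | \<pi> permutes {..<CARD('n)}. of_int (sign \<pi>) * (\<Prod>i<CARD('n). of_bool (\<pi> i = i)))"
    unfolding vol_form_def by (auto simp: basis_list_def l o.orthonormal permutes_in_image[of _ "{..<CARD('n)}", simplified] intro!: sum.cong prod.cong)
  also have "\<dots> = (\<Sum>\<pi>\<in>{id}. of_int (sign \<pi>) * (\<Prod>i<CARD('n). of_bool (\<pi> i = i)))"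
  proof (rule sum.mono_neutral_right)
    show "\<forall>\<pi>\<in>{\<pi>. \<pi> permutes {..<CARD('n)}} - {id}.
        of_int (sign \<pi>) * (\<Prod>i<CARD('n). of_bool (\<pi> i = i)) = (0::real)"
    proof
      fix \<pi> assume *: "\<pi> \<in> {\<pi>. \<pi> permutes {..<CARD('n)}} - {id}"
      then obtain i where "\<pi> i \<noteq> i" by (auto simp: fun_eq_iff)
      moreover from this have "i \<in> {..<CARD('n)}" using * permutes_not_in by fastforce
      ultimately have "(\<Prod>i<CARD('n). of_bool (\<pi> i = i)) = (0::real)"
        by (intro prod_zero) auto
      then show "of_int (sign \<pi>) * (\<Prod>i<CARD('n). of_bool (\<pi> i = i)) = (0::real)" by simp
    qed
  qed (auto simp: permutes_id finite_permutations)
  finally show ?thesis by (simp add: sign_id)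
qed

lemma sum_full_card:
  fixes f :: "nat set \<Rightarrow> real"
  assumes "\<And>I. I \<subseteq> {..<n} \<Longrightarrow> card I \<noteq> n \<Longrightarrow> f I = 0"
  shows "(\<Sum>I\<in>Pow {..<n}. f I) = f {..<n}"
proof -
  have "(\<Sum>I\<in>Pow {..<n}. f I) = (\<Sum>I\<in>{{..<n}}. f I)"
  proof (rule sum.mono_neutral_right)
    show "\<forall>I\<in>Pow {..<n} - {{..<n}}. f I = 0"
      using assms card_subset_eq[of "{..<n}"] by auto
  qed auto
  then show ?thesis by simp
qed

text \<open>The sum of squares over all increasing lists does not depend on the frame, and in top
  degree only the full list contributes. This replaces a determinant computation; the sign itself
  depends on the orientation of \<open>e\<close>.\<close>

lemma (in euclidean_frame) vol_form_square: "(vol_form G (basis_list e {..<CARD('n)}))\<^sup>2 = 1"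
proof -
  have "(\<Sum>I\<in>Pow {..<CARD('n)}. vol_form G (basis_list f I) * vol_form G (basis_list f I)) =
      vol_form G (basis_list f {..<CARD('n)}) * vol_form G (basis_list f {..<CARD('n)})" for f
    by (rule sum_full_card) (simp add: vol_form_def)
  then show ?thesis
    using sum_basis_list_frame[OF euclidean_frame_axioms euclidean_frame_onb is_form_vol is_form_vol, of G G]
    by (simp add: vol_form_onb power2_eq_square)
qed

text \<open>Sorting changes a form only by a sign. The square forgets it, which suffices because the
  volume form enters the Hodge star of a diagonal double form twice with the same arguments.\<close>

lemma is_form_sort_square:
  "is_form p \<theta> \<Longrightarrow> (\<theta> (map e xs))\<^sup>2 = (\<theta> (map e (sort (xs :: nat list))))\<^sup>2"
proof (induction xs arbitrary: p \<theta>)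
  case (Cons x xs)
  have "(\<theta> (map e (x # xs)))\<^sup>2 = (\<theta> (map e (x # sort xs)))\<^sup>2"
    using Cons.IH[OF is_form_Cons'[OF Cons.prems, of "e x"]] by simp
  also have "\<dots> = (\<theta> (map e (insort x (sort xs))))\<^sup>2"
    using is_form_insort[OF Cons.prems, of "sort xs" e x] by (simp add: power_mult_distrib flip: power_mult)
  finally show ?case by simp
qed simp

lemma is_form_union_square:
  assumes "is_form p \<theta>" "finite I" "finite K" "I \<inter> K = {}"
  shows "(\<theta> (basis_list e I @ basis_list e K))\<^sup>2 = (\<theta> (basis_list e (I \<union> K)))\<^sup>2"
proof -
  have "sort (sorted_list_of_set I @ sorted_list_of_set K) = sorted_list_of_set (I \<union> K)"
    using assms by (intro sorted_distinct_set_unique) auto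
  then show ?thesis
    using is_form_sort_square[OF assms(1), of e "sorted_list_of_set I @ sorted_list_of_set K"]
    by (simp add: basis_list_def)
qed

lemma hodge_other:
  fixes \<omega> :: "'n::finite dform"
  assumes "is_dform p q \<omega>" "p + length xs \<noteq> CARD('n) \<or> q + length ys \<noteq> CARD('n)"
  shows "hodge G \<omega> xs ys = 0"
proof -
  have "\<omega> (onb_list G I) (onb_list G J) * (vol_form G (onb_list G I @ xs) * vol_form G (onb_list G J @ ys)) = 0" for I J
  proof (cases "card I = p \<and> card J = q")
    case True
    then show ?thesis using assms(2) by (auto simp: vol_form_def onb_list_eq)
  next
    case False
    then show ?thesis using assms(1) by (auto simp: is_dform_def is_form_def onb_list_eq)
  qed
  then show ?thesis unfolding hodge_def by (simp only: sum.neutral_const)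
qed

lemma hodge_swap: "hodge G \<omega> xs ys = hodge G (\<lambda>xs ys. \<omega> ys xs) ys xs"
  unfolding hodge_def by (subst sum.swap) (simp add: mult_ac)

lemma is_dform_hodge:
  fixes \<omega> :: "'n::finite dform"
  assumes "is_dform p q \<omega>" "p \<le> CARD('n)" "q \<le> CARD('n)"
  shows "is_dform (CARD('n) - p) (CARD('n) - q) (hodge G \<omega>)"
proof -
  have *: "is_form (CARD('n) - p) (\<lambda>xs. hodge G \<omega> xs ys)" if "is_dform p q \<omega>" "p \<le> CARD('n)"
    for p q and \<omega> :: "'n dform" and ys
  proof -
    have "is_form (CARD('n) - p)
       (\<lambda>xs. (\<omega> (onb_list G I) (onb_list G J) * vol_form G (onb_list G J @ ys)) * vol_form G (onb_list G I @ xs))" for I J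
    proof (cases "card I = p")
      case True
      then show ?thesis using that(2) is_form_vol[of G]
        by (intro is_form_scale is_form_append) (simp add: onb_list_eq)
    next
      case False
      then have "\<omega> (onb_list G I) (onb_list G J) = 0"
        using that(1) by (auto simp: is_dform_def is_form_def onb_list_eq)
      then show ?thesis by (simp add: is_form_zero)
    qed
    then show ?thesis unfolding hodge_def by (intro is_form_sum) (simp add: mult_ac)
  qed
  have "is_dform q p (\<lambda>xs ys. \<omega> ys xs)" using assms(1) by (simp add: is_dform_def)
  then have "is_form (CARD('n) - q) (\<lambda>ys. hodge G (\<lambda>xs ys. \<omega> ys xs) ys xs)" for xs
    using * assms(3) by blast
  then have "is_form (CARD('n) - q) (hodge G \<omega> xs)" for xs
    using hodge_swap[of G \<omega> xs] by presburger
  then show ?thesis using *[OF assms(1,2)] by (simp add: is_dform_def)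
qed

lemma is_form_append_right:
  assumes "is_form (p + length us) \<theta>"
  shows "is_form p (\<lambda>xs. \<theta> (xs @ us))"
proof (rule is_formI)
  show "linear (\<lambda>v. \<theta> ((as @ v # bs) @ us))" for as bs
    using is_form_linear[OF assms, of as "bs @ us"] by simp
qed (simp_all add: is_form_other[OF assms] is_form_not_distinct[OF assms])

text \<open>The frame is changed in one slot of \<open>\<omega>\<close> at a time. The degree
  conditions make the volume form, with its last arguments fixed, a form of the degree of the slot
  with which it is paired.\<close>

lemma hodge_eq:
  fixes \<omega> :: "'n::finite dform"
  assumes fr: "euclidean_frame G e" and df: "is_dform p q \<omega>"
    and len: "p + length xs = CARD('n)" "q + length ys = CARD('n)"
  shows "hodge G \<omega> xs ys = (\<Sum>I\<in>Pow {..<CARD('n)}. \<Sum>J\<in>Pow {..<CARD('n)}.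
    \<omega> (basis_list e I) (basis_list e J) *
      (vol_form G (basis_list e I @ xs) * vol_form G (basis_list e J @ ys)))"
proof -
  let ?P = "Pow {..<CARD('n)}" and ?o = "basis_list (onb G)" and ?e = "basis_list e"
  have fro: "euclidean_frame G (onb G)" using euclidean_frame.euclidean_frame_onb[OF fr] .
  have 1: "is_form p (\<lambda>zs. \<omega> zs ws)" "is_form q (\<omega> ws)" for ws
    using df by (auto simp: is_dform_def)
  have 2: "is_form p (\<lambda>zs. vol_form G (zs @ xs))" "is_form q (\<lambda>zs. vol_form G (zs @ ys))"
    using is_form_vol[of G] len by (auto intro!: is_form_append_right)
  have "hodge G \<omega> xs ys = (\<Sum>I\<in>?P. vol_form G (?o I @ xs) * (\<Sum>J\<in>?P. \<omega> (?o I) (?o J) * vol_form G (?o J @ ys)))"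
    unfolding hodge_def onb_list_eq by (simp add: sum_distrib_left mult_ac)
  also have "\<dots> = (\<Sum>I\<in>?P. vol_form G (?o I @ xs) * (\<Sum>J\<in>?P. \<omega> (?o I) (?e J) * vol_form G (?e J @ ys)))"
    using sum_basis_list_frame[OF fro fr 1(2) 2(2)] by simp
  also have "\<dots> = (\<Sum>J\<in>?P. vol_form G (?e J @ ys) * (\<Sum>I\<in>?P. \<omega> (?o I) (?e J) * vol_form G (?o I @ xs)))"
    by (simp add: sum_distrib_left mult_ac) (rule sum.swap)
  also have "\<dots> = (\<Sum>J\<in>?P. vol_form G (?e J @ ys) * (\<Sum>I\<in>?P. \<omega> (?e I) (?e J) * vol_form G (?e I @ xs)))"
    using sum_basis_list_frame[OF fro fr 1(1) 2(1)] by simp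
  also have "\<dots> = (\<Sum>I\<in>?P. \<Sum>J\<in>?P. \<omega> (?e I) (?e J) * (vol_form G (?e I @ xs) * vol_form G (?e J @ ys)))"
    by (subst sum.swap) (simp add: sum_distrib_left mult_ac)
  finally show ?thesis .
qed

text \<open>In each slot only the complement contributes: any other set of the right size meets
  \<open>K\<close> or \<open>L\<close>, so that the volume form sees a repeated vector. The double
  form may have off-diagonal entries, as happens for \<open>B\<close> in dimension 6.\<close>

lemma hodge_basis_list:
  fixes \<omega> :: "'n::finite dform"
  assumes fr: "euclidean_frame G e" and df: "is_dform p q \<omega>"
    and KL: "K \<subseteq> {..<CARD('n)}" "L \<subseteq> {..<CARD('n)}" "p + card K = CARD('n)" "q + card L = CARD('n)"
  shows "hodge G \<omega> (basis_list e K) (basis_list e L) =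
    \<omega> (basis_list e ({..<CARD('n)} - K)) (basis_list e ({..<CARD('n)} - L)) *
      (vol_form G (basis_list e ({..<CARD('n)} - K) @ basis_list e K) *
       vol_form G (basis_list e ({..<CARD('n)} - L) @ basis_list e L))"
proof -
  let ?P = "Pow {..<CARD('n)}" and ?e = "basis_list e" and ?N = "{..<CARD('n)}"
  have single: "(\<Sum>I\<in>?P. \<theta> (?e I) * vol_form G (?e I @ ?e M)) =
      \<theta> (?e (?N - M)) * vol_form G (?e (?N - M) @ ?e M)"
    if th: "is_form k \<theta>" and M: "M \<subseteq> ?N" "k + card M = CARD('n)" for k \<theta> M
  proof -
    have "(\<Sum>I\<in>?P. \<theta> (?e I) * vol_form G (?e I @ ?e M)) =
        (\<Sum>I\<in>{?N - M}. \<theta> (?e I) * vol_form G (?e I @ ?e M))"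
    proof (rule sum.mono_neutral_right)
      show "\<forall>I\<in>?P - {?N - M}. \<theta> (?e I) * vol_form G (?e I @ ?e M) = 0"
      proof (rule ballI, rule ccontr)
        fix I assume I: "I \<in> ?P - {?N - M}" and nz: "\<theta> (?e I) * vol_form G (?e I @ ?e M) \<noteq> 0"
        have "card I = k" using nz is_form_other[OF th, of "?e I"] by force
        have fin: "finite I" "finite M" using I M finite_subset[of _ ?N] by auto
        have "distinct (?e I @ ?e M)"
          using nz is_form_not_distinct[OF is_form_vol[of G], of "?e I @ ?e M"] by force
        then have "I \<inter> M = {}" using fin by (auto simp: basis_list_def)
        then have "I \<subseteq> ?N - M" using I by auto
        moreover have "card (?N - M) = card I"
          using M fin \<open>card I = k\<close> card_Diff_subset[of M ?N] by simp
        ultimately have "I = ?N - M" by (intro card_subset_eq) auto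
        then show False using I by blast
      qed
    qed auto
    then show ?thesis by simp
  qed
  have f: "is_form p (\<lambda>xs. \<omega> xs ys)" "is_form q (\<omega> xs)" for xs ys using df by (auto simp: is_dform_def)
  have "hodge G \<omega> (?e K) (?e L) =
      (\<Sum>I\<in>?P. \<Sum>J\<in>?P. \<omega> (?e I) (?e J) * (vol_form G (?e I @ ?e K) * vol_form G (?e J @ ?e L)))"
    by (rule hodge_eq[OF fr df]) (use KL in auto)
  also have "\<dots> = (\<Sum>I\<in>?P. vol_form G (?e I @ ?e K) * (\<Sum>J\<in>?P. \<omega> (?e I) (?e J) * vol_form G (?e J @ ?e L)))"
    by (simp add: sum_distrib_left mult_ac)
  also have "\<dots> = vol_form G (?e (?N - L) @ ?e L) * (\<Sum>I\<in>?P. \<omega> (?e I) (?e (?N - L)) * vol_form G (?e I @ ?e K))"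
    unfolding single[OF f(2) KL(2,4)] by (simp add: sum_distrib_left mult_ac)
  finally show ?thesis unfolding single[OF f(1) KL(1,3)] by (simp add: mult_ac)
qed

lemma (in euclidean_frame) vol_form_complement_square:
  assumes "K \<subseteq> {..<CARD('n)}"
  shows "vol_form G (basis_list e ({..<CARD('n)} - K) @ basis_list e K) *
    vol_form G (basis_list e ({..<CARD('n)} - K) @ basis_list e K) = 1"
proof -
  have "({..<CARD('n)} - K) \<inter> K = {}" "{..<CARD('n)} - K \<union> K = {..<CARD('n)}" using assms by auto
  then show ?thesis
    using is_form_union_square[OF is_form_vol[of G], of "{..<CARD('n)} - K" K e] vol_form_square
      finite_subset[OF assms] by (simp add: power2_eq_square)
qed

lemma diagonal_hodge:
  fixes \<omega> :: "'n::finite dform"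
  assumes fr: "euclidean_frame G e" and df: "is_dform p p \<omega>"
    and dg: "diagonal e \<omega> a"
  shows "diagonal e (hodge G \<omega>) (\<lambda>K. a ({..<CARD('n)} - K))"
  unfolding diagonal_def
proof (intro allI impI)
  fix K L assume KL: "K \<subseteq> {..<CARD('n)}" "L \<subseteq> {..<CARD('n)}"
  then have fin: "finite K" "finite L" by (auto intro: finite_subset)
  have cardK: "card ({..<CARD('n)} - K) = CARD('n) - card K" "card K \<le> CARD('n)"
    using KL fin card_mono[of "{..<CARD('n)}" K] by (auto simp: card_Diff_subset)
  \<comment> \<open>The coefficients at sets of size other than \<open>p\<close> are values of
    \<open>\<omega>\<close>, which vanishes there; this settles the case in which the degrees do not
    fit.\<close>
  have a0: "a I = 0" if "I \<subseteq> {..<CARD('n)}" "card I \<noteq> p" for I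
  proof -
    have "\<omega> (basis_list e I) (basis_list e I) = a I" using dg that by (simp add: diagonal_def)
    then show ?thesis using df that(2) by (auto simp: is_dform_def is_form_def)
  qed
  show "hodge G \<omega> (basis_list e K) (basis_list e L) = of_bool (K = L) * a ({..<CARD('n)} - K)"
  proof (cases "p + card K = CARD('n) \<and> p + card L = CARD('n)")
    case False
    then have "hodge G \<omega> (basis_list e K) (basis_list e L) = 0"
      using hodge_other[OF df] by auto
    moreover have "K \<noteq> L \<or> a ({..<CARD('n)} - K) = 0"
      using False cardK a0[of "{..<CARD('n)} - K"] by force
    ultimately show ?thesis by auto
  next
    case True
    have "(K = L) = ({..<CARD('n)} - K = {..<CARD('n)} - L)" using KL by blast
    then show ?thesis
      using hodge_basis_list[OF fr df KL conjunct1[OF True] conjunct2[OF True]] dg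
        euclidean_frame.vol_form_complement_square[OF fr KL(1)]
      by (auto simp: diagonal_def)
  qed
qed

section \<open>Sums over subsets\<close>

text \<open>The second elementary symmetric function of \<open>l\<close> on \<open>K\<close>,
  written over all subsets so that the double counting below applies to it directly.\<close>

definition pair_sum :: "(nat \<Rightarrow> real) \<Rightarrow> nat set \<Rightarrow> real" where
  "pair_sum l K = (\<Sum>L\<in>Pow K. of_bool (card L = 2) * prod l L)"

lemma sum_card_1: "finite K \<Longrightarrow> (\<Sum>L\<in>Pow K. of_bool (card L = 1) * f L) = (\<Sum>i\<in>K. f {i} :: real)"
proof -
  assume K: "finite K"
  have "(\<Sum>L\<in>Pow K. of_bool (card L = 1) * f L) = (\<Sum>L\<in>(\<lambda>i. {i}) ` K. f L)"
    by (rule sum.mono_neutral_cong_right) (use K in \<open>auto simp: card_1_singleton_iff\<close>)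
  also have "\<dots> = (\<Sum>i\<in>K. f {i})" by (simp add: sum.reindex)
  finally show ?thesis .
qed

lemma pair_sum_insert:
  fixes l :: "nat \<Rightarrow> real"
  assumes "finite K" "a \<notin> K"
  shows "(\<Sum>L\<in>Pow K. of_bool (card (insert a L) = 2) * prod l (insert a L)) = l a * sum l K"
proof -
  have "(\<Sum>L\<in>Pow K. of_bool (card (insert a L) = 2) * prod l (insert a L)) =
      (\<Sum>L\<in>Pow K. of_bool (card L = 1) * (l a * prod l L))"
  proof (rule sum.cong)
    fix L assume "L \<in> Pow K"
    then have "finite L" "a \<notin> L" using assms finite_subset by auto
    then show "of_bool (card (insert a L) = 2) * prod l (insert a L) = of_bool (card L = 1) * (l a * prod l L)"
      by simp
  qed simp
  then show ?thesis using sum_card_1[OF assms(1), of "\<lambda>L. l a * prod l L"] by (simp add: sum_distrib_left)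
qed

text \<open>Newton's identity for the first two power sums.\<close>

lemma pair_sum_eq: "finite K \<Longrightarrow> 2 * pair_sum l K = (sum l K)\<^sup>2 - (\<Sum>i\<in>K. (l i)\<^sup>2)"
proof (induction K rule: finite_induct)
  case (insert a K)
  have "pair_sum l (insert a K) = pair_sum l K + l a * sum l K"
    unfolding pair_sum_def sum_Pow_insert[OF insert(1,2)] pair_sum_insert[OF insert(1,2)] ..
  then show ?case using insert by (simp add: power2_eq_square algebra_simps)
qed (simp add: pair_sum_def)

text \<open>The number of \<open>m\<close>-element subsets of an \<open>n\<close>-element set that
  contain a fixed \<open>l\<close>-element subset. For \<open>l > m\<close> truncated subtraction
  would make the binomial coefficient \<open>1\<close>, hence the case distinction.\<close>

definition supersets :: "nat \<Rightarrow> nat \<Rightarrow> nat \<Rightarrow> nat" where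
  "supersets n l m = (if l \<le> m then (n - l) choose (m - l) else 0)"

lemma card_supersets:
  assumes "finite S" "L \<subseteq> S"
  shows "card {K. L \<subseteq> K \<and> K \<subseteq> S \<and> card K = m} = supersets (card S) (card L) m"
proof (cases "card L \<le> m")
  case True
  have fin: "finite L" using assms finite_subset by blast
  have "bij_betw (\<lambda>M. L \<union> M) {M. M \<subseteq> S - L \<and> card M = m - card L} {K. L \<subseteq> K \<and> K \<subseteq> S \<and> card K = m}"
  proof (rule bij_betw_byWitness[where f' = "\<lambda>K. K - L"])
    show "(\<lambda>M. L \<union> M) ` {M. M \<subseteq> S - L \<and> card M = m - card L} \<subseteq> {K. L \<subseteq> K \<and> K \<subseteq> S \<and> card K = m}"
    proof (rule image_subsetI)
      fix M assume "M \<in> {M. M \<subseteq> S - L \<and> card M = m - card L}"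
      then have M: "M \<subseteq> S - L" "card M = m - card L" by auto
      then have "finite M" using assms(1) finite_subset[of M S] by auto
      then have "card (L \<union> M) = m" using M True fin by (subst card_Un_disjoint) auto
      then show "L \<union> M \<in> {K. L \<subseteq> K \<and> K \<subseteq> S \<and> card K = m}" using M assms by auto
    qed
    show "(\<lambda>K. K - L) ` {K. L \<subseteq> K \<and> K \<subseteq> S \<and> card K = m} \<subseteq> {M. M \<subseteq> S - L \<and> card M = m - card L}"
      using fin by (auto simp: card_Diff_subset)
  qed auto
  then have "card {K. L \<subseteq> K \<and> K \<subseteq> S \<and> card K = m} = card {M. M \<subseteq> S - L \<and> card M = m - card L}"
    by (rule bij_betw_same_card[symmetric])
  also have "\<dots> = (card S - card L) choose (m - card L)"
    using assms fin by (simp add: n_subsets card_Diff_subset)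
  finally show ?thesis using True by (simp add: supersets_def)
next
  case False
  have e: "{K. L \<subseteq> K \<and> K \<subseteq> S \<and> card K = m} = {}"
    using False card_mono[OF finite_subset[OF _ assms(1)], of _ L] by blast
  show ?thesis unfolding e using False by (simp add: supersets_def)
qed

text \<open>Double counting: a term \<open>f L\<close> occurs for exactly those \<open>K\<close>
  that contain \<open>L \<union> M\<close>, so exchanging the sums leaves the number of these
  \<open>K\<close> as weight.\<close>

lemma sum_supersets:
  fixes f :: "nat set \<Rightarrow> real"
  assumes "finite S" "M \<subseteq> S" "\<And>L. L \<subseteq> S \<Longrightarrow> card L \<noteq> l \<Longrightarrow> f L = 0"
  shows "(\<Sum>K\<in>Pow S. of_bool (card K = m \<and> M \<subseteq> K) * (\<Sum>L\<in>Pow K. f L)) =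
    (\<Sum>L\<in>Pow S. supersets (card S) (card (L \<union> M)) m * f L)"
proof -
  have "(\<Sum>K\<in>Pow S. of_bool (card K = m \<and> M \<subseteq> K) * (\<Sum>L\<in>Pow K. f L)) =
      (\<Sum>K\<in>Pow S. \<Sum>L\<in>Pow S. of_bool (L \<union> M \<subseteq> K \<and> card K = m) * f L)"
  proof (rule sum.cong)
    fix K assume K: "K \<in> Pow S"
    have "(\<Sum>L\<in>Pow K. f L) = (\<Sum>L\<in>Pow S. of_bool (L \<subseteq> K) * f L)"
      by (rule sum.mono_neutral_cong_left) (use K assms(1) in auto)
    then show "of_bool (card K = m \<and> M \<subseteq> K) * (\<Sum>L\<in>Pow K. f L) =
        (\<Sum>L\<in>Pow S. of_bool (L \<union> M \<subseteq> K \<and> card K = m) * f L)"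
      by (simp add: sum_distrib_left of_bool_conj mult_ac)
  qed simp
  also have "\<dots> = (\<Sum>L\<in>Pow S. (\<Sum>K\<in>Pow S. of_bool (L \<union> M \<subseteq> K \<and> card K = m)) * f L)"
    by (subst sum.swap) (simp add: sum_distrib_right)
  also have "\<dots> = (\<Sum>L\<in>Pow S. supersets (card S) (card (L \<union> M)) m * f L)"
  proof (rule sum.cong)
    fix L assume "L \<in> Pow S"
    then have "card {K. L \<union> M \<subseteq> K \<and> K \<subseteq> S \<and> card K = m} = supersets (card S) (card (L \<union> M)) m"
      using assms by (intro card_supersets) auto
    moreover have "(\<Sum>K\<in>Pow S. of_bool (L \<union> M \<subseteq> K \<and> card K = m)) =
        real (card (Pow S \<inter> {K. L \<union> M \<subseteq> K \<and> card K = m}))"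
      using assms(1) by (subst sum_of_bool_eq) auto
    moreover have "Pow S \<inter> {K. L \<union> M \<subseteq> K \<and> card K = m} = {K. L \<union> M \<subseteq> K \<and> K \<subseteq> S \<and> card K = m}" by auto
    ultimately show "(\<Sum>K\<in>Pow S. of_bool (L \<union> M \<subseteq> K \<and> card K = m)) * f L = supersets (card S) (card (L \<union> M)) m * f L"
      by simp
  qed simp
  finally show ?thesis .
qed

text \<open>For the coefficients \<open>f\<close> of a double form this is, up to a factorial, the
  coefficient at \<open>M\<close> of an iterated contraction. With \<open>M = {i}\<close> and
  \<open>f = square_coeff l\<close> it is a diagonal entry of c^3 R^2 / 3!.\<close>

definition star_sum :: "(nat set \<Rightarrow> real) \<Rightarrow> nat set \<Rightarrow> nat set \<Rightarrow> real" where
  "star_sum f S M = (\<Sum>K\<in>Pow S. of_bool (M \<subseteq> K) * f K)"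

text \<open>A set \<open>K\<close> through \<open>i\<close> that contains \<open>L\<close> has to
  contain \<open>l\<close> prescribed elements if \<open>i \<in> L\<close> and \<open>l + 1\<close>
  otherwise; hence the two weights.\<close>

lemma sum_supersets_point:
  fixes f :: "nat set \<Rightarrow> real"
  assumes S: "finite S" "i \<in> S" and f: "\<And>L. L \<subseteq> S \<Longrightarrow> card L \<noteq> l \<Longrightarrow> f L = 0"
  shows "(\<Sum>K\<in>Pow S. of_bool (card K = m \<and> i \<in> K) * (\<Sum>L\<in>Pow K. f L)) =
    supersets (card S) l m * star_sum f S {i} + supersets (card S) (Suc l) m * (sum f (Pow S) - star_sum f S {i})"
proof -
  have "(\<Sum>K\<in>Pow S. of_bool (card K = m \<and> i \<in> K) * (\<Sum>L\<in>Pow K. f L)) =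
      (\<Sum>L\<in>Pow S. supersets (card S) (card (L \<union> {i})) m * f L)"
    using sum_supersets[OF S(1), of "{i}" l f m] S(2) f by simp
  also have "\<dots> = (\<Sum>L\<in>Pow S. supersets (card S) l m * (of_bool (i \<in> L) * f L) +
      supersets (card S) (Suc l) m * (f L - of_bool (i \<in> L) * f L))"
  proof (rule sum.cong)
    fix L assume L: "L \<in> Pow S"
    then have "finite L" using S finite_subset by blast
    then show "supersets (card S) (card (L \<union> {i})) m * f L = supersets (card S) l m * (of_bool (i \<in> L) * f L) +
        supersets (card S) (Suc l) m * (f L - of_bool (i \<in> L) * f L)"
      using f[of L] L by (cases "card L = l") (auto simp: insert_absorb)
  qed simp
  finally show ?thesis
    by (simp add: star_sum_def sum.distrib sum_distrib_left[symmetric] sum_subtractf)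
qed

lemma sum_supersets_all:
  fixes f :: "nat set \<Rightarrow> real"
  assumes S: "finite S" and f: "\<And>L. L \<subseteq> S \<Longrightarrow> card L \<noteq> l \<Longrightarrow> f L = 0"
  shows "(\<Sum>K\<in>Pow S. of_bool (card K = m) * (\<Sum>L\<in>Pow K. f L)) = supersets (card S) l m * sum f (Pow S)"
proof -
  have "(\<Sum>K\<in>Pow S. of_bool (card K = m) * (\<Sum>L\<in>Pow K. f L)) =
      (\<Sum>L\<in>Pow S. supersets (card S) (card L) m * f L)"
    using sum_supersets[OF S(1), of "{}" l f m] f by simp
  also have "\<dots> = (\<Sum>L\<in>Pow S. supersets (card S) l m * f L)"
  proof (rule sum.cong)
    fix L assume "L \<in> Pow S"
    then show "supersets (card S) (card L) m * f L = supersets (card S) l m * f L"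
      using f[of L] by (cases "card L = l") auto
  qed simp
  finally show ?thesis by (simp add: sum_distrib_left)
qed

text \<open>Summing the hypothesis over the middle-sized sets that contain \<open>i\<close> determines
  \<^term>\<open>star_sum f S {i}\<close> from the total sum.\<close>

lemma star_sum_eq_if_complement_invariant:
  fixes f :: "nat set \<Rightarrow> real"
  assumes S: "finite S" "card S = 2 * r" and lr: "l \<le> r" "0 < r"
    and f: "\<And>L. L \<subseteq> S \<Longrightarrow> card L \<noteq> l \<Longrightarrow> f L = 0"
    and inv: "\<And>K. K \<subseteq> S \<Longrightarrow> card K = r \<Longrightarrow> (\<Sum>L\<in>Pow (S - K). f L) = (\<Sum>L\<in>Pow K. f L)"
    and ij: "i \<in> S" "j \<in> S"
  shows "star_sum f S {i} = star_sum f S {j}"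
proof -
  define a where "a = real (supersets (card S) l r)"
  define b where "b = real (supersets (card S) (Suc l) r)"
  \<comment> \<open>By Pascal's rule the difference is
    \<open>(2 * r - Suc l) choose (r - l)\<close>; for \<open>l = r\<close> the two values are
    \<open>1\<close> and \<open>0\<close>.\<close>
  have "a > b"
  proof (cases "l = r")
    case True
    then show ?thesis by (simp add: a_def b_def supersets_def)
  next
    case False
    have "(2 * r - l) choose (r - l) = ((2 * r - Suc l) choose (r - Suc l)) + ((2 * r - Suc l) choose (r - l))"
      using lr False choose_reduce_nat[of "2 * r - l" "r - l"] by simp
    moreover have "(2 * r - Suc l) choose (r - l) > 0" using lr False by (simp add: zero_less_binomial_iff)
    ultimately show ?thesis using lr False S by (simp add: a_def b_def supersets_def)
  qed
  have "2 * (a - b) * star_sum f S {k} = (a - 2 * b) * sum f (Pow S)" if k: "k \<in> S" for k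
  proof -
    let ?s = "\<lambda>K. \<Sum>L\<in>Pow K. f L"
    \<comment> \<open>Complementation exchanges the half-size sets through \<open>k\<close> with
      those avoiding \<open>k\<close> and preserves the subset sums, so either family carries half
      of the total.\<close>
    have "(\<Sum>K\<in>Pow S. of_bool (card K = r \<and> k \<in> K) * ?s K) = (\<Sum>K\<in>Pow S. of_bool (card K = r \<and> k \<notin> K) * ?s K)"
    proof (rule sum.reindex_bij_witness[of _ "\<lambda>K. S - K" "\<lambda>K. S - K"])
      fix K assume K: "K \<in> Pow S"
      then have "card (S - K) = card S - card K" "card K \<le> card S"
        using S finite_subset[of K S] card_mono[of S K] by (auto simp: card_Diff_subset)
      then have c: "card (S - K) = r \<longleftrightarrow> card K = r" using S by auto
      show "of_bool (card (S - K) = r \<and> k \<notin> S - K) * ?s (S - K) = of_bool (card K = r \<and> k \<in> K) * ?s K"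
        using inv[of K] K k c by auto
    qed auto
    also have "\<dots> = (\<Sum>K\<in>Pow S. of_bool (card K = r) * ?s K) - (\<Sum>K\<in>Pow S. of_bool (card K = r \<and> k \<in> K) * ?s K)"
      unfolding sum_subtractf[symmetric] by (rule sum.cong) auto
    finally have "2 * (\<Sum>K\<in>Pow S. of_bool (card K = r \<and> k \<in> K) * ?s K) = (\<Sum>K\<in>Pow S. of_bool (card K = r) * ?s K)"
      by simp
    then show ?thesis
      using sum_supersets_point[OF S(1) k, of l f r] sum_supersets_all[OF S(1), of l f r] f
      by (simp add: a_def b_def algebra_simps)
  qed
  then have "2 * (a - b) * star_sum f S {i} = 2 * (a - b) * star_sum f S {j}"
    using ij by metis
  moreover have "2 * (a - b) \<noteq> 0" using \<open>a > b\<close> by simp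
  ultimately show ?thesis using mult_left_cancel by blast
qed

section \<open>Coefficients of the curvature of a conformally flat metric\<close>

lemma subset_convolution_metric:
  assumes "finite K"
  shows "subset_convolution (\<lambda>K. of_bool (card K = 1)) b K = (\<Sum>i\<in>K. b (K - {i}))"
  unfolding subset_convolution_def using sum_card_1[OF assms, of "\<lambda>I. b (K - I)"] by simp

text \<open>Each factor of the metric removes one element, and a set of size \<open>k\<close> can be
  emptied in \<open>k!\<close> orders.\<close>

lemma diagonal_metric_power:
  fixes e :: "nat \<Rightarrow> real^'n::finite"
  assumes "euclidean_frame G e"
  shows "diagonal e (dpower (metric_dform G) k) (\<lambda>K. of_bool (card K = k) * fact k)"
proof (induction k)
  case 0
  show ?case unfolding dpower.simps
    by (rule diagonal_cong[OF diagonal_dunit]) (use finite_subset in \<open>fastforce\<close>)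
next
  case (Suc k)
  show ?case unfolding dpower.simps
  proof (rule diagonal_cong[OF diagonal_dprod[OF euclidean_frame.diagonal_metric[OF assms] Suc]])
    fix K assume "K \<subseteq> {..<CARD('n)}"
    then have fin: "finite K" by (rule finite_subset) simp
    have "(\<Sum>i\<in>K. of_bool (card (K - {i}) = k) * fact k) = (\<Sum>i\<in>K. of_bool (card K = Suc k) * fact k :: real)"
    proof (rule sum.cong)
      fix i assume "i \<in> K"
      then have "card K = Suc (card (K - {i}))" by (rule card.remove[OF fin])
      then show "of_bool (card (K - {i}) = k) * fact k = (of_bool (card K = Suc k) * fact k :: real)" by simp
    qed simp
    also have "\<dots> = of_bool (card K = Suc k) * fact (Suc k)" by simp
    finally show "subset_convolution (\<lambda>K. of_bool (card K = 1)) (\<lambda>K. of_bool (card K = k) * fact k) K =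
        (of_bool (card K = Suc k) * fact (Suc k) :: real)"
      using subset_convolution_metric[OF fin] by simp
  qed
qed

text \<open>Since \<open>b\<close> lives in one degree, the size condition on the complement becomes
  a condition on \<open>K\<close> alone and comes out of the sum.\<close>

lemma subset_convolution_metric_power:
  assumes "finite K" "\<And>J. J \<subseteq> K \<Longrightarrow> card J \<noteq> m \<Longrightarrow> b J = 0"
  shows "subset_convolution (\<lambda>K. of_bool (card K = k) * fact k) b K =
    of_bool (card K = k + m) * fact k * (\<Sum>J\<in>Pow K. b J)"
proof -
  have "subset_convolution (\<lambda>K. of_bool (card K = k) * fact k) b K =
      (\<Sum>J\<in>Pow K. of_bool (card (K - J) = k) * fact k * b J)"
    unfolding subset_convolution_def
    by (rule sum.reindex_bij_witness[of _ "\<lambda>I. K - I" "\<lambda>I. K - I"]) (auto simp: double_diff)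
  also have "\<dots> = (\<Sum>J\<in>Pow K. of_bool (card K = k + m) * fact k * b J)"
  proof (rule sum.cong)
    fix J assume J: "J \<in> Pow K"
    then have "card (K - J) = card K - card J" "card J \<le> card K"
      using assms(1) finite_subset[of J K] card_mono[of K J] by (auto simp: card_Diff_subset)
    then show "of_bool (card (K - J) = k) * fact k * b J = of_bool (card K = k + m) * fact k * b J"
      using assms(2)[of J] J by (cases "card J = m") auto
  qed simp
  finally show ?thesis by (simp add: sum_distrib_left)
qed

definition square_coeff :: "(nat \<Rightarrow> real) \<Rightarrow> nat set \<Rightarrow> real" where
  "square_coeff l K = of_bool (card K = 4) * (4 * pair_sum l K)"

lemma curvature_coeffs:
  assumes "finite K"
  shows "subset_convolution (\<lambda>K. of_bool (card K = 1)) (\<lambda>K. of_bool (card K = 1) * sum l K) K =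
    of_bool (card K = 2) * sum l K"
proof (cases "card K = 2")
  case True
  then obtain a b where "K = {a, b}" "a \<noteq> b" by (auto simp: card_2_iff)
  then show ?thesis unfolding subset_convolution_metric[OF assms] by (auto simp: insert_Diff_if)
next
  case False
  have "of_bool (card (K - {i}) = 1) * sum l (K - {i}) = 0" if "i \<in> K" for i
    using False that assms by (auto simp: card_Diff_singleton)
  then show ?thesis unfolding subset_convolution_metric[OF assms] using False by simp
qed

lemma card_4E:
  assumes "card K = 4"
  obtains a b c d where "K = {a, b, c, d}" "distinct [a, b, c, d]"
proof -
  obtain xs where xs: "set xs = K" "distinct xs"
    using finite_distinct_list[of K] assms card.infinite[of K] by force
  then have "length xs = 4" using assms distinct_card by metis
  then obtain a b c d where "xs = [a, b, c, d]"
    by (auto simp: numeral_eq_Suc length_Suc_conv)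
  then show ?thesis using that xs by auto
qed

text \<open>Of the six ordered splittings of a four-element set into two pairs, exactly four
  separate two given elements \<open>i\<close> and \<open>j\<close>, so every product
  \<open>l i * l j\<close> occurs four times.\<close>

lemma square_coeffs:
  assumes "finite K"
  shows "subset_convolution (\<lambda>K. of_bool (card K = 2) * sum l K) (\<lambda>K. of_bool (card K = 2) * sum l K) K =
    square_coeff l K"
proof (cases "card K = 4")
  case True
  then obtain a b c d where K: "K = {a, b, c, d}" "distinct [a, b, c, d]" by (rule card_4E)
  show ?thesis unfolding subset_convolution_def square_coeff_def pair_sum_def K(1)
    using K(2) by (simp add: sum_Pow_insert insert_Diff_if algebra_simps del: sum_of_bool_mult_eq sum_mult_of_bool_eq)
next
  case False
  have z: "of_bool (card I = 2) * sum l I * (of_bool (card (K - I) = 2) * sum l (K - I)) = 0" if "I \<in> Pow K" for I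
  proof -
    have "card (K - I) = card K - card I" "card I \<le> card K"
      using that assms finite_subset[of I K] card_mono[of K I] by (auto simp: card_Diff_subset)
    then show ?thesis using False by auto
  qed
  have "subset_convolution (\<lambda>K. of_bool (card K = 2) * sum l K) (\<lambda>K. of_bool (card K = 2) * sum l K) K = 0"
    unfolding subset_convolution_def using z by (intro sum.neutral ballI)
  then show ?thesis using False by (simp add: square_coeff_def)
qed

text \<open>The two orders of splitting a pair into singletons give the factor \<open>2\<close>.
  These are the coefficients of \<open>h h\<close>, the quotient of the squared curvature by the
  squared metric.\<close>

lemma schouten_square_coeffs:
  assumes "finite K"
  shows "subset_convolution (\<lambda>K. of_bool (card K = 1) * sum l K) (\<lambda>K. of_bool (card K = 1) * sum l K) K =
    of_bool (card K = 2) * (2 * prod l K)"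
proof -
  have "subset_convolution (\<lambda>K. of_bool (card K = 1) * sum l K) (\<lambda>K. of_bool (card K = 1) * sum l K) K =
      (\<Sum>i\<in>K. l i * (of_bool (card (K - {i}) = 1) * sum l (K - {i})))"
    unfolding subset_convolution_def
    using sum_card_1[OF assms, of "\<lambda>I. sum l I * (of_bool (card (K - I) = 1) * sum l (K - I))"]
    by (simp add: mult.assoc)
  also have "\<dots> = of_bool (card K = 2) * (2 * prod l K)"
  proof (cases "card K = 2")
    case True
    then obtain a b where "K = {a, b}" "a \<noteq> b" by (auto simp: card_2_iff)
    then show ?thesis by (auto simp: insert_Diff_if)
  next
    case False
    have "l i * (of_bool (card (K - {i}) = 1) * sum l (K - {i})) = 0" if "i \<in> K" for i
      using False that assms by (auto simp: card_Diff_singleton)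
    then show ?thesis using False by simp
  qed
  finally show ?thesis .
qed

lemma star_sum_pair:
  assumes "finite S" "i \<in> S"
  shows "star_sum (\<lambda>L. of_bool (card L = 2) * prod l L) S {i} = l i * (sum l S - l i)"
proof -
  obtain T where T: "S = insert i T" "i \<notin> T" "finite T" using assms by (metis finite_insert mk_disjoint_insert)
  have "(\<Sum>K\<in>Pow T. of_bool ({i} \<subseteq> K) * (of_bool (card K = 2) * prod l K)) = 0"
    by (rule sum.neutral) (use T in auto)
  then show ?thesis unfolding star_sum_def T(1) sum_Pow_insert[OF T(3,2)]
    using pair_sum_insert[OF T(3,2), of l] T by simp
qed

text \<open>Every pair in \<open>K\<close> lies in the same number of four-element subsets of
  \<open>K\<close>, so multiplying the squared curvature by a power of the metric merely rescales
  \<open>pair_sum\<close>.\<close>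

lemma sum_square_coeff:
  assumes "finite K"
  shows "(\<Sum>J\<in>Pow K. square_coeff l J) = 4 * supersets (card K) 2 4 * pair_sum l K"
proof -
  have "(\<Sum>J\<in>Pow K. square_coeff l J) = 4 * (\<Sum>J\<in>Pow K. of_bool (card J = 4) * pair_sum l J)"
    by (simp add: square_coeff_def sum_distrib_left mult_ac)
  also have "(\<Sum>J\<in>Pow K. of_bool (card J = 4) * pair_sum l J) = supersets (card K) 2 4 * pair_sum l K"
    unfolding pair_sum_def by (rule sum_supersets_all[OF assms]) simp
  finally show ?thesis by simp
qed

text \<open>If all \<open>l i * (s - l i)\<close> agree, where \<open>s\<close> is the total sum, then \<open>2 * pair_sum l K\<close> is a constant minus
  \<open>sum l K * sum l (S - K)\<close> on the sets \<open>K\<close> of half size.\<close>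

lemma pair_sum_complement:
  assumes S: "finite S" "card S = 2 * r" "4 < card S"
    and const: "\<And>i j. i \<in> S \<Longrightarrow> j \<in> S \<Longrightarrow> star_sum (square_coeff l) S {i} = star_sum (square_coeff l) S {j}"
    and K: "K \<subseteq> S" "card K = r"
  shows "pair_sum l (S - K) = pair_sum l K"
proof -
  let ?f = "\<lambda>L. of_bool (card L = 2) * prod l L"
  define a where "a = real (supersets (card S) 2 4)"
  define b where "b = real (supersets (card S) (Suc 2) 4)"
  have star: "star_sum (square_coeff l) S {i} = 4 * (a * (l i * (sum l S - l i)) + b * (sum ?f (Pow S) - l i * (sum l S - l i)))"
    if i: "i \<in> S" for i
  proof -
    have "star_sum (square_coeff l) S {i} = 4 * (\<Sum>K\<in>Pow S. of_bool (card K = 4 \<and> i \<in> K) * (\<Sum>L\<in>Pow K. ?f L))"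
      unfolding star_sum_def square_coeff_def pair_sum_def by (simp add: sum_distrib_left of_bool_conj mult_ac)
    then show ?thesis using sum_supersets_point[OF S(1) i, of 2 ?f 4] star_sum_pair[OF S(1) i]
      by (simp add: a_def b_def)
  qed
  \<comment> \<open>By Pascal's rule \<open>a - b\<close> is \<open>(card S - 3) choose 2\<close>,
    which is positive exactly for sizes above four; here \<open>4 < card S\<close> enters.\<close>
  have "a > b"
  proof -
    have "(card S - 2) choose 2 = ((card S - 3) choose 1) + ((card S - 3) choose 2)"
      using S(3) choose_reduce_nat[of "card S - 2" 2] by simp
    moreover have "(card S - 3) choose 2 > 0" using S(3) by (simp add: zero_less_binomial_iff)
    ultimately show ?thesis by (simp add: a_def b_def supersets_def)
  qed
  have eq: "l i * (sum l S - l i) = l j * (sum l S - l j)" if "i \<in> S" "j \<in> S" for i j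
  proof -
    have "(a - b) * (l i * (sum l S - l i)) = (a - b) * (l j * (sum l S - l j))"
      using const[OF that] star[OF that(1)] star[OF that(2)] by (simp add: algebra_simps)
    then show ?thesis using \<open>a > b\<close> by simp
  qed
  have "S \<noteq> {}" using S by auto
  then obtain i where "i \<in> S" by blast
  define m where "m = l i * (sum l S - l i)"
  have m: "l j * (sum l S - l j) = m" if "j \<in> S" for j using eq[OF that \<open>i \<in> S\<close>] by (simp add: m_def)
  have half: "2 * pair_sum l M = real r * m - sum l M * sum l (S - M)" if M: "M \<subseteq> S" "card M = r" for M
  proof -
    have finM: "finite M" using S M finite_subset by blast
    have "real r * m = (\<Sum>j\<in>M. l j * (sum l S - l j))"
      using m M by (subst sum.cong[OF refl, of _ _ "\<lambda>_. m"]) auto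
    also have "\<dots> = sum l M * sum l S - (\<Sum>j\<in>M. (l j)\<^sup>2)"
      by (simp add: right_diff_distrib sum_subtractf sum_distrib_right power2_eq_square)
    finally have "(\<Sum>j\<in>M. (l j)\<^sup>2) = sum l M * sum l S - real r * m" by simp
    moreover have "sum l S = sum l M + sum l (S - M)" using S M by (simp add: sum_diff)
    ultimately have "2 * pair_sum l M = (sum l M)\<^sup>2 - (sum l M * (sum l M + sum l (S - M)) - real r * m)"
      using pair_sum_eq[OF finM, of l] by simp
    then show ?thesis by (simp add: power2_eq_square distrib_left)
  qed
  have finK: "finite K" using S K finite_subset by blast
  have "card (S - K) = r" "S - (S - K) = K" using K S finK by (auto simp: card_Diff_subset)
  then show ?thesis using half[OF K] half[of "S - K"] by (simp add: mult.commute)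
qed


section \<open>The equivalence in a single tangent space\<close>

text \<open>\<open>R = g h\<close> with \<open>h\<close> symmetric and diagonal in the orthonormal basis \<open>e\<close>; for a conformally flat
  metric \<open>h\<close> is the Schouten tensor.\<close>

locale conformally_flat_curvature = euclidean_frame G e
  for G :: "real^'n::finite^'n" and e +
  fixes h :: "real^'n \<Rightarrow> real^'n \<Rightarrow> real" and l :: "nat \<Rightarrow> real" and R :: "'n dform"
  assumes bilinear: "bilinear h" and symmetric: "h x y = h y x"
    and eigen: "i < CARD('n) \<Longrightarrow> j < CARD('n) \<Longrightarrow> h (e i) (e j) = of_bool (i = j) * l i"
    and R_eq: "R = dprod (metric_dform G) (bilinear_dform h)"
begin

lemma fin_subset: "K \<subseteq> {..<CARD('n)} \<Longrightarrow> finite K"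
  using finite_subset[OF _ finite_lessThan] by blast

lemma is_dform_R: "is_dform 2 2 R"
  unfolding R_eq using is_dform_dprod[OF is_dform_metric is_dform_bilinear[OF bilinear]] by (simp add: numeral_2_eq_2)

lemma diagonal_h: "diagonal e (bilinear_dform h) (\<lambda>K. of_bool (card K = 1) * sum l K)"
  by (rule diagonal_bilinear[OF eigen])

lemma diagonal_R: "diagonal e R (\<lambda>K. of_bool (card K = 2) * sum l K)"
  unfolding R_eq
  by (rule diagonal_cong[OF diagonal_dprod[OF diagonal_metric diagonal_h]])
    (rule curvature_coeffs[OF fin_subset])

lemma is_dform_square: "is_dform 4 4 (dpower R 2)"
  using is_dform_dpower[OF is_dform_R, of 2] by simp

lemma diagonal_square: "diagonal e (dpower R 2) (square_coeff l)"
proof -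
  \<comment> \<open>\<open>dpower\<close> ends in the unit, whose only coefficient sits at the empty
    set, so the convolution keeps the single term \<open>I = K\<close>.\<close>
  have "diagonal e (dprod R dunit) (\<lambda>K. of_bool (card K = 2) * sum l K)"
  proof (rule diagonal_cong[OF diagonal_dprod[OF diagonal_R diagonal_dunit]])
    fix K assume "K \<subseteq> {..<CARD('n)}"
    then have fin: "finite K" by (rule fin_subset)
    have "subset_convolution (\<lambda>K. of_bool (card K = 2) * sum l K) (\<lambda>K. of_bool (K = {})) K =
        (\<Sum>I\<in>{K}. of_bool (card I = 2) * sum l I * of_bool (K - I = {}))"
      unfolding subset_convolution_def by (rule sum.mono_neutral_right) (use fin in auto)
    then show "subset_convolution (\<lambda>K. of_bool (card K = 2) * sum l K) (\<lambda>K. of_bool (K = {})) K =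
        of_bool (card K = 2) * sum l K" by simp
  qed
  moreover have "dpower R 2 = dprod R (dprod R dunit)" by (simp add: numeral_2_eq_2)
  ultimately show ?thesis
    using diagonal_cong[OF diagonal_dprod[OF diagonal_R], of "dprod R dunit" _ "square_coeff l"] square_coeffs[OF fin_subset]
    by simp
qed

text \<open>Degree and coefficients go through the induction together, since the rule for
  contracting a diagonal double form needs its degree. One more contraction multiplies by
  \<open>Suc k\<close>: a four-element set containing \<open>K\<close> is reached through each of
  its \<open>Suc k\<close> elements outside \<open>K\<close>.\<close>

lemma contraction_power:
  assumes "k \<le> 4"
  shows "is_dform (4 - k) (4 - k) ((contraction G ^^ k) (dpower R 2)) \<and>
    diagonal e ((contraction G ^^ k) (dpower R 2)) (\<lambda>K. of_bool (card K = 4 - k) * (fact k * star_sum (square_coeff l) {..<CARD('n)} K))"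
  using assms
proof (induction k)
  case 0
  have "square_coeff l K = of_bool (card K = 4) * star_sum (square_coeff l) {..<CARD('n)} K" if K: "K \<subseteq> {..<CARD('n)}" for K
  proof (cases "card K = 4")
    case True
    have "star_sum (square_coeff l) {..<CARD('n)} K = (\<Sum>J\<in>{K}. of_bool (K \<subseteq> J) * square_coeff l J)"
      unfolding star_sum_def
    proof (rule sum.mono_neutral_right)
      show "\<forall>J\<in>Pow {..<CARD('n)} - {K}. of_bool (K \<subseteq> J) * square_coeff l J = 0"
      proof
        fix J assume J: "J \<in> Pow {..<CARD('n)} - {K}"
        then have "finite J" using fin_subset by auto
        then have "\<not> (K \<subseteq> J \<and> card J = 4)" using card_subset_eq[of J K] True J by auto
        then show "of_bool (K \<subseteq> J) * square_coeff l J = 0" by (auto simp: square_coeff_def)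
      qed
    qed (use K in auto)
    then show ?thesis using True by simp
  qed (simp add: square_coeff_def)
  then have "diagonal e (dpower R 2) (\<lambda>K. of_bool (card K = 4) * (fact 0 * star_sum (square_coeff l) {..<CARD('n)} K))"
    by (intro diagonal_cong[OF diagonal_square]) simp
  then show ?case using is_dform_square by simp
next
  case (Suc k)
  let ?w = "(contraction G ^^ k) (dpower R 2)"
  have k: "4 - k = Suc (4 - Suc k)" using Suc.prems by simp
  have df: "is_dform (Suc (4 - Suc k)) (Suc (4 - Suc k)) ?w"
    and dg: "diagonal e ?w (\<lambda>K. of_bool (card K = 4 - k) * (fact k * star_sum (square_coeff l) {..<CARD('n)} K))"
    using Suc k by auto
  have "diagonal e (contraction G ?w) (\<lambda>K. of_bool (card K = 4 - Suc k) * (fact (Suc k) * star_sum (square_coeff l) {..<CARD('n)} K))"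
  proof (rule diagonal_cong[OF diagonal_contraction[OF euclidean_frame_axioms df dg]])
    fix K assume K: "K \<subseteq> {..<CARD('n)}"
    then have fin: "finite K" by (rule fin_subset)
    have "(\<Sum>i\<in>{..<CARD('n)} - K. star_sum (square_coeff l) {..<CARD('n)} (insert i K)) = real (Suc k) * star_sum (square_coeff l) {..<CARD('n)} K"
      if c: "card K = 4 - Suc k"
    proof -
      have "(\<Sum>i\<in>{..<CARD('n)} - K. star_sum (square_coeff l) {..<CARD('n)} (insert i K)) =
          (\<Sum>J\<in>Pow {..<CARD('n)}. (\<Sum>i\<in>{..<CARD('n)} - K. of_bool (insert i K \<subseteq> J)) * square_coeff l J)"
        unfolding star_sum_def by (subst sum.swap) (simp add: sum_distrib_right del: sum_of_bool_mult_eq sum_of_bool_eq)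
      also have "\<dots> = (\<Sum>J\<in>Pow {..<CARD('n)}. real (Suc k) * (of_bool (K \<subseteq> J) * square_coeff l J))"
      proof (rule sum.cong)
        fix J assume J: "J \<in> Pow {..<CARD('n)}"
        show "(\<Sum>i\<in>{..<CARD('n)} - K. of_bool (insert i K \<subseteq> J)) * square_coeff l J =
            real (Suc k) * (of_bool (K \<subseteq> J) * square_coeff l J)"
        proof (cases "K \<subseteq> J \<and> card J = 4")
          case True
          then have "({..<CARD('n)} - K) \<inter> {i. insert i K \<subseteq> J} = J - K" using J by auto
          moreover have "card (J - K) = Suc k" using True c fin Suc.prems by (simp add: card_Diff_subset)
          ultimately show ?thesis using True by simp
        next
          case False
          then show ?thesis by (auto simp: square_coeff_def)
        qed
      qed simp
      finally show ?thesis by (simp add: star_sum_def sum_distrib_left del: sum_of_bool_mult_eq sum_of_bool_eq)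
    qed
    moreover have "(\<Sum>i\<in>{..<CARD('n)} - K. of_bool (card (insert i K) = 4 - k) * (fact k * star_sum (square_coeff l) {..<CARD('n)} (insert i K))) =
        (\<Sum>i\<in>{..<CARD('n)} - K. of_bool (card K = 4 - Suc k) * fact k * star_sum (square_coeff l) {..<CARD('n)} (insert i K))"
      using fin k by (intro sum.cong) auto
    ultimately show "(\<Sum>i\<in>{..<CARD('n)} - K. of_bool (card (insert i K) = 4 - k) * (fact k * star_sum (square_coeff l) {..<CARD('n)} (insert i K))) =
        of_bool (card K = 4 - Suc k) * (fact (Suc k) * star_sum (square_coeff l) {..<CARD('n)} K)"
      by (auto simp: sum_distrib_left[symmetric] algebra_simps)
  qed
  then show ?case using is_dform_contraction[OF df] by simp
qed

lemma h4_eq: "h4 G R = star_sum (square_coeff l) {..<CARD('n)} {}"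
proof -
  have "diagonal e ((contraction G ^^ 4) (dpower R 2)) (\<lambda>K. of_bool (card K = 0) * (fact 4 * star_sum (square_coeff l) {..<CARD('n)} K))"
    using contraction_power[of 4] by simp
  then have "(contraction G ^^ 4) (dpower R 2) (basis_list e {}) (basis_list e {}) = fact 4 * star_sum (square_coeff l) {..<CARD('n)} {}"
    unfolding diagonal_def by simp
  then show ?thesis by (simp add: h4_def basis_list_def)
qed

lemma einstein4_iff:
  "einstein4_at G R \<mu> \<longleftrightarrow> (\<forall>i<CARD('n). star_sum (square_coeff l) {..<CARD('n)} {} - star_sum (square_coeff l) {..<CARD('n)} {i} = \<mu>)"
proof -
  \<comment> \<open>Moving everything to one side gives a single \<open>(1,1)\<close> double form,
    so the condition can be tested on pairs of basis vectors, and the entries off the diagonal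
    vanish by themselves.\<close>
  define E where "E xs ys = h4 G R * metric_dform G xs ys - (contraction G ^^ 3) (dpower R 2) xs ys / fact 3
      - \<mu> * metric_dform G xs ys" for xs ys
  have c: "is_dform 1 1 ((contraction G ^^ 3) (dpower R 2))"
    "diagonal e ((contraction G ^^ 3) (dpower R 2)) (\<lambda>K. of_bool (card K = 1) * (fact 3 * star_sum (square_coeff l) {..<CARD('n)} K))"
    using contraction_power[of 3] by simp_all
  have E: "is_dform 1 1 E"
    using c(1) is_dform_metric[of G] is_form_scale[of 1 _ "1 / fact 3"]
    unfolding is_dform_def E_def[abs_def] by (auto intro!: is_form_diff is_form_scale)
  have val: "E (basis_list e I) (basis_list e J) =
      of_bool (I = J) * (of_bool (card I = 1) * (star_sum (square_coeff l) {..<CARD('n)} {} - star_sum (square_coeff l) {..<CARD('n)} I - \<mu>))"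
    if "I \<subseteq> {..<CARD('n)}" "J \<subseteq> {..<CARD('n)}" for I J
    using c(2) diagonal_metric that unfolding E_def diagonal_def h4_eq by auto
  have "einstein4_at G R \<mu> \<longleftrightarrow> E = (\<lambda>_ _. 0)"
    by (auto simp: einstein4_at_def E_def fun_eq_iff)
  also have "\<dots> \<longleftrightarrow> (\<forall>i<CARD('n). star_sum (square_coeff l) {..<CARD('n)} {} - star_sum (square_coeff l) {..<CARD('n)} {i} = \<mu>)"
  proof
    assume "E = (\<lambda>_ _. 0)"
    then show "\<forall>i<CARD('n). star_sum (square_coeff l) {..<CARD('n)} {} - star_sum (square_coeff l) {..<CARD('n)} {i} = \<mu>"
      using val by fastforce
  next
    assume *: "\<forall>i<CARD('n). star_sum (square_coeff l) {..<CARD('n)} {} - star_sum (square_coeff l) {..<CARD('n)} {i} = \<mu>"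
    show "E = (\<lambda>_ _. 0)"
    proof (rule dform_eqI[OF E])
      fix I J assume IJ: "I \<subseteq> {..<CARD('n)}" "J \<subseteq> {..<CARD('n)}"
      show "E (basis_list e I) (basis_list e J) = 0"
        unfolding val[OF IJ] using * IJ by (auto simp: card_1_singleton_iff)
    qed (simp add: is_dform_def is_form_zero)
  qed
  finally show ?thesis .
qed

text \<open>From dimension 8 on, the middle-degree double form has the subset sums of
  \<open>square_coeff l\<close> as coefficients, up to a constant, and
  \<open>star_sum_eq_if_complement_invariant\<close> applies in degree \<open>4\<close>. In
  dimension 6 it is applied in degree \<open>2\<close> to the diagonal entries \<open>b\<close> of
  \<open>B\<close>: the diagonal entries of the metric times \<open>B\<close>, and of its Hodge
  star, involve only those of \<open>B\<close>.\<close>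

lemma thorpe4_imp_star_const:
  assumes "thorpe4_at G R" "even CARD('n)" "CARD('n) \<ge> 6" "i < CARD('n)" "j < CARD('n)"
  shows "star_sum (square_coeff l) {..<CARD('n)} {i} = star_sum (square_coeff l) {..<CARD('n)} {j}"
proof (cases "CARD('n) = 6")
  case True
  let ?N = "{..<CARD('n)}" and ?g = "metric_dform G"
  obtain B where B: "is_dform 2 2 B" "dpower R 2 = dprod (dpower ?g 2) B" "hodge G (dprod ?g B) = dprod ?g B"
    using assms(1) True unfolding thorpe4_at_def by auto
  define b where "b I = B (basis_list e I) (basis_list e I)" for I
  have b0: "b J = 0" if "card J \<noteq> 2" for J
    using B(1) that by (auto simp: b_def is_dform_def is_form_def)
  have sq: "square_coeff l K = of_bool (card K = 4) * (2 * (\<Sum>J\<in>Pow K. b J))" if K: "K \<subseteq> ?N" for K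
  proof -
    have "square_coeff l K = dpower R 2 (basis_list e K) (basis_list e K)"
      using diagonal_square K by (simp add: diagonal_def)
    also have "\<dots> = subset_convolution (\<lambda>K. of_bool (card K = 2) * fact 2) b K"
      unfolding B(2) using dprod_diagonal_entry[OF diagonal_metric_power[OF euclidean_frame_axioms] K, of 2 B]
      by (simp add: b_def[abs_def])
    also have "\<dots> = of_bool (card K = 4) * (2 * (\<Sum>J\<in>Pow K. b J))"
      by (subst subset_convolution_metric_power[where m = 2]) (use fin_subset[OF K] b0 in \<open>auto simp: fact_numeral\<close>)
    finally show ?thesis .
  qed
  have gB: "dprod ?g B (basis_list e K) (basis_list e K) = (\<Sum>J\<in>Pow K. b J)" if K: "K \<subseteq> ?N" "card K = 3" for K
  proof -
    have "diagonal e ?g (\<lambda>K. of_bool (card K = 1) * fact 1)" using diagonal_metric by simp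
    then have "dprod ?g B (basis_list e K) (basis_list e K) = subset_convolution (\<lambda>K. of_bool (card K = 1) * fact 1) b K"
      using dprod_diagonal_entry[OF _ K(1)] by (simp add: b_def[abs_def])
    also have "\<dots> = (\<Sum>J\<in>Pow K. b J)"
      by (subst subset_convolution_metric_power[where m = 2]) (use fin_subset[OF K(1)] b0 K in auto)
    finally show ?thesis .
  qed
  have inv: "(\<Sum>L\<in>Pow (?N - K). b L) = (\<Sum>L\<in>Pow K. b L)" if K: "K \<subseteq> ?N" "card K = 3" for K
  proof -
    have cK: "card (?N - K) = 3" using K fin_subset[OF K(1)] True by (simp add: card_Diff_subset)
    have d: "is_dform 3 3 (dprod ?g B)" using is_dform_dprod[OF is_dform_metric B(1), of G] by (simp add: numeral_3_eq_3)
    have "hodge G (dprod ?g B) (basis_list e K) (basis_list e K) =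
        dprod ?g B (basis_list e (?N - K)) (basis_list e (?N - K))"
      using hodge_basis_list[OF euclidean_frame_axioms d K(1) K(1)] K True vol_form_complement_square[OF K(1)] by simp
    then show ?thesis using gB[OF K] gB[of "?N - K"] cK B(3) by simp
  qed
  have bij: "star_sum b ?N {k} = star_sum b ?N {i}" if "k < CARD('n)" for k
    by (rule star_sum_eq_if_complement_invariant[of ?N 3 2]) (use True b0 inv that assms in auto)
  \<comment> \<open>The coefficients of the squared curvature are twice the subset sums of
    \<open>b\<close>, so another double count expresses their star sums by the star sum and the
    total sum of \<open>b\<close>.\<close>
  have "star_sum (square_coeff l) {..<CARD('n)} {k} = 2 * (\<Sum>K\<in>Pow ?N. of_bool (card K = 4 \<and> k \<in> K) * (\<Sum>L\<in>Pow K. b L))" for k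
    unfolding star_sum_def by (subst sum_distrib_left, rule sum.cong) (auto simp: sq)
  then have "star_sum (square_coeff l) {..<CARD('n)} {k} = 2 * (supersets CARD('n) 2 4 * star_sum b ?N {k} +
      supersets CARD('n) (Suc 2) 4 * (sum b (Pow ?N) - star_sum b ?N {k}))" if "k < CARD('n)" for k
    using sum_supersets_point[of ?N k 2 b 4] that b0 by simp
  from this[OF assms(4)] this[OF assms(5)] show ?thesis unfolding bij[OF assms(5)] by simp
next
  case False
  let ?N = "{..<CARD('n)}" and ?g = "metric_dform G"
  define r where "r = CARD('n) div 2"
  have r: "CARD('n) = 2 * r" "4 \<le> r" using assms(2,3) False by (auto simp: r_def elim!: evenE)
  let ?w = "dprod (dpower ?g (r - 4)) (dpower R 2)"
  let ?a = "\<lambda>K. of_bool (card K = r) * fact (r - 4) * (\<Sum>J\<in>Pow K. square_coeff l J)"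
  have h: "hodge G ?w = ?w" using assms(1) False unfolding thorpe4_at_def r_def by (simp add: Let_def)
  have d: "is_dform r r ?w"
    using is_dform_dprod[OF is_dform_dpower[OF is_dform_metric] is_dform_square, of "r - 4" G] r by simp
  have dg: "diagonal e ?w ?a"
    by (rule diagonal_cong[OF diagonal_dprod[OF diagonal_metric_power[OF euclidean_frame_axioms] diagonal_square]])
      (subst subset_convolution_metric_power[where m = 4], use r fin_subset in \<open>auto simp: square_coeff_def\<close>)
  show ?thesis
  proof (rule star_sum_eq_if_complement_invariant[of ?N r 4])
    fix K assume K: "K \<subseteq> ?N" "card K = r"
    have cK: "card (?N - K) = r" using K fin_subset[OF K(1)] r by (simp add: card_Diff_subset)
    have "hodge G ?w (basis_list e K) (basis_list e K) = ?a (?N - K)"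
      using diagonal_hodge[OF euclidean_frame_axioms d dg] K by (simp add: diagonal_def)
    moreover have "?w (basis_list e K) (basis_list e K) = ?a K" using dg K by (simp add: diagonal_def)
    ultimately show "(\<Sum>L\<in>Pow (?N - K). square_coeff l L) = (\<Sum>L\<in>Pow K. square_coeff l L)"
      using h cK K by simp
  qed (use r assms in \<open>auto simp: square_coeff_def\<close>)
qed

lemma hodge_fixed:
  assumes d: "is_dform r r \<omega>" and dg: "diagonal e \<omega> a" and r: "CARD('n) = 2 * r"
    and inv: "\<And>K. K \<subseteq> {..<CARD('n)} \<Longrightarrow> a ({..<CARD('n)} - K) = a K"
  shows "hodge G \<omega> = \<omega>"
proof (rule dform_eqI)
  have [simp]: "CARD('n) - r = r" using r by simp
  show "is_dform r r (hodge G \<omega>)" using is_dform_hodge[OF d, of G] r by simp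
  show "hodge G \<omega> (basis_list e I) (basis_list e J) = \<omega> (basis_list e I) (basis_list e J)"
    if "I \<subseteq> {..<CARD('n)}" "J \<subseteq> {..<CARD('n)}" for I J
    using diagonal_hodge[OF euclidean_frame_axioms d dg] dg that inv by (simp add: diagonal_def)
qed (rule d)

text \<open>In dimension 6 as well as above, the middle-degree double form has a constant multiple
  of \<open>pair_sum l K\<close> as its coefficient at a set \<open>K\<close> of size
  \<open>r\<close>. By \<open>pair_sum_complement\<close> this is invariant under complements, so
  the Hodge star fixes the double form.\<close>

lemma star_const_imp_thorpe4:
  assumes "even CARD('n)" "CARD('n) \<ge> 6"
    and const: "\<And>i j. i < CARD('n) \<Longrightarrow> j < CARD('n) \<Longrightarrow> star_sum (square_coeff l) {..<CARD('n)} {i} = star_sum (square_coeff l) {..<CARD('n)} {j}"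
  shows "thorpe4_at G R"
proof -
  let ?N = "{..<CARD('n)}" and ?g = "metric_dform G"
  define r where "r = CARD('n) div 2"
  have r: "CARD('n) = 2 * r" "3 \<le> r" using assms(1,2) by (auto simp: r_def elim!: evenE)
  have card_compl: "card (?N - K) = r \<longleftrightarrow> card K = r" if "K \<subseteq> ?N" for K
    using fin_subset[OF that] card_mono[of ?N K] that r by (auto simp: card_Diff_subset)
  have pair: "pair_sum l (?N - K) = pair_sum l K" if "K \<subseteq> ?N" "card K = r" for K
  proof (rule pair_sum_complement[OF _ _ _ _ that])
    show "star_sum (square_coeff l) ?N {i} = star_sum (square_coeff l) ?N {j}" if "i \<in> ?N" "j \<in> ?N" for i j
      using that by (intro const) auto
  qed (use r assms(2) in auto)
  show ?thesis
  proof (cases "CARD('n) = 6")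
    case True
    then have r3: "r = 3" using r by simp
    let ?h = "bilinear_dform h"
    let ?b = "\<lambda>K. of_bool (card K = 2) * (2 * prod l K)"
    \<comment> \<open>As the curvature is the metric times \<open>h\<close>, its square should be
      the squared metric times \<open>h h\<close>; this is then verified on coefficients.\<close>
    define B where "B = dprod ?h ?h"
    have B: "is_dform 2 2 B"
      using is_dform_dprod[OF is_dform_bilinear[OF bilinear] is_dform_bilinear[OF bilinear]]
      by (simp add: B_def numeral_2_eq_2)
    have Bs: "symmetric_dform B"
      unfolding B_def by (intro symmetric_dprod symmetric_bilinear_dform symmetric)
    have Bd: "diagonal e B ?b" unfolding B_def
      by (rule diagonal_cong[OF diagonal_dprod[OF diagonal_h diagonal_h]])
        (simp only: schouten_square_coeffs fin_subset)
    have sum_b: "(\<Sum>J\<in>Pow K. ?b J) = 2 * pair_sum l K" for K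
      by (simp add: pair_sum_def sum_distrib_left mult_ac)
    have "dpower R 2 = dprod (dpower ?g 2) B"
    proof (rule dform_eqI[OF is_dform_square])
      show "is_dform 4 4 (dprod (dpower ?g 2) B)"
        using is_dform_dprod[OF is_dform_dpower[OF is_dform_metric] B, of 2 G] by simp
      have "diagonal e (dprod (dpower ?g 2) B) (square_coeff l)"
      proof (rule diagonal_cong[OF diagonal_dprod[OF diagonal_metric_power[OF euclidean_frame_axioms] Bd]])
        fix K assume "K \<subseteq> ?N"
        then show "subset_convolution (\<lambda>K. of_bool (card K = 2) * fact 2) ?b K = square_coeff l K"
          by (subst subset_convolution_metric_power[where m = 2])
            (auto simp only: fin_subset sum_b, auto simp: square_coeff_def)
      qed
      then show "dpower R 2 (basis_list e I) (basis_list e J) = dprod (dpower ?g 2) B (basis_list e I) (basis_list e J)"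
        if "I \<subseteq> ?N" "J \<subseteq> ?N" for I J
        using diagonal_square that by (simp add: diagonal_def)
    qed
    moreover have "hodge G (dprod ?g B) = dprod ?g B"
    proof (rule hodge_fixed)
      show "is_dform r r (dprod ?g B)" using is_dform_dprod[OF is_dform_metric B, of G] by (simp add: r3 numeral_3_eq_3)
      have "diagonal e ?g (\<lambda>K. of_bool (card K = 1) * fact 1)" using diagonal_metric by simp
      then show "diagonal e (dprod ?g B) (\<lambda>K. of_bool (card K = r) * (2 * pair_sum l K))"
      proof (rule diagonal_cong[OF diagonal_dprod[OF _ Bd]])
        fix K assume "K \<subseteq> ?N"
        then show "subset_convolution (\<lambda>K. of_bool (card K = 1) * fact 1) ?b K = of_bool (card K = r) * (2 * pair_sum l K)"
          by (subst subset_convolution_metric_power[where m = 2])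
            (auto simp only: fin_subset sum_b, auto simp: r3)
      qed
      show "of_bool (card (?N - K) = r) * (2 * pair_sum l (?N - K)) = of_bool (card K = r) * (2 * pair_sum l K)"
        if "K \<subseteq> ?N" for K using card_compl[OF that] pair[OF that] by auto
    qed (rule r)
    ultimately show ?thesis unfolding thorpe4_at_def using True B Bs by auto
  next
    case False
    then have r4: "4 \<le> r" using r by auto
    let ?w = "dprod (dpower ?g (r - 4)) (dpower R 2)"
    have "hodge G ?w = ?w"
    proof (rule hodge_fixed)
      show "is_dform r r ?w"
        using is_dform_dprod[OF is_dform_dpower[OF is_dform_metric] is_dform_square, of "r - 4" G] r4 by simp
      show "diagonal e ?w (\<lambda>K. of_bool (card K = r) * fact (r - 4) * (4 * supersets r 2 4 * pair_sum l K))"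
      proof (rule diagonal_cong[OF diagonal_dprod[OF diagonal_metric_power[OF euclidean_frame_axioms] diagonal_square]])
        fix K assume "K \<subseteq> ?N"
        then show "subset_convolution (\<lambda>K. of_bool (card K = r - 4) * fact (r - 4)) (square_coeff l) K =
            of_bool (card K = r) * fact (r - 4) * (4 * supersets r 2 4 * pair_sum l K)"
          by (subst subset_convolution_metric_power[where m = 4])
            (use r4 fin_subset sum_square_coeff[of K l] in \<open>auto simp: square_coeff_def[abs_def]\<close>)
      qed
      show "of_bool (card (?N - K) = r) * fact (r - 4) * (4 * supersets r 2 4 * pair_sum l (?N - K)) =
          of_bool (card K = r) * fact (r - 4) * (4 * supersets r 2 4 * pair_sum l K)"
        if "K \<subseteq> ?N" for K using card_compl[OF that] pair[OF that] by auto
    qed (rule r)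
    then show ?thesis unfolding thorpe4_at_def using False by (simp add: r_def Let_def)
  qed
qed

end

section \<open>Symmetry of second derivatives\<close>

lemma has_derivative_line:
  fixes f :: "'a::real_normed_vector \<Rightarrow> real"
  assumes "(f has_derivative f') (at (y + s *\<^sub>R v))"
  shows "((\<lambda>s. f (y + s *\<^sub>R v)) has_real_derivative f' v) (at s)"
proof -
  interpret linear f' using assms by (rule has_derivative_linear)
  have "((\<lambda>s. y + s *\<^sub>R v) has_derivative (\<lambda>t. t *\<^sub>R v)) (at s)"
    by (auto intro!: derivative_eq_intros)
  from has_derivative_compose[OF this assms]
  show ?thesis by (simp add: has_field_derivative_def scale mult_commute_abs)
qed

text \<open>The mean value theorem, applied in direction \<open>v\<close> to the difference of two
  translates and then in direction \<open>w\<close> to the derivative, turns the second difference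
  over a parallelogram into a mixed derivative at a point inside it.\<close>

lemma second_difference:
  fixes f :: "'a::real_normed_vector \<Rightarrow> real"
  assumes h: "0 < h"
    and S: "\<And>s t. 0 \<le> s \<Longrightarrow> s \<le> h \<Longrightarrow> 0 \<le> t \<Longrightarrow> t \<le> h \<Longrightarrow> x + s *\<^sub>R v + t *\<^sub>R w \<in> S"
    and f: "\<And>y. y \<in> S \<Longrightarrow> (f has_derivative f' y) (at y)"
    and fv: "\<And>y. y \<in> S \<Longrightarrow> ((\<lambda>z. f' z v) has_derivative f'' y) (at y)"
  shows "\<exists>s t. 0 \<le> s \<and> s \<le> h \<and> 0 \<le> t \<and> t \<le> h \<and>
    f (x + h *\<^sub>R v + h *\<^sub>R w) - f (x + h *\<^sub>R v) - f (x + h *\<^sub>R w) + f x = h * h * f'' (x + s *\<^sub>R v + t *\<^sub>R w) w"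
proof -
  define u where "u s = f (x + h *\<^sub>R w + s *\<^sub>R v) - f (x + s *\<^sub>R v)" for s
  have du: "(u has_real_derivative f' (x + h *\<^sub>R w + s *\<^sub>R v) v - f' (x + s *\<^sub>R v) v) (at s)"
    if "0 \<le> s" "s \<le> h" for s
    unfolding u_def using S[OF that, of h] S[OF that, of 0] h
    by (intro DERIV_diff has_derivative_line f) (auto simp: algebra_simps)
  obtain s where s: "0 < s" "s < h" "u h - u 0 = (h - 0) * (f' (x + h *\<^sub>R w + s *\<^sub>R v) v - f' (x + s *\<^sub>R v) v)"
    using MVT2[OF h, of u "\<lambda>s. f' (x + h *\<^sub>R w + s *\<^sub>R v) v - f' (x + s *\<^sub>R v) v"] du by auto
  have dw: "((\<lambda>t. f' (x + s *\<^sub>R v + t *\<^sub>R w) v) has_real_derivative f'' (x + s *\<^sub>R v + t *\<^sub>R w) w) (at t)"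
    if "0 \<le> t" "t \<le> h" for t
    using S[of s t] s that by (intro has_derivative_line fv) auto
  obtain t where t: "0 < t" "t < h"
    "f' (x + s *\<^sub>R v + h *\<^sub>R w) v - f' (x + s *\<^sub>R v + 0 *\<^sub>R w) v = (h - 0) * f'' (x + s *\<^sub>R v + t *\<^sub>R w) w"
    using MVT2[OF h, of "\<lambda>t. f' (x + s *\<^sub>R v + t *\<^sub>R w) v" "\<lambda>t. f'' (x + s *\<^sub>R v + t *\<^sub>R w) w"] dw
    by blast
  have swap: "x + h *\<^sub>R w + s *\<^sub>R v = x + s *\<^sub>R v + h *\<^sub>R w" by simp
  have "f' (x + s *\<^sub>R v + h *\<^sub>R w) v - f' (x + s *\<^sub>R v) v = h * f'' (x + s *\<^sub>R v + t *\<^sub>R w) w"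
    using t(3) unfolding scaleR_zero_left add_0_right diff_zero .
  then have "u h - u 0 = h * (h * f'' (x + s *\<^sub>R v + t *\<^sub>R w) w)"
    using s(3) unfolding swap by (simp only: diff_zero)
  moreover have "u h - u 0 = f (x + h *\<^sub>R v + h *\<^sub>R w) - f (x + h *\<^sub>R v) - f (x + h *\<^sub>R w) + f x"
    by (simp add: u_def algebra_simps)
  ultimately show ?thesis using s t by (intro exI[of _ s] exI[of _ t]) (simp add: mult.assoc)
qed

text \<open>The second difference is symmetric in \<open>v\<close> and \<open>w\<close>, so the two
  mixed derivatives take a common value at two points of a small parallelogram; continuity then
  forbids a gap at \<open>x\<close>.\<close>

lemma symmetric_second_derivative_real:
  fixes f :: "'a::real_normed_vector \<Rightarrow> real"
  assumes S: "open S" "x \<in> S"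
    and f: "\<And>y. y \<in> S \<Longrightarrow> (f has_derivative f' y) (at y)"
    and fv: "\<And>y. y \<in> S \<Longrightarrow> ((\<lambda>z. f' z v) has_derivative fv y) (at y)"
    and fw: "\<And>y. y \<in> S \<Longrightarrow> ((\<lambda>z. f' z w) has_derivative fw y) (at y)"
    and cont: "continuous_on S (\<lambda>y. fv y w)" "continuous_on S (\<lambda>y. fw y v)"
  shows "fv x w = fw x v"
proof (rule ccontr)
  assume ne: "fv x w \<noteq> fw x v"
  \<comment> \<open>Half the gap: two errors below \<open>\<epsilon>\<close> cannot bridge
    it.\<close>
  define \<epsilon> where "\<epsilon> = \<bar>fv x w - fw x v\<bar> / 2"
  have \<epsilon>: "\<epsilon> > 0" using ne by (simp add: \<epsilon>_def)
  have "isCont (\<lambda>y. fv y w) x" "isCont (\<lambda>y. fw y v) x"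
    using cont S by (auto simp: continuous_on_eq_continuous_at)
  then obtain d1 d2 where d: "d1 > 0" "\<And>y. dist y x < d1 \<Longrightarrow> dist (fv y w) (fv x w) < \<epsilon>"
      "d2 > 0" "\<And>y. dist y x < d2 \<Longrightarrow> dist (fw y v) (fw x v) < \<epsilon>"
    unfolding continuous_at_eps_delta using \<epsilon> by metis
  obtain d3 where d3: "d3 > 0" "\<And>y. dist y x < d3 \<Longrightarrow> y \<in> S"
    using S by (auto simp: open_dist)
  define \<delta> where "\<delta> = min d1 (min d2 d3)"
  have \<delta>: "\<delta> > 0" using d d3 by (simp add: \<delta>_def)
  \<comment> \<open>Small enough for the parallelogram to stay within distance
    \<open>\<delta>\<close> of \<open>x\<close>; the summand \<open>1\<close> keeps the denominator
    positive if both directions vanish.\<close>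
  define h where "h = \<delta> / (norm v + norm w + 1)"
  have pos: "norm v + norm w + 1 > 0" by (meson add_nonneg_pos add_nonneg_nonneg norm_ge_zero zero_less_one)
  have h: "h > 0" using \<delta> pos by (simp add: h_def)
  have near: "dist (x + s *\<^sub>R v + t *\<^sub>R w) x < \<delta>" if "0 \<le> s" "s \<le> h" "0 \<le> t" "t \<le> h" for s t
  proof -
    have "dist (x + s *\<^sub>R v + t *\<^sub>R w) x = norm (s *\<^sub>R v + t *\<^sub>R w)" by (simp add: dist_norm add.assoc)
    also have "\<dots> \<le> s * norm v + t * norm w"
      using norm_triangle_ineq[of "s *\<^sub>R v" "t *\<^sub>R w"] that by simp
    also have "\<dots> \<le> h * norm v + h * norm w" using that by (intro add_mono mult_right_mono) auto
    also have "\<dots> < h * (norm v + norm w + 1)" using h by (simp add: distrib_left)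
    also have "\<dots> = \<delta>" using pos by (simp add: h_def)
    finally show ?thesis .
  qed
  have S1: "x + s *\<^sub>R v + t *\<^sub>R w \<in> S" if "0 \<le> s" "s \<le> h" "0 \<le> t" "t \<le> h" for s t
    using near[OF that] d3(2) by (simp add: \<delta>_def)
  have S2: "x + s *\<^sub>R w + t *\<^sub>R v \<in> S" if "0 \<le> s" "s \<le> h" "0 \<le> t" "t \<le> h" for s t
    using S1[OF that(3,4,1,2)] by (simp add: algebra_simps)
  obtain s t where 1: "0 \<le> s" "s \<le> h" "0 \<le> t" "t \<le> h"
    "f (x + h *\<^sub>R v + h *\<^sub>R w) - f (x + h *\<^sub>R v) - f (x + h *\<^sub>R w) + f x = h * h * fv (x + s *\<^sub>R v + t *\<^sub>R w) w"
    using second_difference[OF h S1 f fv] by blast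
  obtain s' t' where 2: "0 \<le> s'" "s' \<le> h" "0 \<le> t'" "t' \<le> h"
    "f (x + h *\<^sub>R w + h *\<^sub>R v) - f (x + h *\<^sub>R w) - f (x + h *\<^sub>R v) + f x = h * h * fw (x + s' *\<^sub>R w + t' *\<^sub>R v) v"
    using second_difference[OF h S2 f fw] by blast
  have swap: "x + h *\<^sub>R w + h *\<^sub>R v = x + h *\<^sub>R v + h *\<^sub>R w" by simp
  have "h * h * fv (x + s *\<^sub>R v + t *\<^sub>R w) w = h * h * fw (x + s' *\<^sub>R w + t' *\<^sub>R v) v"
    using 1(5) 2(5) unfolding swap by linarith
  then have eq: "fv (x + s *\<^sub>R v + t *\<^sub>R w) w = fw (x + s' *\<^sub>R w + t' *\<^sub>R v) v" using h by simp
  have "dist (fv (x + s *\<^sub>R v + t *\<^sub>R w) w) (fv x w) < \<epsilon>"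
    using near[OF 1(1-4)] d(2) by (simp add: \<delta>_def)
  moreover have "dist (x + s' *\<^sub>R w + t' *\<^sub>R v) x < \<delta>" using near[OF 2(3,4,1,2)] by (simp add: algebra_simps)
  then have "dist (fw (x + s' *\<^sub>R w + t' *\<^sub>R v) v) (fw x v) < \<epsilon>" using d(4) by (simp add: \<delta>_def)
  moreover have "dist (fv x w) (fw x v) \<le> dist (fv (x + s *\<^sub>R v + t *\<^sub>R w) w) (fv x w) +
      dist (fw (x + s' *\<^sub>R w + t' *\<^sub>R v) v) (fw x v)"
    unfolding eq using dist_triangle3 .
  moreover have "dist (fv x w) (fw x v) = \<epsilon> + \<epsilon>" by (simp add: \<epsilon>_def dist_real_def)
  ultimately show False by linarith
qed

lemma symmetric_second_derivative:
  fixes f :: "real^'n::finite \<Rightarrow> 'b::euclidean_space"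
  assumes S: "open S" "x \<in> S" and f: "Ck_on 2 S f"
  shows "frechet_derivative (\<lambda>y. frechet_derivative f (at y) v) (at x) w =
    frechet_derivative (\<lambda>y. frechet_derivative f (at y) w) (at x) v"
proof (rule euclidean_eqI)
  fix b :: 'b
  let ?D = "\<lambda>u y. frechet_derivative f (at y) u"
  have f1: "(f has_derivative frechet_derivative f (at y)) (at y)" if "y \<in> S" for y
    using f that by (simp add: numeral_2_eq_2 frechet_derivative_works)
  have f2: "(?D u has_derivative frechet_derivative (?D u) (at y)) (at y)" if "y \<in> S" for y u
    using f that by (simp add: numeral_2_eq_2 frechet_derivative_works)
  have f3: "continuous_on S (\<lambda>y. frechet_derivative (?D u) (at y) u')" for u u'
    using f by (simp add: numeral_2_eq_2)
  show "frechet_derivative (?D v) (at x) w \<bullet> b = frechet_derivative (?D w) (at x) v \<bullet> b"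
    by (rule symmetric_second_derivative_real[OF S, of "\<lambda>y. f y \<bullet> b" "\<lambda>y u. ?D u y \<bullet> b" v
          "\<lambda>y u. frechet_derivative (?D v) (at y) u \<bullet> b" w "\<lambda>y u. frechet_derivative (?D w) (at y) u \<bullet> b"])
      (auto intro!: has_derivative_inner_left f1 f2 continuous_intros f3)
qed

section \<open>Diagonalization of symmetric bilinear forms\<close>

text \<open>The spectral theorem by the Rayleigh quotient: a maximum \<open>m\<close> of the
  quadratic form on the unit sphere of \<open>W\<close> is \<open>s\<close>-orthogonal to every
  vector of \<open>W\<close> perpendicular to it, and the induction continues in the subspace of
  these vectors. This is why \<open>W\<close> is a general subspace.\<close>

lemma symmetric_form_eigenbasis_subspace:
  fixes s :: "'a::euclidean_space \<Rightarrow> 'a \<Rightarrow> real"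
  assumes s: "bilinear s" and sym: "\<And>x y. s x y = s y x"
  shows "subspace W \<Longrightarrow> dim W = k \<Longrightarrow> \<exists>e. (\<forall>i<k. e i \<in> W) \<and>
    (\<forall>i<k. \<forall>j<k. e i \<bullet> e j = of_bool (i = j)) \<and> (\<forall>i<k. \<forall>j<k. i \<noteq> j \<longrightarrow> s (e i) (e j) = 0)"
proof (induction k arbitrary: W)
  case 0
  then show ?case by simp
next
  case (Suc k)
  note add = bilinear_ladd[OF s] bilinear_radd[OF s] bilinear_lmul[OF s] bilinear_rmul[OF s]
  let ?K = "W \<inter> sphere 0 1"
  obtain w where w: "w \<in> W" "w \<noteq> 0"
    using Suc.prems dim_eq_0[of W] by force
  then have "w /\<^sub>R norm w \<in> ?K" using Suc.prems by (simp add: subspace_scale)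
  then have "?K \<noteq> {}" by blast
  moreover have "compact ?K"
    using closed_subspace[OF Suc.prems(1)] by (intro closed_Int_compact) auto
  moreover have "continuous_on ?K (\<lambda>x. s x x)"
    using bilinear_continuous_on_compose[OF continuous_on_id continuous_on_id s] .
  ultimately obtain m where m: "m \<in> ?K" "\<And>x. x \<in> ?K \<Longrightarrow> s x x \<le> s m m"
    using continuous_attains_sup[of ?K "\<lambda>x. s x x"] by blast
  then have mW: "m \<in> W" and mm: "m \<bullet> m = 1" by (auto simp: norm_eq_1)
  have max: "s x x \<le> s m m * (x \<bullet> x)" if "x \<in> W" for x
  proof (cases "x = 0")
    case True
    then show ?thesis by (simp add: bilinear_lzero[OF s])
  next
    case False
    then have "s (x /\<^sub>R norm x) (x /\<^sub>R norm x) \<le> s m m"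
      using that Suc.prems by (intro m(2)) (simp add: subspace_scale)
    then have "s x x / (norm x)\<^sup>2 \<le> s m m" by (simp add: add power2_eq_square divide_simps)
    then show ?thesis using False by (simp add: divide_le_eq power2_norm_eq_inner)
  qed
  text \<open>First variation: at a maximum of the quadratic form on the sphere the derivative in every
    tangential direction vanishes.\<close>
  have orth: "s m x = 0" if x: "x \<in> W" "m \<bullet> x = 0" for x
  proof -
    have q: "2 * t * s m x + t\<^sup>2 * (s x x - s m m * (x \<bullet> x)) \<le> 0" for t
    proof -
      have "m + t *\<^sub>R x \<in> W" using mW x Suc.prems by (simp add: subspace_add subspace_scale)
      from max[OF this] show ?thesis
        using x(2) mm sym[of x m] by (simp add: add inner_add inner_commute power2_eq_square algebra_simps)
    qed
    show ?thesis
    proof (rule ccontr)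
      assume ne: "s m x \<noteq> 0"
      \<comment> \<open>\<open>c\<close> is positive and exceeds the absolute value of the quadratic
        coefficient. At the parameter \<open>s m x / c\<close> the left side of \<open>q\<close> is
        therefore at least \<open>(s m x)^2 / c\<close>, which is positive.\<close>
      define c where "c = \<bar>s x x - s m m * (x \<bullet> x)\<bar> + 1"
      have c: "c > 0" "- c \<le> s x x - s m m * (x \<bullet> x)" by (auto simp: c_def)
      have "2 * (s m x / c) * s m x + (s m x / c)\<^sup>2 * (- c) \<le>
          2 * (s m x / c) * s m x + (s m x / c)\<^sup>2 * (s x x - s m m * (x \<bullet> x))"
        using c by (intro add_left_mono mult_left_mono) auto
      also have "\<dots> \<le> 0" by (rule q)
      finally have "(s m x)\<^sup>2 / c \<le> 0" using c by (simp add: power2_eq_square field_simps)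
      then show False using ne c by (simp add: divide_le_0_iff)
    qed
  qed
  let ?W = "{x \<in> W. m \<bullet> x = 0}"
  have sub: "subspace ?W" using Suc.prems(1) by (auto simp: subspace_def inner_add_right)
  have "dim ?W = k"
  proof -
    have "W = {x + y | x y. x \<in> span {m} \<and> y \<in> ?W}"
    proof (intro equalityI subsetI)
      fix x assume x: "x \<in> W"
      have "x - (m \<bullet> x) *\<^sub>R m \<in> ?W" "(m \<bullet> x) *\<^sub>R m \<in> span {m}"
        using x mW mm Suc.prems(1) by (auto simp: subspace_diff subspace_scale inner_diff_right span_base span_scale)
      then show "x \<in> {x + y | x y. x \<in> span {m} \<and> y \<in> ?W}"
        by (intro CollectI exI[of _ "(m \<bullet> x) *\<^sub>R m"] exI[of _ "x - (m \<bullet> x) *\<^sub>R m"]) simp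
    next
      fix x assume "x \<in> {x + y | x y. x \<in> span {m} \<and> y \<in> ?W}"
      then show "x \<in> W" using mW Suc.prems(1) by (auto simp: span_singleton subspace_add subspace_scale)
    qed
    moreover have "span {m} \<inter> ?W = {0}" using mm Suc.prems(1) by (auto simp: span_singleton subspace_0 sub[unfolded subspace_def])
    ultimately have "dim W = dim (span {m}) + dim ?W"
      using dim_sums_Int[OF subspace_span[of "{m}"] sub] by (simp add: dim_eq_0)
    moreover have "dim (span {m}) = 1" using mm by (auto simp: dim_singleton)
    ultimately show ?thesis using Suc.prems(2) by simp
  qed
  from Suc.IH[OF sub this] obtain e where "(\<forall>i<k. e i \<in> ?W) \<and>
    (\<forall>i<k. \<forall>j<k. e i \<bullet> e j = of_bool (i = j)) \<and> (\<forall>i<k. \<forall>j<k. i \<noteq> j \<longrightarrow> s (e i) (e j) = 0)" ..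
  then have e: "\<forall>i<k. e i \<in> ?W" "\<forall>i<k. \<forall>j<k. e i \<bullet> e j = of_bool (i = j)"
    "\<forall>i<k. \<forall>j<k. i \<noteq> j \<longrightarrow> s (e i) (e j) = 0" by auto
  let ?e = "e(k := m)"
  have "\<forall>i<Suc k. ?e i \<in> W" using e(1) mW by (auto simp: less_Suc_eq)
  moreover have "\<forall>i<Suc k. \<forall>j<Suc k. ?e i \<bullet> ?e j = of_bool (i = j)"
    using e(1,2) mm by (auto simp: less_Suc_eq inner_commute)
  moreover have "\<forall>i<Suc k. \<forall>j<Suc k. i \<noteq> j \<longrightarrow> s (?e i) (?e j) = 0"
  proof (intro allI impI)
    fix i j assume *: "i < Suc k" "j < Suc k" "i \<noteq> j"
    have o: "s m (e q) = 0" "s (e q) m = 0" if "q < k" for q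
      using e(1) that orth[of "e q"] sym[of "e q" m] by auto
    show "s (?e i) (?e j) = 0" using * o e(3) by (cases "i = k"; cases "j = k") auto
  qed
  ultimately show ?case by blast
qed

lemma symmetric_form_eigenbasis:
  fixes s :: "real^'n::finite \<Rightarrow> real^'n \<Rightarrow> real"
  assumes "bilinear s" "\<And>x y. s x y = s y x"
  obtains e l where "\<And>i j. i < CARD('n) \<Longrightarrow> j < CARD('n) \<Longrightarrow> e i \<bullet> e j = of_bool (i = j)"
    "\<And>i j. i < CARD('n) \<Longrightarrow> j < CARD('n) \<Longrightarrow> s (e i) (e j) = of_bool (i = j) * l i"
proof -
  obtain e where e: "\<forall>i<CARD('n). \<forall>j<CARD('n). e i \<bullet> e j = of_bool (i = j)"
    "\<forall>i<CARD('n). \<forall>j<CARD('n). i \<noteq> j \<longrightarrow> s (e i) (e j) = 0"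
    using symmetric_form_eigenbasis_subspace[OF assms subspace_UNIV, of "CARD('n)"] by (auto simp: dim_UNIV)
  show ?thesis by (rule that[of e "\<lambda>i. s (e i) (e i)"]) (use e in auto)
qed

section \<open>The curvature of a conformally flat metric\<close>

lemma smooth_on_differentiable: "smooth_on S f \<Longrightarrow> x \<in> S \<Longrightarrow> f differentiable (at x)"
  unfolding smooth_on_def using Ck_on.simps(2)[of 0 S f] by blast

lemma smooth_on_has_derivative:
  "smooth_on S f \<Longrightarrow> x \<in> S \<Longrightarrow> (f has_derivative frechet_derivative f (at x)) (at x)"
  using smooth_on_differentiable frechet_derivative_works by blast

lemma smooth_on_frechet_derivative: "smooth_on S f \<Longrightarrow> smooth_on S (\<lambda>x. frechet_derivative f (at x) v)"
  unfolding smooth_on_def using Ck_on.simps(2)[of _ S f] by blast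

lemma smooth_on_Ck: "smooth_on S f \<Longrightarrow> Ck_on k S f"
  by (simp add: smooth_on_def)

lemma vector_sum_axis: "v = (\<Sum>i\<in>UNIV. v $ i *\<^sub>R axis i (1::real))"
  using basis_expansion[of v] by (simp add: scalar_mult_eq_scaleR)

lemma linear_combination: "linear F \<Longrightarrow> (\<Sum>i\<in>S. c i *\<^sub>R F (v i)) = F (\<Sum>i\<in>S. c i *\<^sub>R v i)"
  by (simp add: linear_sum linear_cmul)

lemma linear_sum_axis: "linear J \<Longrightarrow> J v = (\<Sum>i\<in>UNIV. v $ i *\<^sub>R J (axis i 1))"
  by (subst vector_sum_axis) (simp add: linear_sum linear_cmul)

text \<open>The curvature of \<open>exp (2 f)\<close> times the flat metric, as a trilinear map; \<open>p\<close> and \<open>H\<close> are gradient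
  and Hessian of \<open>f\<close>.\<close>

definition schouten_op :: "'v::real_inner \<Rightarrow> ('v \<Rightarrow> 'v) \<Rightarrow> 'v \<Rightarrow> 'v" where
  "schouten_op p H a = H a - (p \<bullet> a) *\<^sub>R p + (p \<bullet> p / 2) *\<^sub>R a"

definition flat_curvature :: "'v::real_inner \<Rightarrow> ('v \<Rightarrow> 'v) \<Rightarrow> 'v \<Rightarrow> 'v \<Rightarrow> 'v \<Rightarrow> 'v" where
  "flat_curvature p H a b c = (schouten_op p H a \<bullet> c) *\<^sub>R b - (schouten_op p H b \<bullet> c) *\<^sub>R a
     - (b \<bullet> c) *\<^sub>R schouten_op p H a + (a \<bullet> c) *\<^sub>R schouten_op p H b"

text \<open>Here \<open>a, b, c\<close> are the coordinate fields with indices \<open>i, j, k\<close>, and \<open>ab, ac, bc, abc\<close> are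
  their derivatives.\<close>

lemma flat_curvature_eq:
  fixes a b c p ab ac bc abc :: "'v::real_inner" and H :: "'v \<Rightarrow> 'v"
  assumes H: "H a \<bullet> b = H b \<bullet> a"
  defines "V \<equiv> \<lambda>b c bc. (p \<bullet> b) *\<^sub>R c + (p \<bullet> c) *\<^sub>R b - (b \<bullet> c) *\<^sub>R p + bc"
  defines "dV \<equiv> \<lambda>a b c ab ac. (H a \<bullet> b + p \<bullet> ab) *\<^sub>R c + (p \<bullet> b) *\<^sub>R ac + (H a \<bullet> c + p \<bullet> ac) *\<^sub>R b
     + (p \<bullet> c) *\<^sub>R ab - (ab \<bullet> c + b \<bullet> ac) *\<^sub>R p - (b \<bullet> c) *\<^sub>R H a + abc"
  defines "Q \<equiv> \<lambda>a b c ab ac bc. dV a b c ab ac + (p \<bullet> a) *\<^sub>R V b c bc + (p \<bullet> V b c bc) *\<^sub>R a - (a \<bullet> V b c bc) *\<^sub>R p"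
  shows "Q a b c ab ac bc - Q b a c ab bc ac = flat_curvature p H a b c"
\<comment> \<open>Testing against an arbitrary \<open>z\<close> leaves a polynomial identity in
  inner products. The third derivative \<open>abc\<close> is common to both orders and cancels; so
  do the Hessian terms between \<open>a\<close> and \<open>b\<close>, by the symmetry
  \<open>H\<close>.\<close>
proof (rule vector_eq_rdot[THEN iffD1], rule allI)
  fix z
  show "(Q a b c ab ac bc - Q b a c ab bc ac) \<bullet> z = flat_curvature p H a b c \<bullet> z"
    unfolding Q_def dV_def V_def flat_curvature_def schouten_op_def
    by (simp add: inner_add_left inner_add_right inner_diff_left inner_diff_right H
        inner_commute[of a p] inner_commute[of b p] inner_commute[of b a])
      (simp add: algebra_simps)
qed

lemma linear_flat_curvature:
  assumes "linear H"
  shows "linear (\<lambda>a. flat_curvature p H a b c)" "linear (\<lambda>b. flat_curvature p H a b c)"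
    "linear (\<lambda>c. flat_curvature p H a b c)"
  unfolding flat_curvature_def schouten_op_def linear_iff
  by (simp_all add: linear_add[OF assms] linear_cmul[OF assms] inner_add_left inner_add_right
      inner_diff_left inner_diff_right algebra_simps add_divide_distrib)

text \<open>\<open>U\<close> lies in the coordinates of the given chart, \<open>V\<close> in those
  of the conformally flat one, and \<open>\<phi>\<close> is the transition between them. The metric
  \<open>G\<close> is known as a matrix only over \<open>U\<close>.\<close>

locale conformal_chart =
  fixes U :: "(real^'n::finite) set" and \<phi> :: "real^'n \<Rightarrow> real^'n"
    and V :: "(real^'n) set" and f :: "real^'n \<Rightarrow> real" and G :: "real^'n \<Rightarrow> real^'n^'n"
  assumes open_U: "open U" and open_V: "open V" and maps: "x \<in> U \<Longrightarrow> \<phi> x \<in> V"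
    and smooth_\<phi>: "smooth_on U \<phi>" and smooth_f: "smooth_on V f"
    and metric: "x \<in> U \<Longrightarrow> inner_product_matrix (G x)"
    and conformal: "x \<in> U \<Longrightarrow> ginner (G x) u v =
      exp (2 * f (\<phi> x)) * (frechet_derivative \<phi> (at x) u \<bullet> frechet_derivative \<phi> (at x) v)"

definition gradient :: "(real^'n::finite \<Rightarrow> real) \<Rightarrow> real^'n \<Rightarrow> real^'n" where
  "gradient f y = (\<chi> a. frechet_derivative f (at y) (axis a 1))"

definition hessian :: "(real^'n::finite \<Rightarrow> real) \<Rightarrow> real^'n \<Rightarrow> real^'n \<Rightarrow> real^'n" where
  "hessian f y u = (\<chi> a. frechet_derivative (\<lambda>z. frechet_derivative f (at z) (axis a 1)) (at y) u)"

lemma gradient_inner: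
  assumes "f differentiable (at y)"
  shows "frechet_derivative f (at y) u = gradient f y \<bullet> u"
proof -
  have "linear (frechet_derivative f (at y))" using assms by (rule linear_frechet_derivative)
  from linear_sum_axis[OF this, of u] show ?thesis
    by (simp add: gradient_def inner_vec_def mult.commute)
qed

lemma has_derivative_gradient:
  assumes "smooth_on S f" "y \<in> S"
  shows "(gradient f has_derivative hessian f y) (at y)"
proof -
  have "((\<lambda>z. \<chi> a. frechet_derivative f (at z) (axis a 1)) has_derivative hessian f y) (at y)"
  proof (subst has_derivative_componentwise_within, rule ballI)
    fix b :: "real^'a" assume "b \<in> Basis"
    then obtain a where "b = axis a 1" by (auto simp: Basis_vec_def)
    then show "((\<lambda>z. (\<chi> a. frechet_derivative f (at z) (axis a 1)) \<bullet> b) has_derivative (\<lambda>u. hessian f y u \<bullet> b)) (at y)"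
      using smooth_on_has_derivative[OF smooth_on_frechet_derivative[OF assms(1)] assms(2), of "axis a 1"]
      by (simp add: hessian_def inner_axis)
  qed
  then show ?thesis by (simp add: gradient_def[abs_def])
qed

lemma linear_hessian: "smooth_on S f \<Longrightarrow> y \<in> S \<Longrightarrow> linear (hessian f y)"
  using has_derivative_gradient has_derivative_linear by blast

lemma hessian_symmetric:
  assumes "open S" "smooth_on S f" "y \<in> S"
  shows "hessian f y u \<bullet> w = hessian f y w \<bullet> u"
proof -
  have "frechet_derivative (\<lambda>z. frechet_derivative f (at z) w) (at y) u = hessian f y u \<bullet> w" for u w
  proof -
    have "((\<lambda>z. gradient f z \<bullet> w) has_derivative (\<lambda>u. hessian f y u \<bullet> w)) (at y)"
      by (rule has_derivative_inner_left[OF has_derivative_gradient[OF assms(2,3)]])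
    then have "((\<lambda>z. frechet_derivative f (at z) w) has_derivative (\<lambda>u. hessian f y u \<bullet> w)) (at y)"
      by (rule has_derivative_transform_within_open[OF _ assms(1,3)])
        (simp add: gradient_inner[OF smooth_on_differentiable[OF assms(2)]])
    then show ?thesis using frechet_derivative_at by metis
  qed
  then show ?thesis using symmetric_second_derivative[OF assms(1,3) smooth_on_Ck[OF assms(2)]] by metis
qed

section \<open>Connection and curvature in the given chart\<close>

context conformal_chart
begin

text \<open>The coordinate fields pushed forward by \<open>\<phi>\<close>; \<open>E2\<close> and
  \<open>E3\<close> are their derivatives in coordinate directions. As functions into Euclidean
  space they can be differentiated componentwise and paired with the constant inner product.\<close>

definition E :: "'n \<Rightarrow> real^'n \<Rightarrow> real^'n" where
  "E i x = frechet_derivative \<phi> (at x) (axis i 1)"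

definition E2 :: "'n \<Rightarrow> 'n \<Rightarrow> real^'n \<Rightarrow> real^'n" where
  "E2 i j x = frechet_derivative (E j) (at x) (axis i 1)"

definition E3 :: "'n \<Rightarrow> 'n \<Rightarrow> 'n \<Rightarrow> real^'n \<Rightarrow> real^'n" where
  "E3 i j k x = frechet_derivative (E2 j k) (at x) (axis i 1)"

definition P :: "real^'n \<Rightarrow> real^'n" where "P x = gradient f (\<phi> x)"

definition Hess :: "real^'n \<Rightarrow> real^'n \<Rightarrow> real^'n" where "Hess x = hessian f (\<phi> x)"

text \<open>The push-forward of the covariant derivative of the \<open>j\<close>-th coordinate field
  in direction \<open>i\<close>: the flat derivative \<open>E2 i j x\<close> plus the conformal
  change of the Levi-Civita connection.\<close>

definition W :: "'n \<Rightarrow> 'n \<Rightarrow> real^'n \<Rightarrow> real^'n" where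
  "W i j x = (P x \<bullet> E i x) *\<^sub>R E j x + (P x \<bullet> E j x) *\<^sub>R E i x - (E i x \<bullet> E j x) *\<^sub>R P x + E2 i j x"

lemma smooth_E: "smooth_on U (E i)"
  unfolding E_def[abs_def] by (rule smooth_on_frechet_derivative[OF smooth_\<phi>])

lemma smooth_E2: "smooth_on U (E2 i j)"
  unfolding E2_def[abs_def] by (rule smooth_on_frechet_derivative[OF smooth_E])

lemma linear_J: "x \<in> U \<Longrightarrow> linear (frechet_derivative \<phi> (at x))"
  using smooth_on_differentiable[OF smooth_\<phi>] by (rule linear_frechet_derivative)

lemma J_eq: "x \<in> U \<Longrightarrow> frechet_derivative \<phi> (at x) v = (\<Sum>i\<in>UNIV. v $ i *\<^sub>R E i x)"
  unfolding E_def by (rule linear_sum_axis[OF linear_J])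

lemma E2_symmetric: "x \<in> U \<Longrightarrow> E2 i j x = E2 j i x"
  unfolding E2_def E_def[abs_def]
  by (rule symmetric_second_derivative[OF open_U _ smooth_on_Ck[OF smooth_\<phi>]])

lemma E3_symmetric: "x \<in> U \<Longrightarrow> E3 i j k x = E3 j i k x"
  unfolding E3_def E2_def[abs_def]
  by (rule symmetric_second_derivative[OF open_U _ smooth_on_Ck[OF smooth_E]])

lemma has_derivative_E: "x \<in> U \<Longrightarrow> (E i has_derivative frechet_derivative (E i) (at x)) (at x)"
  by (rule smooth_on_has_derivative[OF smooth_E])

lemma has_derivative_E2: "x \<in> U \<Longrightarrow> (E2 i j has_derivative frechet_derivative (E2 i j) (at x)) (at x)"
  by (rule smooth_on_has_derivative[OF smooth_E2])

lemma has_derivative_P: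
  assumes "x \<in> U"
  shows "(P has_derivative (\<lambda>v. Hess x (frechet_derivative \<phi> (at x) v))) (at x)"
  unfolding P_def[abs_def] Hess_def
  by (rule has_derivative_compose[OF smooth_on_has_derivative[OF smooth_\<phi> assms]
        has_derivative_gradient[OF smooth_f maps[OF assms]]])

lemma has_derivative_f:
  assumes "x \<in> U"
  shows "((\<lambda>x. f (\<phi> x)) has_derivative (\<lambda>v. P x \<bullet> frechet_derivative \<phi> (at x) v)) (at x)"
  using has_derivative_compose[OF smooth_on_has_derivative[OF smooth_\<phi> assms]
        smooth_on_has_derivative[OF smooth_f maps[OF assms]]]
  by (simp add: P_def gradient_inner[OF smooth_on_differentiable[OF smooth_f maps[OF assms]]])

text \<open>By conformality a vector in the kernel has length zero in the metric
  \<open>G x\<close>.\<close>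

lemma J_zero:
  assumes "x \<in> U" "frechet_derivative \<phi> (at x) v = 0"
  shows "v = 0"
  using metric[OF assms(1)] conformal[OF assms(1), of v v] assms(2)
  unfolding inner_product_matrix_def by force

lemma inj_J: "x \<in> U \<Longrightarrow> inj (frechet_derivative \<phi> (at x))"
  using J_zero linear_injective_0[OF linear_J] by blast

lemma surj_J: "x \<in> U \<Longrightarrow> surj (frechet_derivative \<phi> (at x))"
  using linear_injective_imp_surjective[OF linear_J inj_J] by simp

lemma orthogonal_E:
  assumes "x \<in> U" "\<And>m. E m x \<bullet> w = 0"
  shows "w = 0"
proof -
  obtain c where "w = frechet_derivative \<phi> (at x) c" using surj_J[OF assms(1)] by (metis surjD)
  then have "w \<bullet> w = (\<Sum>i\<in>UNIV. c $ i *\<^sub>R E i x) \<bullet> w" using J_eq[OF assms(1)] by simp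
  also have "\<dots> = 0" using assms(2) by (simp add: inner_sum_left)
  finally show ?thesis by simp
qed

lemma G_entry: "x \<in> U \<Longrightarrow> G x $ i $ j = exp (2 * f (\<phi> x)) * (E i x \<bullet> E j x)"
  using conformal[of x "axis i 1" "axis j 1"]
  by (simp add: E_def ginner_def matrix_vector_mult_basis inner_axis' column_def)

lemma partial_G:
  assumes "x \<in> U"
  shows "partial k (\<lambda>y. G y $ i $ j) x = exp (2 * f (\<phi> x)) *
    (2 * (P x \<bullet> E k x) * (E i x \<bullet> E j x) + E2 k i x \<bullet> E j x + E i x \<bullet> E2 k j x)"
proof -
  have "((\<lambda>y. exp (2 * f (\<phi> y)) * (E i y \<bullet> E j y)) has_derivative (\<lambda>v. exp (2 * f (\<phi> x)) *
      (2 * (P x \<bullet> frechet_derivative \<phi> (at x) v) * (E i x \<bullet> E j x) +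
        frechet_derivative (E i) (at x) v \<bullet> E j x + E i x \<bullet> frechet_derivative (E j) (at x) v))) (at x)"
    by (rule derivative_eq_intros has_derivative_f[OF assms] has_derivative_E[OF assms] refl)+
      (simp add: fun_eq_iff algebra_simps)
  then have "((\<lambda>y. G y $ i $ j) has_derivative (\<lambda>v. exp (2 * f (\<phi> x)) *
      (2 * (P x \<bullet> frechet_derivative \<phi> (at x) v) * (E i x \<bullet> E j x) +
        frechet_derivative (E i) (at x) v \<bullet> E j x + E i x \<bullet> frechet_derivative (E j) (at x) v))) (at x)"
    by (rule has_derivative_transform_within_open[OF _ open_U assms]) (simp add: G_entry)
  from frechet_derivative_at[OF this, symmetric] show ?thesis
    by (simp add: partial_def E_def[symmetric] E2_def)
qed

lemma G_inverse:
  assumes "x \<in> U"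
  shows "G x ** matrix_inv (G x) = mat 1"
proof -
  have "v = 0" if "G x *v v = 0" for v
    using metric[OF assms] that unfolding inner_product_matrix_def ginner_def by force
  then have "invertible (G x)"
    by (simp add: invertible_left_inverse matrix_left_invertible_ker)
  then show ?thesis unfolding invertible_def matrix_inv_def by (rule someI_ex[THEN conjunct1])
qed

text \<open>Half of the bracket in the definition of the Christoffel symbols is Koszul's formula; in
  terms of \<open>E\<close> it is \<open>exp (2 * f (\<phi> x))\<close> times the inner product of
  \<open>E m x\<close> and \<open>W i j x\<close>. Raising the index by the inverse matrix
  identifies the vector, since the \<open>E m x\<close> span.\<close>

lemma christoffel_sum:
  assumes x: "x \<in> U"
  shows "(\<Sum>l\<in>UNIV. christoffel G l i j x *\<^sub>R E l x) = W i j x"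
proof -
  define T where "T m = 1 / 2 * (partial i (\<lambda>y. G y $ j $ m) x + partial j (\<lambda>y. G y $ i $ m) x
       - partial m (\<lambda>y. G y $ i $ j) x)" for m
  have T: "T m = exp (2 * f (\<phi> x)) * (E m x \<bullet> W i j x)" for m
    unfolding T_def partial_G[OF x] W_def
    using E2_symmetric[OF x, of i j] E2_symmetric[OF x, of i m] E2_symmetric[OF x, of j m]
    by (simp add: inner_add_right inner_diff_right inner_commute algebra_simps)
  have \<Gamma>: "christoffel G l i j x = (\<Sum>m\<in>UNIV. matrix_inv (G x) $ l $ m * T m)" for l
    unfolding christoffel_def T_def by (simp add: sum_distrib_left mult_ac)
  have "E m x \<bullet> ((\<Sum>l\<in>UNIV. christoffel G l i j x *\<^sub>R E l x) - W i j x) = 0" for m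
  proof -
    have "exp (2 * f (\<phi> x)) * (E m x \<bullet> (\<Sum>l\<in>UNIV. christoffel G l i j x *\<^sub>R E l x)) =
        (\<Sum>l\<in>UNIV. G x $ m $ l * christoffel G l i j x)"
      by (simp add: G_entry[OF x] inner_sum_right sum_distrib_left mult_ac)
    also have "\<dots> = (\<Sum>l\<in>UNIV. \<Sum>k\<in>UNIV. G x $ m $ l * matrix_inv (G x) $ l $ k * T k)"
      unfolding \<Gamma> by (simp add: sum_distrib_left mult_ac)
    also have "\<dots> = (\<Sum>k\<in>UNIV. (G x ** matrix_inv (G x)) $ m $ k * T k)"
      by (subst sum.swap) (simp add: matrix_matrix_mult_def sum_distrib_right)
    also have "\<dots> = T m"
      unfolding G_inverse[OF x] by (simp add: mat_def if_distrib[of "\<lambda>c. c * _"] cong: if_cong)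
    finally show ?thesis unfolding T by (simp add: inner_diff_right)
  qed
  from orthogonal_E[OF x this] show ?thesis by simp
qed

lemma has_derivative_W:
  assumes x: "x \<in> U"
  shows "(W j k has_derivative (\<lambda>v. let D = \<lambda>i. frechet_derivative (E i) (at x) v; H = Hess x (frechet_derivative \<phi> (at x) v) in
    (H \<bullet> E j x + P x \<bullet> D j) *\<^sub>R E k x + (P x \<bullet> E j x) *\<^sub>R D k + (H \<bullet> E k x + P x \<bullet> D k) *\<^sub>R E j x
     + (P x \<bullet> E k x) *\<^sub>R D j - (D j \<bullet> E k x + E j x \<bullet> D k) *\<^sub>R P x - (E j x \<bullet> E k x) *\<^sub>R H
     + frechet_derivative (E2 j k) (at x) v)) (at x)"
  unfolding W_def[abs_def] Let_def
  by (rule derivative_eq_intros has_derivative_P[OF x] has_derivative_E[OF x] has_derivative_E2[OF x] refl)+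
    (simp add: fun_eq_iff algebra_simps)

lemma det_E:
  assumes "x \<in> U"
  shows "det (\<chi> a b. E b x $ a) \<noteq> 0"
proof -
  have "(\<chi> a b. E b x $ a) *v c = frechet_derivative \<phi> (at x) c" for c
    using J_eq[OF assms, of c] by (simp add: vec_eq_iff matrix_vector_mult_def mult.commute)
  then have "invertible (\<chi> a b. E b x $ a)"
    using J_zero[OF assms] by (simp add: invertible_left_inverse matrix_left_invertible_ker)
  then show ?thesis by (simp add: invertible_det_nz)
qed

lemma differentiable_det:
  fixes A :: "real^'n \<Rightarrow> real^'n^'n"
  assumes "\<And>a b. (\<lambda>y. A y $ a $ b) differentiable (at x)"
  shows "(\<lambda>y. det (A y)) differentiable (at x)"
proof -
  obtain D where D: "\<And>a b. ((\<lambda>y. A y $ a $ b) has_derivative D a b) (at x)"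
    using assms unfolding differentiable_def by metis
  have "(\<lambda>y. \<Prod>i\<in>UNIV. A y $ i $ p i) differentiable (at x)" for p
    unfolding differentiable_def using has_derivative_prod[of UNIV "\<lambda>i y. A y $ i $ p i" "\<lambda>i. D i (p i)" x UNIV] D by auto
  then show ?thesis unfolding det_def
    by (intro differentiable_sum differentiable_mult ballI) auto
qed

text \<open>The Christoffel symbols solve the linear system of \<open>christoffel_sum\<close>, so Cramer's rule writes
  them as a quotient of determinants.\<close>

lemma differentiable_christoffel:
  assumes x: "x \<in> U"
  shows "christoffel G l j k differentiable (at x)"
proof -
  define N where "N y = (\<chi> a b. if b = l then W j k y $ a else E b y $ a)" for y
  define M where "M y = (\<chi> a b. E b y $ a)" for y
  have eq: "christoffel G l j k y = det (N y) / det (M y)" if y: "y \<in> U" for y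
  proof -
    have "M y *v (\<chi> l. christoffel G l j k y) = W j k y"
      using christoffel_sum[OF y, of j k] by (simp add: M_def vec_eq_iff matrix_vector_mult_def mult.commute)
    then have "(\<chi> l. christoffel G l j k y) = (\<chi> k'. det (\<chi> i m. if m = k' then W j k y $ i else M y $ i $ m) / det (M y))"
      using cramer[of "M y"] det_E[OF y] by (simp add: M_def)
    then show ?thesis by (simp add: vec_eq_iff N_def M_def cong: if_cong)
  qed
  have dE: "(\<lambda>y. E b y $ a) differentiable (at x)" for a b
    using bounded_linear.has_derivative[OF bounded_linear_vec_nth has_derivative_E[OF x]] unfolding differentiable_def by blast
  have dW: "(\<lambda>y. W j k y $ a) differentiable (at x)" for a
    using bounded_linear.has_derivative[OF bounded_linear_vec_nth has_derivative_W[OF x]] unfolding differentiable_def by blast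
  have "(\<lambda>y. det (N y)) differentiable (at x)"
  proof (rule differentiable_det)
    show "(\<lambda>y. N y $ a $ b) differentiable (at x)" for a b
      by (cases "b = l") (simp_all add: N_def dE dW)
  qed
  moreover have "(\<lambda>y. det (M y)) differentiable (at x)"
    by (rule differentiable_det) (simp add: M_def dE)
  ultimately have "(\<lambda>y. det (N y) / det (M y)) differentiable (at x)"
    using det_E[OF x] by (intro differentiable_divide) (auto simp: M_def)
  then obtain D where "((\<lambda>y. det (N y) / det (M y)) has_derivative D) (at x)"
    unfolding differentiable_def by blast
  then have "(christoffel G l j k has_derivative D) (at x)"
    by (rule has_derivative_transform_within_open[OF _ open_U x]) (simp add: eq)
  then show ?thesis unfolding differentiable_def by blast
qed

text \<open>The identity \<open>christoffel_sum\<close> holds on the open set \<open>U\<close>, so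
  both sides may be differentiated in direction \<open>i\<close>: the left by the product rule, the
  right by \<open>has_derivative_W\<close>.\<close>

lemma partial_christoffel_sum:
  assumes x: "x \<in> U"
  shows "(\<Sum>l\<in>UNIV. partial i (christoffel G l j k) x *\<^sub>R E l x) + (\<Sum>l\<in>UNIV. christoffel G l j k x *\<^sub>R E2 i l x) =
    (Hess x (E i x) \<bullet> E j x + P x \<bullet> E2 i j x) *\<^sub>R E k x + (P x \<bullet> E j x) *\<^sub>R E2 i k x
     + (Hess x (E i x) \<bullet> E k x + P x \<bullet> E2 i k x) *\<^sub>R E j x
     + (P x \<bullet> E k x) *\<^sub>R E2 i j x - (E2 i j x \<bullet> E k x + E j x \<bullet> E2 i k x) *\<^sub>R P x - (E j x \<bullet> E k x) *\<^sub>R Hess x (E i x)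
     + E3 i j k x"
proof -
  have hd: "(christoffel G l j k has_derivative frechet_derivative (christoffel G l j k) (at x)) (at x)" for l
    using differentiable_christoffel[OF x] frechet_derivative_works by blast
  have "((\<lambda>y. \<Sum>l\<in>UNIV. christoffel G l j k y *\<^sub>R E l y) has_derivative
      (\<lambda>v. \<Sum>l\<in>UNIV. christoffel G l j k x *\<^sub>R frechet_derivative (E l) (at x) v +
        frechet_derivative (christoffel G l j k) (at x) v *\<^sub>R E l x)) (at x)"
    by (intro has_derivative_sum has_derivative_scaleR hd has_derivative_E x)
  then have d: "(W j k has_derivative
      (\<lambda>v. \<Sum>l\<in>UNIV. christoffel G l j k x *\<^sub>R frechet_derivative (E l) (at x) v +
        frechet_derivative (christoffel G l j k) (at x) v *\<^sub>R E l x)) (at x)"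
    by (rule has_derivative_transform_within_open[OF _ open_U x]) (simp add: christoffel_sum)
  from fun_cong[OF has_derivative_unique[OF d has_derivative_W[OF x]], of "axis i 1"]
  show ?thesis by (simp add: Let_def sum.distrib partial_def E2_def E3_def flip: E_def) (simp add: add.commute)
qed

lemma curvature_coeff_sum:
  assumes x: "x \<in> U"
  shows "(\<Sum>l\<in>UNIV. curvature_coeff G l i j k x *\<^sub>R E l x) = flat_curvature (P x) (Hess x) (E i x) (E j x) (E k x)"
proof -
  let ?\<Gamma> = "\<lambda>l j k. christoffel G l j k x"
  \<comment> \<open>The push-forward of the second covariant derivative of the \<open>k\<close>-th
    coordinate field, first in direction \<open>j\<close> and then in direction
    \<open>i\<close>.\<close>
  define Q where "Q i j k = (\<Sum>l\<in>UNIV. partial i (christoffel G l j k) x *\<^sub>R E l x) +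
      (\<Sum>l\<in>UNIV. (\<Sum>m\<in>UNIV. ?\<Gamma> l i m * ?\<Gamma> m j k) *\<^sub>R E l x)" for i j k
  have Q: "Q i j k = ((\<Sum>l\<in>UNIV. partial i (christoffel G l j k) x *\<^sub>R E l x) + (\<Sum>l\<in>UNIV. ?\<Gamma> l j k *\<^sub>R E2 i l x)) +
      (P x \<bullet> E i x) *\<^sub>R W j k x + (P x \<bullet> W j k x) *\<^sub>R E i x - (E i x \<bullet> W j k x) *\<^sub>R P x" for i j k
  proof -
    \<comment> \<open>Summing over \<open>l\<close> turns the quadratic terms into a combination of
      the \<open>W i m x\<close>, whose \<open>E2 i m x\<close> parts supply the second sum on the
      left of \<open>partial_christoffel_sum\<close>.\<close>
    have "(\<Sum>l\<in>UNIV. (\<Sum>m\<in>UNIV. ?\<Gamma> l i m * ?\<Gamma> m j k) *\<^sub>R E l x) =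
        (\<Sum>m\<in>UNIV. ?\<Gamma> m j k *\<^sub>R (\<Sum>l\<in>UNIV. ?\<Gamma> l i m *\<^sub>R E l x))"
      unfolding scaleR_sum_left scaleR_sum_right by (subst sum.swap) (simp add: mult.commute)
    also have "\<dots> = (\<Sum>m\<in>UNIV. ?\<Gamma> m j k *\<^sub>R W i m x)" unfolding christoffel_sum[OF x] ..
    also have "\<dots> = (P x \<bullet> E i x) *\<^sub>R (\<Sum>m\<in>UNIV. ?\<Gamma> m j k *\<^sub>R E m x) +
        (P x \<bullet> (\<Sum>m\<in>UNIV. ?\<Gamma> m j k *\<^sub>R E m x)) *\<^sub>R E i x -
        (E i x \<bullet> (\<Sum>m\<in>UNIV. ?\<Gamma> m j k *\<^sub>R E m x)) *\<^sub>R P x + (\<Sum>m\<in>UNIV. ?\<Gamma> m j k *\<^sub>R E2 i m x)"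
      unfolding W_def
      by (simp add: scaleR_right_distrib scaleR_right_diff_distrib sum.distrib sum_subtractf inner_sum_right
          scaleR_sum_left scaleR_sum_right mult.commute)
    finally show ?thesis unfolding Q_def christoffel_sum[OF x] by simp
  qed
  have "(\<Sum>l\<in>UNIV. curvature_coeff G l i j k x *\<^sub>R E l x) = Q i j k - Q j i k"
    unfolding curvature_coeff_def Q_def
    by (simp add: scaleR_left_distrib scaleR_left_diff_distrib sum.distrib sum_subtractf)
  also have "\<dots> = flat_curvature (P x) (Hess x) (E i x) (E j x) (E k x)"
    unfolding Q partial_christoffel_sum[OF x] unfolding W_def E3_symmetric[OF x, of j i] E2_symmetric[OF x, of j i]
    by (rule flat_curvature_eq) (simp add: Hess_def hessian_symmetric[OF open_V smooth_f maps[OF x]])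
  finally show ?thesis .
qed

text \<open>The sum over the upper index \<open>l\<close> is moved inside until
  \<open>curvature_coeff_sum\<close> applies; trilinearity then collects the other three sums into
  the arguments.\<close>

lemma J_curvature_operator:
  assumes x: "x \<in> U"
  shows "frechet_derivative \<phi> (at x) (curvature_operator G x u v w) =
    flat_curvature (P x) (Hess x) (frechet_derivative \<phi> (at x) u) (frechet_derivative \<phi> (at x) v) (frechet_derivative \<phi> (at x) w)"
proof -
  have H: "linear (Hess x)" unfolding Hess_def by (rule linear_hessian[OF smooth_f maps[OF x]])
  note lin = linear_flat_curvature[OF H]
  have "frechet_derivative \<phi> (at x) (curvature_operator G x u v w) =
      (\<Sum>l\<in>UNIV. \<Sum>i\<in>UNIV. \<Sum>j\<in>UNIV. \<Sum>k\<in>UNIV. (u $ i * v $ j * w $ k) *\<^sub>R (curvature_coeff G l i j k x *\<^sub>R E l x))"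
    unfolding J_eq[OF x] curvature_operator_def by (simp add: scaleR_sum_left mult_ac)
  also have "\<dots> = (\<Sum>i\<in>UNIV. \<Sum>l\<in>UNIV. \<Sum>j\<in>UNIV. \<Sum>k\<in>UNIV. (u $ i * v $ j * w $ k) *\<^sub>R (curvature_coeff G l i j k x *\<^sub>R E l x))"
    by (rule sum.swap)
  also have "\<dots> = (\<Sum>i\<in>UNIV. \<Sum>j\<in>UNIV. \<Sum>l\<in>UNIV. \<Sum>k\<in>UNIV. (u $ i * v $ j * w $ k) *\<^sub>R (curvature_coeff G l i j k x *\<^sub>R E l x))"
    by (rule sum.cong[OF refl], rule sum.swap)
  also have "\<dots> = (\<Sum>i\<in>UNIV. \<Sum>j\<in>UNIV. \<Sum>k\<in>UNIV. \<Sum>l\<in>UNIV. (u $ i * v $ j * w $ k) *\<^sub>R (curvature_coeff G l i j k x *\<^sub>R E l x))"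
    by (rule sum.cong[OF refl], rule sum.cong[OF refl], rule sum.swap)
  also have "\<dots> = (\<Sum>i\<in>UNIV. \<Sum>j\<in>UNIV. \<Sum>k\<in>UNIV. (u $ i * v $ j * w $ k) *\<^sub>R flat_curvature (P x) (Hess x) (E i x) (E j x) (E k x))"
    unfolding scaleR_sum_right[symmetric] curvature_coeff_sum[OF x] ..
  also have "\<dots> = (\<Sum>i\<in>UNIV. u $ i *\<^sub>R (\<Sum>j\<in>UNIV. v $ j *\<^sub>R (\<Sum>k\<in>UNIV. w $ k *\<^sub>R flat_curvature (P x) (Hess x) (E i x) (E j x) (E k x))))"
    by (simp add: scaleR_sum_right mult.assoc)
  also have "\<dots> = flat_curvature (P x) (Hess x) (\<Sum>i\<in>UNIV. u $ i *\<^sub>R E i x) (\<Sum>i\<in>UNIV. v $ i *\<^sub>R E i x) (\<Sum>i\<in>UNIV. w $ i *\<^sub>R E i x)"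
  proof -
    let ?F = "flat_curvature (P x) (Hess x)"
    have "(\<Sum>k\<in>UNIV. w $ k *\<^sub>R ?F a b (E k x)) = ?F a b (\<Sum>k\<in>UNIV. w $ k *\<^sub>R E k x)" for a b
      by (rule linear_combination[OF lin(3)])
    moreover have "(\<Sum>j\<in>UNIV. v $ j *\<^sub>R ?F a (E j x) c) = ?F a (\<Sum>j\<in>UNIV. v $ j *\<^sub>R E j x) c" for a c
      by (rule linear_combination[OF lin(2)])
    moreover have "(\<Sum>i\<in>UNIV. u $ i *\<^sub>R ?F (E i x) b c) = ?F (\<Sum>i\<in>UNIV. u $ i *\<^sub>R E i x) b c" for b c
      by (rule linear_combination[OF lin(1)])
    ultimately show ?thesis by (simp only:)
  qed
  finally show ?thesis unfolding J_eq[OF x] .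
qed

end

section \<open>The curvature as the product of the metric and the Schouten tensor\<close>

lemma wedge_pair:
  assumes "\<And>xs. length xs \<noteq> 1 \<Longrightarrow> \<alpha> xs = 0" "\<And>xs. length xs \<noteq> 1 \<Longrightarrow> \<beta> xs = 0"
  shows "wedge \<alpha> \<beta> [a, b] = \<alpha> [a] * \<beta> [b] - \<alpha> [b] * \<beta> [a]"
  using assms by (simp add: wedge_Cons wedge_Nil)

text \<open>This is the Kulkarni-Nomizu product of \<open>g\<close> and \<open>h\<close>.\<close>

lemma dprod_bilinear:
  "dprod (bilinear_dform g) (bilinear_dform h) [a, b] [c, d] =
     g a c * h b d - g a d * h b c - g b c * h a d + g b d * h a c"
proof -
  let ?g = "bilinear_dform g" and ?h = "bilinear_dform h"
  have "wedge (\<lambda>zs. ?g zs us) (\<lambda>zs. ?h zs vs) [a, b] = ?g [a] us * ?h [b] vs - ?g [b] us * ?h [a] vs" for us vs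
    by (rule wedge_pair) (simp_all add: bilinear_dform_other)
  then have "dprod ?g ?h [a, b] [c, d] = wedge (?g [a]) (?h [b]) [c, d] - wedge (?g [b]) (?h [a]) [c, d]"
    unfolding dprod_eq_wedge wedge_def[of _ _ "[c, d]"] by (simp add: right_diff_distrib sum_subtractf)
  also have "\<dots> = (g a c * h b d - g a d * h b c) - (g b c * h a d - g b d * h a c)"
    by (subst (1 2) wedge_pair) (simp_all add: bilinear_dform_other)
  finally show ?thesis by simp
qed

lemma bilinear_schouten_op:
  assumes "linear H"
  shows "bilinear (\<lambda>u v. schouten_op p H u \<bullet> v)"
  unfolding bilinear_def schouten_op_def
  by (auto simp: linear_iff linear_add[OF assms] linear_cmul[OF assms] inner_add_left inner_add_right
      inner_diff_left algebra_simps)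

lemma schouten_op_symmetric:
  assumes "\<And>u v. H u \<bullet> v = H v \<bullet> u"
  shows "schouten_op p H u \<bullet> v = schouten_op p H v \<bullet> u"
  using assms[of u v] by (simp add: schouten_op_def inner_add_left inner_diff_left inner_commute[of v u])

context conformal_chart
begin

text \<open>\<open>schouten_op\<close> is the negative of the Schouten tensor of
  \<open>exp (2 * f)\<close> times the flat metric, whence the sign. No conformal factor appears,
  because the one in the curvature is absorbed by the metric factor in
  \<open>riemann_eq\<close>.\<close>

definition schouten :: "real^'n \<Rightarrow> real^'n \<Rightarrow> real^'n \<Rightarrow> real" where
  "schouten x u v = - (schouten_op (P x) (Hess x) (frechet_derivative \<phi> (at x) u) \<bullet> frechet_derivative \<phi> (at x) v)"

lemma linear_Hess: "x \<in> U \<Longrightarrow> linear (Hess x)"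
  unfolding Hess_def by (rule linear_hessian[OF smooth_f maps])

lemma bilinear_schouten:
  assumes x: "x \<in> U"
  shows "bilinear (schouten x)"
  using bilinear_schouten_op[OF linear_Hess[OF x], of "P x"] linear_J[OF x]
  unfolding bilinear_def schouten_def[abs_def] by (auto simp: linear_iff)

lemma Hess_symmetric: "x \<in> U \<Longrightarrow> Hess x u \<bullet> v = Hess x v \<bullet> u"
  unfolding Hess_def by (rule hessian_symmetric[OF open_V smooth_f maps])

lemma riemann_eq:
  assumes x: "x \<in> U"
  shows "riemann G x = dprod (metric_dform (G x)) (bilinear_dform (schouten x))"
proof (intro ext)
  fix us vs :: "(real^'n) list"
  show "riemann G x us vs = dprod (metric_dform (G x)) (bilinear_dform (schouten x)) us vs"
  proof (cases "length us = 2 \<and> length vs = 2")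
    case True
    then obtain u1 u2 v1 v2 where uv: "us = [u1, u2]" "vs = [v1, v2]"
      by (auto simp: numeral_2_eq_2 length_Suc_conv)
    let ?J = "frechet_derivative \<phi> (at x)"
    have "riemann G x us vs = exp (2 * f (\<phi> x)) * (flat_curvature (P x) (Hess x) (?J u1) (?J u2) (?J v2) \<bullet> ?J v1)"
      by (simp add: riemann_def uv conformal[OF x] J_curvature_operator[OF x])
    also have "\<dots> = dprod (metric_dform (G x)) (bilinear_dform (schouten x)) us vs"
      unfolding metric_dform_eq uv dprod_bilinear
      by (simp add: conformal[OF x] schouten_def flat_curvature_def inner_add_left inner_diff_left algebra_simps)
    finally show ?thesis .
  next
    case False
    have "is_dform 2 2 (dprod (metric_dform (G x)) (bilinear_dform (schouten x)))"
      using is_dform_dprod[OF is_dform_metric is_dform_bilinear[OF bilinear_schouten[OF x]]] by (simp add: numeral_2_eq_2)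
    then have "dprod (metric_dform (G x)) (bilinear_dform (schouten x)) us vs = 0"
      using False by (auto simp: is_dform_def is_form_def)
    moreover have "riemann G x us vs = 0"
      using False by (auto simp: riemann_def split: list.split)
    ultimately show ?thesis by simp
  qed
qed

text \<open>The eigenbasis \<open>\<epsilon>\<close> belongs to the flat chart. Its preimage,
  rescaled by \<open>exp (- f (\<phi> x))\<close>, is orthonormal for \<open>G x\<close>; the
  rescaling and the sign in \<open>schouten\<close> account for the form of the eigenvalues. These
  involve only data at \<open>\<phi> x\<close>, which makes them the same for all charts around a
  point.\<close>

lemma conformally_flat_curvature_at:
  assumes x: "x \<in> U"
    and \<epsilon>: "\<And>i j. i < CARD('n) \<Longrightarrow> j < CARD('n) \<Longrightarrow> \<epsilon> i \<bullet> \<epsilon> j = of_bool (i = j)"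
    and \<mu>: "\<And>i j. i < CARD('n) \<Longrightarrow> j < CARD('n) \<Longrightarrow>
      schouten_op (gradient f (\<phi> x)) (hessian f (\<phi> x)) (\<epsilon> i) \<bullet> \<epsilon> j = of_bool (i = j) * \<mu> i"
  shows "\<exists>e h. conformally_flat_curvature (G x) e h (\<lambda>i. - (\<mu> i / exp (2 * f (\<phi> x)))) (riemann G x)"
proof -
  let ?J = "frechet_derivative \<phi> (at x)" and ?c = "exp (- f (\<phi> x))"
  define e where "e i = (SOME v. ?J v = ?c *\<^sub>R \<epsilon> i)" for i
  have Je: "?J (e i) = ?c *\<^sub>R \<epsilon> i" for i
    unfolding e_def by (rule someI_ex) (metis surj_J[OF x] surjD)
  have cc: "exp (2 * f (\<phi> x)) * (?c * ?c) = 1" by (simp flip: exp_add)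
  have cc': "?c * ?c = 1 / exp (2 * f (\<phi> x))" using cc by (simp add: field_simps)
  have "conformally_flat_curvature (G x) e (schouten x) (\<lambda>i. - (\<mu> i / exp (2 * f (\<phi> x)))) (riemann G x)"
  proof unfold_locales
    show "inner_product_matrix (G x)" by (rule metric[OF x])
    show "ginner (G x) (e i) (e j) = of_bool (i = j)" if "i < CARD('n)" "j < CARD('n)" for i j
    proof -
      have "ginner (G x) (e i) (e j) = exp (2 * f (\<phi> x)) * (?c * ?c) * (\<epsilon> i \<bullet> \<epsilon> j)"
        unfolding conformal[OF x] Je by simp
      then show ?thesis unfolding cc using \<epsilon>[OF that] by simp
    qed
    show "bilinear (schouten x)" by (rule bilinear_schouten[OF x])
    show "schouten x u v = schouten x v u" for u v
      unfolding schouten_def using schouten_op_symmetric[OF Hess_symmetric[OF x], of "P x"] by simp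
    show "schouten x (e i) (e j) = of_bool (i = j) * - (\<mu> i / exp (2 * f (\<phi> x)))"
      if "i < CARD('n)" "j < CARD('n)" for i j
    proof -
      note b = bilinear_schouten_op[OF linear_Hess[OF x], of "P x"]
      have "schouten x (e i) (e j) = - (?c * ?c * (schouten_op (P x) (Hess x) (\<epsilon> i) \<bullet> \<epsilon> j))"
        unfolding schouten_def Je using bilinear_lmul[OF b] bilinear_rmul[OF b] by simp
      then show ?thesis unfolding cc' using \<mu>[OF that] by (simp add: P_def Hess_def)
    qed
    show "riemann G x = dprod (metric_dform (G x)) (bilinear_dform (schouten x))"
      by (rule riemann_eq[OF x])
  qed
  then show ?thesis by blast
qed

end

section \<open>Passage from charts to the manifold\<close>

lemma is_chart_inj:
  assumes "is_chart X c"
  shows "inj_on (coord c) (chart_dom c)"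
proof -
  have "chart_dom c \<subseteq> topspace X" using assms by (simp add: is_chart_def openin_subset)
  then show ?thesis using assms homeomorphic_imp_injective_map
    unfolding is_chart_def by (metis inf.absorb2 topspace_subtopology)
qed

lemma is_chart_open_image:
  assumes c: "is_chart X c" and W: "openin X W"
  shows "open (coord c ` (chart_dom c \<inter> W))"
proof -
  have "openin (subtopology X (chart_dom c)) (chart_dom c \<inter> W)"
    using W by (simp add: openin_subtopology_Int2)
  then have "openin (top_of_set (coord c ` chart_dom c)) (coord c ` (chart_dom c \<inter> W))"
    using c homeomorphic_imp_open_map unfolding is_chart_def open_map_def by blast
  then show ?thesis using c openin_open_trans unfolding is_chart_def by blast
qed

lemma transition_coord:
  assumes "is_chart X c" "q \<in> chart_dom c"
  shows "transition c d (coord c q) = coord d q"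
  using is_chart_inj[OF assms(1)] assms(2) by (simp add: transition_def)

text \<open>The eigenvalues \<open>l\<close> depend on the point only, not on the chart of \<open>A\<close>: they are computed in the
  conformally flat chart.\<close>

lemma conformally_flat_fibre:
  fixes X :: "'a topology" and A :: "('a, 'n::finite) chart set" and g :: "('a, 'n) metric"
  assumes M: "riemannian_manifold X A g" and flat: "locally_conformally_flat X A g" and p: "p \<in> topspace X"
  shows "\<exists>l. \<forall>c\<in>A. p \<in> chart_dom c \<longrightarrow>
    (\<exists>e h. conformally_flat_curvature (g c (coord c p)) e h l (riemann (g c) (coord c p)))"
proof -
  interpret riemannian_manifold X A g by fact
  obtain d and f :: "real^'n \<Rightarrow> real" where d: "is_chart X d" "\<forall>c\<in>A. smoothly_compatible c d" "p \<in> chart_dom d"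
    and f: "smooth_on (coord d ` chart_dom d) f"
    and conf: "\<forall>c\<in>A. \<forall>q\<in>chart_dom c \<inter> chart_dom d. \<forall>u v.
        ginner (g c (coord c q)) u v = exp (2 * f (coord d q)) *
          (frechet_derivative (transition c d) (at (coord c q)) u \<bullet> frechet_derivative (transition c d) (at (coord c q)) v)"
    using flat p unfolding locally_conformally_flat_def Let_def by metis
  let ?y = "coord d p"
  let ?s = "\<lambda>u v. schouten_op (gradient f ?y) (hessian f ?y) u \<bullet> v"
  have V: "open (coord d ` chart_dom d)" using d(1) by (simp add: is_chart_def)
  have y: "?y \<in> coord d ` chart_dom d" using d(3) by blast
  obtain \<epsilon> \<mu> where \<epsilon>: "\<And>i j. i < CARD('n) \<Longrightarrow> j < CARD('n) \<Longrightarrow> \<epsilon> i \<bullet> \<epsilon> j = of_bool (i = j)"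
    and \<mu>: "\<And>i j. i < CARD('n) \<Longrightarrow> j < CARD('n) \<Longrightarrow> ?s (\<epsilon> i) (\<epsilon> j) = of_bool (i = j) * \<mu> i"
    using symmetric_form_eigenbasis[OF bilinear_schouten_op[OF linear_hessian[OF f y]]
        schouten_op_symmetric[OF hessian_symmetric[OF V f y]]] by metis
  have "\<exists>e h. conformally_flat_curvature (g c (coord c p)) e h (\<lambda>i. - (\<mu> i / exp (2 * f ?y))) (riemann (g c) (coord c p))"
    if c: "c \<in> A" "p \<in> chart_dom c" for c
  proof -
    let ?U = "coord c ` (chart_dom c \<inter> chart_dom d)"
    note chart = charts[OF c(1)]
    have "conformal_chart ?U (transition c d) (coord d ` chart_dom d) f (g c)"
    proof
      show "open ?U" using is_chart_open_image[OF chart] d(1) by (simp add: is_chart_def)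
      show "open (coord d ` chart_dom d)" by (rule V)
      show "smooth_on ?U (transition c d)" using d(2) c(1) by (simp add: smoothly_compatible_def)
      show "smooth_on (coord d ` chart_dom d) f" by (rule f)
      fix x assume "x \<in> ?U"
      then obtain q where q: "x = coord c q" "q \<in> chart_dom c" "q \<in> chart_dom d" by auto
      show "transition c d x \<in> coord d ` chart_dom d"
        unfolding q(1) transition_coord[OF chart q(2)] using q(3) by blast
      show "inner_product_matrix (g c x)" using inner_product[OF c(1)] q by blast
      show "ginner (g c x) u v = exp (2 * f (transition c d x)) *
          (frechet_derivative (transition c d) (at x) u \<bullet> frechet_derivative (transition c d) (at x) v)" for u v
        unfolding q(1) transition_coord[OF chart q(2)] using conf c(1) q by blast
    qed
    moreover have "coord c p \<in> ?U" using c d by blast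
    ultimately show ?thesis
      using conformal_chart.conformally_flat_curvature_at[of ?U "transition c d" "coord d ` chart_dom d" f "g c" "coord c p" \<epsilon> \<mu>]
        \<epsilon> \<mu> unfolding transition_coord[OF chart c(2)] by blast
  qed
  then show ?thesis by blast
qed

theorem proposition1p9:
  fixes X :: "'a topology"
    and A :: "('a, 'n::finite) chart set"
    and g :: "('a, 'n) metric"
  assumes "riemannian_manifold X A g"
    and "compact_space X"
    and "locally_conformally_flat X A g"
    and "even CARD('n)"
    and "CARD('n) \<ge> 6"
  shows "einstein4 A g \<longleftrightarrow> thorpe4 A g"
proof -
  interpret riemannian_manifold X A g by fact
  have in_space: "p \<in> topspace X" if "c \<in> A" "p \<in> chart_dom c" for c p
    using cover that by blast
  \<comment> \<open>The eigenvalues are chosen per point, before any chart, because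
    \<open>einstein4\<close> asks for a multiplier that is a function of the point alone.\<close>
  have "\<forall>p\<in>topspace X. \<exists>l. \<forall>c\<in>A. p \<in> chart_dom c \<longrightarrow>
      (\<exists>e h. conformally_flat_curvature (g c (coord c p)) e h l (riemann (g c) (coord c p)))"
    using conformally_flat_fibre[OF assms(1,3)] by blast
  from bchoice[OF this] obtain l where l: "\<And>p c. p \<in> topspace X \<Longrightarrow> c \<in> A \<Longrightarrow> p \<in> chart_dom c \<Longrightarrow>
      \<exists>e h. conformally_flat_curvature (g c (coord c p)) e h (l p) (riemann (g c) (coord c p))"
    by blast
  let ?s = "\<lambda>p. star_sum (square_coeff (l p)) {..<CARD('n)}"
  show ?thesis
  proof
    assume "einstein4 A g"
    then obtain \<mu> where \<mu>: "\<And>c p. c \<in> A \<Longrightarrow> p \<in> chart_dom c \<Longrightarrow>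
        einstein4_at (g c (coord c p)) (riemann (g c) (coord c p)) (\<mu> p)"
      unfolding einstein4_def by blast
    show "thorpe4 A g"
      unfolding thorpe4_def
    proof (intro ballI)
      fix c p assume c: "c \<in> A" "p \<in> chart_dom c"
      obtain e h where "conformally_flat_curvature (g c (coord c p)) e h (l p) (riemann (g c) (coord c p))"
        using l[OF in_space[OF c] c] by blast
      then interpret conformally_flat_curvature "g c (coord c p)" e h "l p" "riemann (g c) (coord c p)" .
      have "?s p {} - ?s p {i} = \<mu> p" if "i < CARD('n)" for i
        using \<mu>[OF c] that unfolding einstein4_iff by blast
      then have "?s p {i} = ?s p {j}" if "i < CARD('n)" "j < CARD('n)" for i j
        using that by (smt (verit))
      then show "thorpe4_at (g c (coord c p)) (riemann (g c) (coord c p))"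
        by (rule star_const_imp_thorpe4[OF assms(4,5)])
    qed
  next
    assume thorpe: "thorpe4 A g"
    \<comment> \<open>The multiplier is \<open>h4\<close> minus the common diagonal entry of c^3 R^2
      / 3!, read off at the index \<open>0\<close>.\<close>
    have "einstein4_at (g c (coord c p)) (riemann (g c) (coord c p)) (?s p {} - ?s p {0})"
      if c: "c \<in> A" "p \<in> chart_dom c" for c p
    proof -
      obtain e h where "conformally_flat_curvature (g c (coord c p)) e h (l p) (riemann (g c) (coord c p))"
        using l[OF in_space[OF c] c] by blast
      then interpret conformally_flat_curvature "g c (coord c p)" e h "l p" "riemann (g c) (coord c p)" .
      have "thorpe4_at (g c (coord c p)) (riemann (g c) (coord c p))"
        using thorpe c unfolding thorpe4_def by blast
      then have "?s p {i} = ?s p {0}" if "i < CARD('n)" for i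
        by (rule thorpe4_imp_star_const[OF _ assms(4,5) that]) simp
      then show ?thesis unfolding einstein4_iff by metis
    qed
    then show "einstein4 A g"
      unfolding einstein4_def by (intro exI[of _ "\<lambda>p. ?s p {} - ?s p {0}"]) blast
  qed
qed

end
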